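(* Let $G=(V,E)$ be a graph and $d \geq 2$ an integer. The picture space $\mathcal{X}^d(G)$ is smooth if and only if $G$ is an orchard.
   Context: A graph $G=(V,E)$ consists of a finite nonempty set $V$ of vertices and a finite set $E$ of edges; each edge has two endpoints in $V$, not necessarily distinct. An edge whose endpoints coincide is a loop; parallel edges are allowed. An edge is an isthmus if deleting it increases the number of connected components of $G$. A graph is an orchard if every edge is either a loop or an isthmus. Picture space: a picture $\mathbf{P}$ of $G$ in $\mathbb{P}^d=\mathbb{P}^d_{\mathbb{C}}$ consists of a point $\mathbf{P}(v)\in\mathbb{P}^d$ for each $v\in V$ and a line $\mathbf{P}(e)\subset\mathbb{P}^d$ for each $e\in E$, such that $\mathbf{P}(v)\in\mathbf{P}(e)$ whenever $v$ is an endpoint of $e$. The set of all such pictures, a projective algebraic set over $\mathbb{C}$ (a closed subset of a product of Grassmannians), is $\mathcal{X}^d(G)$. *)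

theory Defs
  imports
    "HOL-Analysis.Analysis"
    "HOL-Library.Uprod"
    "HOL-Library.Extended_Nat"
    "HOL-Library.Function_Algebras"
begin

section \<open>Multigraphs\<close>

record ('v, 'e) graph =
  verts :: "'v set"
  edges :: "'e set"
  ends :: "'e \<Rightarrow> 'v uprod"

locale multigraph =
  fixes G :: "('v, 'e) graph"
  assumes finite_verts: "finite (verts G)"
    and verts_nonempty: "verts G \<noteq> {}"
    and finite_edges: "finite (edges G)"
    and ends_in_verts: "e \<in> edges G \<Longrightarrow> set_uprod (ends G e) \<subseteq> verts G"

definition adjacency :: "('v, 'e) graph \<Rightarrow> 'v rel" where
  "adjacency G = {(u, w). \<exists>e\<in>edges G. ends G e = Upair u w}"

definition components :: "('v, 'e) graph \<Rightarrow> 'v set set" where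
  "components G = verts G // ((adjacency G)\<^sup>* \<inter> verts G \<times> verts G)"

definition delete_edge :: "('v, 'e) graph \<Rightarrow> 'e \<Rightarrow> ('v, 'e) graph" where
  "delete_edge G e = G\<lparr>edges := edges G - {e}\<rparr>"

definition loop :: "('v, 'e) graph \<Rightarrow> 'e \<Rightarrow> bool" where
  "loop G e \<longleftrightarrow> (\<exists>v. ends G e = Upair v v)"

definition isthmus :: "('v, 'e) graph \<Rightarrow> 'e \<Rightarrow> bool" where
  "isthmus G e \<longleftrightarrow> card (components (delete_edge G e)) > card (components G)"

definition orchard :: "('v, 'e) graph \<Rightarrow> bool" where
  "orchard G \<longleftrightarrow> (\<forall>e\<in>edges G. loop G e \<or> isthmus G e)"


section \<open>Complex algebraic sets\<close>

text \<open>
  Affine space with coordinates indexed by a finite set \<open>K\<close> is the vector space of functions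
  \<open>'k \<Rightarrow> complex\<close> vanishing outside \<open>K\<close>. Since the ground field is infinite,
  polynomials are identified with the functions they induce.
\<close>

definition affine_space :: "'k set \<Rightarrow> ('k \<Rightarrow> complex) set" where
  "affine_space K = {z. \<forall>k. k \<notin> K \<longrightarrow> z k = 0}"

interpretation cfun: vector_space "\<lambda>(c :: complex) (z :: 'k \<Rightarrow> complex) k. c * z k"
  by unfold_locales (auto simp: fun_eq_iff algebra_simps)

inductive_set polynomials :: "'k set \<Rightarrow> (('k \<Rightarrow> complex) \<Rightarrow> complex) set" for K :: "'k set" where
  const: "(\<lambda>z. c) \<in> polynomials K"
| coord: "k \<in> K \<Longrightarrow> (\<lambda>z. z k) \<in> polynomials K"
| add: "f \<in> polynomials K \<Longrightarrow> g \<in> polynomials K \<Longrightarrow> (\<lambda>z. f z + g z) \<in> polynomials K"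
| mult: "f \<in> polynomials K \<Longrightarrow> g \<in> polynomials K \<Longrightarrow> (\<lambda>z. f z * g z) \<in> polynomials K"

definition zariski_closed :: "'k set \<Rightarrow> ('k \<Rightarrow> complex) set \<Rightarrow> bool" where
  "zariski_closed K Z \<longleftrightarrow>
     (\<exists>F\<subseteq>polynomials K. Z = {z \<in> affine_space K. \<forall>f\<in>F. f z = 0})"

definition irreducible_closed :: "'k set \<Rightarrow> ('k \<Rightarrow> complex) set \<Rightarrow> bool" where
  "irreducible_closed K Z \<longleftrightarrow> zariski_closed K Z \<and> Z \<noteq> {} \<and>
     (\<forall>A B. zariski_closed K A \<longrightarrow> zariski_closed K B \<longrightarrow> Z = A \<union> B \<longrightarrow> Z = A \<or> Z = B)"

definition vanishing_ideal ::
  "'k set \<Rightarrow> ('k \<Rightarrow> complex) set \<Rightarrow> (('k \<Rightarrow> complex) \<Rightarrow> complex) set" where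
  "vanishing_ideal K X = {f \<in> polynomials K. \<forall>z\<in>X. f z = 0}"

text \<open>The length of the longest chain of irreducible closed subsets of \<open>X\<close> through \<open>x\<close>,
  that is, the Krull dimension of the local ring of \<open>X\<close> at \<open>x\<close>.\<close>

definition local_dim :: "'k set \<Rightarrow> ('k \<Rightarrow> complex) set \<Rightarrow> ('k \<Rightarrow> complex) \<Rightarrow> enat" where
  "local_dim K X x = Sup {enat m |m. \<exists>Z :: nat \<Rightarrow> ('k \<Rightarrow> complex) set.
     (\<forall>i\<le>m. irreducible_closed K (Z i) \<and> x \<in> Z i \<and> Z i \<subseteq> X) \<and> (\<forall>i<m. Z i \<subset> Z (Suc i))}"

definition partial :: "'k \<Rightarrow> (('k \<Rightarrow> complex) \<Rightarrow> complex) \<Rightarrow> ('k \<Rightarrow> complex) \<Rightarrow> complex" where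
  "partial k f z = deriv (\<lambda>t. f (z(k := t))) (z k)"

definition tangent_space ::
  "'k set \<Rightarrow> ('k \<Rightarrow> complex) set \<Rightarrow> ('k \<Rightarrow> complex) \<Rightarrow> ('k \<Rightarrow> complex) set" where
  "tangent_space K X x =
     {\<xi> \<in> affine_space K. \<forall>f\<in>vanishing_ideal K X. (\<Sum>k\<in>K. partial k f x * \<xi> k) = 0}"

definition affine_smooth :: "'k set \<Rightarrow> ('k \<Rightarrow> complex) set \<Rightarrow> bool" where
  "affine_smooth K X \<longleftrightarrow> (\<forall>x\<in>X. enat (cfun.dim (tangent_space K X x)) = local_dim K X x)"

text \<open>
  Let \<open>\<B>\<close> be a finite set of pairwise disjoint finite blocks of homogeneous coordinates, and let
  \<open>C\<close> be the set of all homogeneous coordinate vectors of the points of a closed subset of the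
  product of the projective spaces with coordinate blocks \<open>b \<in> \<B>\<close>. This set is covered by its
  standard affine pieces, on each of which one chosen coordinate per block is normalised to 1;
  it is smooth if all these affine algebraic sets are.
\<close>

definition multiprojective_smooth :: "'k set set \<Rightarrow> ('k \<Rightarrow> complex) set \<Rightarrow> bool" where
  "multiprojective_smooth \<B> C \<longleftrightarrow>
     (\<forall>\<sigma>. (\<forall>b\<in>\<B>. \<sigma> b \<in> b) \<longrightarrow>
        affine_smooth (\<Union>\<B>) {z \<in> C. \<forall>b\<in>\<B>. z (\<sigma> b) = 1})"


section \<open>Picture spaces\<close>

definition grassmannian :: "nat \<Rightarrow> (complex ^ 'n::finite) set set" where
  "grassmannian r = {S. vec.subspace S \<and> vec.dim S = r}"

text \<open>Points and lines of projective \<open>d\<close>-space are the subspaces of dimension 1 and 2 of the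
  vector space \<open>complex ^ 'n\<close>, where \<open>CARD('n) = d + 1\<close>.\<close>

record ('v, 'e, 'n::finite) picture =
  point :: "'v \<Rightarrow> (complex ^ 'n) set"
  line :: "'e \<Rightarrow> (complex ^ 'n) set"

definition picture_space :: "('v, 'e) graph \<Rightarrow> ('v, 'e, 'n::finite) picture set" where
  "picture_space G =
     {P. point P \<in> verts G \<rightarrow>\<^sub>E grassmannian 1 \<and> line P \<in> edges G \<rightarrow>\<^sub>E grassmannian 2 \<and>
         (\<forall>e\<in>edges G. \<forall>v\<in>set_uprod (ends G e). point P v \<subseteq> line P e)}"

datatype ('v, 'e, 'n) coordinate = Pt 'v 'n | Pl 'e 'n 'n

definition blocks :: "('v, 'e) graph \<Rightarrow> ('v, 'e, 'n) coordinate set set" where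
  "blocks G = (\<lambda>v. {Pt v i |i. True}) ` verts G \<union> (\<lambda>e. {Pl e i j |i j. True}) ` edges G"

text \<open>A line is located by its Pluecker coordinates; all index pairs are kept, so these
  satisfy the linear relations \<open>Pl e i j = - Pl e j i\<close>.\<close>

definition homogeneous_coords ::
  "('v, 'e) graph \<Rightarrow> ('v, 'e, 'n::finite) picture \<Rightarrow> (('v, 'e, 'n) coordinate \<Rightarrow> complex) set" where
  "homogeneous_coords G P =
     {z \<in> affine_space (\<Union>(blocks G)).
        (\<forall>v\<in>verts G. \<exists>u. vec.span {u} = point P v \<and> (\<forall>i. z (Pt v i) = u $ i)) \<and>
        (\<forall>e\<in>edges G. \<exists>u w. vec.span {u, w} = line P e \<and>
           (\<forall>i j. z (Pl e i j) = u $ i * w $ j - u $ j * w $ i))}"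

definition smooth :: "('v, 'e) graph \<Rightarrow> ('v, 'e, 'n::finite) picture set \<Rightarrow> bool" where
  "smooth G X \<longleftrightarrow> multiprojective_smooth (blocks G) (\<Union>P\<in>X. homogeneous_coords G P)"

end

theory Submission
  imports Defs "HOL-Computational_Algebra.Polynomial"
begin

text \<open>
  An affine chart of the picture space is given by one equation per incidence of a vertex with an
  edge, so it depends only on the bipartite incidence graph. For an orchard this graph is a forest.
  Adding a point, a line through a given point, or a point on a given line to an incidence
  structure adds free coordinates and coordinates that are rational functions of the others,
  without pole at a prescribed picture. Hence near each picture the chart is the graph of a regular
  map on an open subset of an affine space, and it is smooth there.

  If an edge that is neither a loop nor an isthmus exists, consider the picture in which all points
  coincide and all lines coincide. It lies on lines in the chart whose directions span a space of
  dimension \<open>n = |V| + (d - 1)(c + |E|)\<close>, where \<open>c\<close> is the number of components of \<open>G\<close>. The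
  chart embeds in an affine space of this dimension, since the edge slopes transport the
  coordinates of one point to its whole component. Transporting along a cycle gives a nonzero
  polynomial vanishing on the image, so that the local dimension is less than \<open>n\<close>.

  Chains of irreducible closed sets are bounded by the growth of their coordinate rings:
  passing to a proper closed subset of an irreducible set divides the number of linearly
  independent functions of degree at most \<open>M\<close> by a quantity linear in \<open>M\<close>.
\<close>

section \<open>Polynomial functions\<close>

text \<open>Generators of the vanishing ideal of a chart are never computed. Tangent vectors are
  produced as velocities of curves inside the set, and tangent spaces are bounded above by single
  polynomials known to vanish on it. The degenerate picture is singular for the following reason. In
  affine coordinates a line has slopes and intercepts, and the i-th coordinates of two points on it
  differ by a slope times the difference of their \<open>\<kappa>\<close>-coordinates. At that
  picture both factors vanish, so the relation has no linear part: to first order the slopes and the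
  positions along the common line move independently. Around a cycle the products must cancel, an
  equation of order two that lowers the dimension but not the tangent space. It lives in a
  coordinate i other than \<open>\<omega>\<close> and \<open>\<kappa>\<close>, which is where d
  \<ge> 2 enters: a projective line contains only one line, and there the points move
  freely.\<close>

lemma polynomials_mono: "f \<in> polynomials S \<Longrightarrow> S \<subseteq> K \<Longrightarrow> f \<in> polynomials K"
  by (induction rule: polynomials.induct) (auto intro: polynomials.intros)

lemma polynomials_cong:
  "f \<in> polynomials K \<Longrightarrow> (\<And>k. k \<in> K \<Longrightarrow> z k = z' k) \<Longrightarrow> f z = f z'"
  by (induction rule: polynomials.induct) auto

lemma polynomials_uminus: "f \<in> polynomials K \<Longrightarrow> (\<lambda>z. - f z) \<in> polynomials K"
  using polynomials.mult[OF polynomials.const[of "-1"]] by simp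

lemma polynomials_diff:
  "f \<in> polynomials K \<Longrightarrow> g \<in> polynomials K \<Longrightarrow> (\<lambda>z. f z - g z) \<in> polynomials K"
  using polynomials.add[OF _ polynomials_uminus] by fastforce

lemma polynomials_power: "f \<in> polynomials K \<Longrightarrow> (\<lambda>z. f z ^ m) \<in> polynomials K"
  by (induction m) (auto intro: polynomials.intros)

lemma polynomials_prod:
  "(\<And>i. i \<in> I \<Longrightarrow> f i \<in> polynomials K) \<Longrightarrow> (\<lambda>z. \<Prod>i\<in>I. f i z) \<in> polynomials K"
  by (induction I rule: infinite_finite_induct) (auto intro: polynomials.intros)

lemma polynomials_sum:
  "(\<And>i. i \<in> I \<Longrightarrow> f i \<in> polynomials K) \<Longrightarrow> (\<lambda>z. \<Sum>i\<in>I. f i z) \<in> polynomials K"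
  by (induction I rule: infinite_finite_induct) (auto intro: polynomials.intros)

lemmas polynomials_intros =
  polynomials.intros polynomials_uminus polynomials_diff polynomials_power
  polynomials_prod polynomials_sum

text \<open>Finding a point where several polynomials are all nonzero is thereby reduced to avoiding
  the finitely many roots of a univariate polynomial over an infinite field.\<close>

lemma polynomial_on_line:
  assumes "f \<in> polynomials K"
  shows "\<exists>p. \<forall>t. f (\<lambda>k. a k + t * b k) = poly p t"
  using assms
proof (induction rule: polynomials.induct)
  case (const c)
  show ?case by (rule exI[of _ "[:c:]"]) simp
next
  case (coord k)
  show ?case by (rule exI[of _ "[:a k, b k:]"]) (simp add: mult.commute)
next
  case (add f g)
  then obtain p q where "\<forall>t. f (\<lambda>k. a k + t * b k) = poly p t" "\<forall>t. g (\<lambda>k. a k + t * b k) = poly q t"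
    by blast
  then show ?case by (intro exI[of _ "p + q"]) simp
next
  case (mult f g)
  then obtain p q where "\<forall>t. f (\<lambda>k. a k + t * b k) = poly p t" "\<forall>t. g (\<lambda>k. a k + t * b k) = poly q t"
    by blast
  then show ?case by (intro exI[of _ "p * q"]) simp
qed

section \<open>Partial derivatives and the chain rule for polynomials\<close>

lemma polynomial_partial:
  assumes "f \<in> polynomials K"
  shows "((\<lambda>t. f (z(k := t))) has_field_derivative partial k f z) (at (z k))"
proof -
  have "(\<lambda>t. f (z(k := t))) field_differentiable (at (z k))"
    using assms
  proof (induction rule: polynomials.induct)
    case (coord j)
    then show ?case by (cases "j = k") auto
  qed (auto intro: field_differentiable_add field_differentiable_mult)
  then show ?thesis
    by (simp add: partial_def field_differentiable_derivI)
qed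

lemma partial_const: "partial k (\<lambda>z. c) z = 0"
  by (simp add: partial_def)

lemma partial_coord: "partial k (\<lambda>z. z j) z = (if j = k then 1 else 0)"
  by (simp add: partial_def)

lemma partial_add:
  assumes "f \<in> polynomials K" "g \<in> polynomials K"
  shows "partial k (\<lambda>z. f z + g z) z = partial k f z + partial k g z"
  unfolding partial_def[of k "\<lambda>z. f z + g z"]
  by (intro DERIV_imp_deriv DERIV_add polynomial_partial[OF assms(1)] polynomial_partial[OF assms(2)])

lemma partial_mult:
  assumes "f \<in> polynomials K" "g \<in> polynomials K"
  shows "partial k (\<lambda>z. f z * g z) z = partial k f z * g z + f z * partial k g z"
proof -
  have "((\<lambda>t. f (z(k := t)) * g (z(k := t))) has_field_derivative
      partial k f z * g (z(k := z k)) + partial k g z * f (z(k := z k))) (at (z k))"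
    by (intro DERIV_mult polynomial_partial[OF assms(1)] polynomial_partial[OF assms(2)])
  then show ?thesis
    unfolding partial_def[of k "\<lambda>z. f z * g z"]
    by (simp add: DERIV_imp_deriv mult.commute)
qed

text \<open>Induction over f replaces differentiability in several variables; f depends only on the
  coordinates in K, so only these need derivatives along the curve.\<close>

lemma polynomial_chain_rule:
  assumes "finite K" "f \<in> polynomials K"
    and "\<And>k. k \<in> K \<Longrightarrow> ((\<lambda>t. c t k) has_field_derivative c' k) (at t0)"
  shows "((\<lambda>t. f (c t)) has_field_derivative (\<Sum>k\<in>K. partial k f (c t0) * c' k)) (at t0)"
  using assms(2)
proof (induction rule: polynomials.induct)
  case (const c)
  then show ?case by (simp add: partial_const)
next
  case (coord k)
  have "(\<Sum>j\<in>K. partial j (\<lambda>z. z k) (c t0) * c' j) = (\<Sum>j\<in>K. if k = j then c' j else 0)"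
    by (intro sum.cong) (auto simp: partial_coord)
  then show ?case
    using assms(1,3) coord by simp
next
  case (add f g)
  from DERIV_add[OF add.IH] show ?case
    by (simp add: partial_add[OF add.hyps] sum.distrib distrib_right)
next
  case (mult f g)
  from DERIV_mult[OF mult.IH] show ?case
    by (simp add: partial_mult[OF mult.hyps] sum.distrib sum_distrib_left sum_distrib_right
        algebra_simps)
qed

section \<open>Tangent spaces\<close>

text \<open>A function vanishing on X is zero along the curve near 0, and the chain rule identifies
  its derivative there with the tangency condition. This yields tangent vectors without knowing the
  ideal.\<close>

lemma tangent_spaceI_curve:
  assumes "finite K" "\<xi> \<in> affine_space K"
    and "\<And>k. k \<in> K \<Longrightarrow> ((\<lambda>t. c t k) has_field_derivative \<xi> k) (at 0)"
    and "c 0 = x" and "eventually (\<lambda>t. c t \<in> X) (nhds 0)"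
  shows "\<xi> \<in> tangent_space K X x"
proof -
  have "(\<Sum>k\<in>K. partial k f x * \<xi> k) = 0" if f: "f \<in> vanishing_ideal K X" for f
  proof -
    have "((\<lambda>t. f (c t)) has_field_derivative (\<Sum>k\<in>K. partial k f (c 0) * \<xi> k)) (at 0)"
      using assms f by (intro polynomial_chain_rule) (auto simp: vanishing_ideal_def)
    moreover have "((\<lambda>t. f (c t)) has_field_derivative 0) (at 0)"
    proof (rule DERIV_cong_ev[THEN iffD1, rotated -1])
      show "((\<lambda>t. 0) has_field_derivative 0) (at (0::complex))" by simp
      show "\<forall>\<^sub>F t in nhds 0. 0 = f (c t)"
        using assms(5) by eventually_elim (use f in \<open>auto simp: vanishing_ideal_def\<close>)
    qed auto
    ultimately show ?thesis
      using DERIV_unique assms(4) by blast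
  qed
  then show ?thesis
    using assms(2) by (simp add: tangent_space_def)
qed

text \<open>Used in the opposite direction: one explicit equation of X excludes every direction
  along which it does not vanish to first order.\<close>

lemma tangent_space_line:
  assumes "finite K" "\<xi> \<in> tangent_space K X x" "f \<in> vanishing_ideal K X"
  shows "((\<lambda>t. f (\<lambda>k. x k + t * \<xi> k)) has_field_derivative 0) (at 0)"
proof -
  have "((\<lambda>t. f (\<lambda>k. x k + t * \<xi> k)) has_field_derivative
      (\<Sum>k\<in>K. partial k f (\<lambda>k. x k + 0 * \<xi> k) * \<xi> k)) (at 0)"
    using assms
    by (intro polynomial_chain_rule) (auto simp: vanishing_ideal_def intro!: derivative_eq_intros)
  then show ?thesis
    using assms by (simp add: tangent_space_def)
qed

lemma subspace_tangent_space: "cfun.subspace (tangent_space K X x)"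
proof (rule cfun.subspaceI)
  fix \<xi> \<zeta> c
  assume \<xi>: "\<xi> \<in> tangent_space K X x"
  have "(\<Sum>k\<in>K. partial k f x * (c * \<xi> k)) = c * (\<Sum>k\<in>K. partial k f x * \<xi> k)" for f
    by (simp add: sum_distrib_left mult.left_commute)
  with \<xi> show "(\<lambda>k. c * \<xi> k) \<in> tangent_space K X x"
    by (simp add: tangent_space_def affine_space_def)
  assume "\<zeta> \<in> tangent_space K X x"
  with \<xi> show "\<xi> + \<zeta> \<in> tangent_space K X x"
    by (simp add: tangent_space_def affine_space_def distrib_left sum.distrib)
qed (simp add: tangent_space_def affine_space_def)

section \<open>Dimension counts by dual families of vectors\<close>

lemma sum_fun_apply: "(\<Sum>i\<in>I. f i) x = (\<Sum>i\<in>I. f i x)"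
  for f :: "'i \<Rightarrow> 'a \<Rightarrow> 'b::comm_monoid_add"
  by (induction I rule: infinite_finite_induct) auto

lemma affine_space_span:
  assumes "finite K"
  shows "affine_space K \<subseteq> cfun.span ((\<lambda>k j. if j = k then 1 else 0) ` K)"
proof
  fix z :: "'a \<Rightarrow> complex"
  assume "z \<in> affine_space K"
  then have "z = (\<Sum>k\<in>K. (\<lambda>j. z k * (if j = k then 1 else 0)))"
    using assms by (auto simp: fun_eq_iff affine_space_def sum_fun_apply if_distrib cong: if_cong)
  also have "\<dots> \<in> cfun.span ((\<lambda>k j. if j = k then 1 else 0) ` K)"
    by (intro cfun.span_sum cfun.span_scale cfun.span_base) auto
  finally show "z \<in> cfun.span ((\<lambda>k j. if j = k then 1 else 0) ` K)" .
qed

lemma independent_dual_family: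
  assumes "finite S" "\<And>j k. j \<in> S \<Longrightarrow> k \<in> S \<Longrightarrow> \<eta> k j = (if j = k then 1 else 0)"
  shows "cfun.independent (\<eta> ` S)" "inj_on \<eta> S"
proof -
  show inj: "inj_on \<eta> S"
    by (rule inj_onI) (metis assms(2) zero_neq_one)
  have "u (\<eta> k) = 0"
    if u: "(\<Sum>v\<in>\<eta> ` S. (\<lambda>j. u v * v j)) = 0" and k: "k \<in> S" for u k
  proof -
    have "0 = (\<Sum>i\<in>S. (\<lambda>j. u (\<eta> i) * \<eta> i j)) k"
      using u by (simp add: sum.reindex[OF inj])
    also have "\<dots> = (\<Sum>i\<in>S. if k = i then u (\<eta> i) else 0)"
      unfolding sum_fun_apply using assms(2) k by (intro sum.cong) auto
    finally show ?thesis
      using k assms(1) by simp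
  qed
  then show "cfun.independent (\<eta> ` S)"
    using assms(1) by (subst cfun.dependent_finite) auto
qed

text \<open>The dual family is extended to a basis of V. Containment in a space spanned by finitely
  many unit vectors keeps this basis finite; for an infinite one \<open>card\<close> would be
  0.\<close>

lemma card_le_dim_dual_family:
  assumes "finite K" "V \<subseteq> affine_space K" "finite S" "\<And>k. k \<in> S \<Longrightarrow> \<eta> k \<in> V"
    and "\<And>j k. j \<in> S \<Longrightarrow> k \<in> S \<Longrightarrow> \<eta> k j = (if j = k then 1 else 0)"
  shows "card S \<le> cfun.dim V"
proof -
  obtain B where B: "\<eta> ` S \<subseteq> B" "B \<subseteq> V" "cfun.independent B" "V \<subseteq> cfun.span B"
  proof (rule cfun.maximal_independent_subset_extend)
    show "\<eta> ` S \<subseteq> V" using assms(4) by blast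
    show "cfun.independent (\<eta> ` S)" using assms(3,5) by (rule independent_dual_family)
  qed
  have "B \<subseteq> cfun.span ((\<lambda>k j. if j = k then 1 else 0) ` K)"
    using B(2) assms(2) affine_space_span[OF assms(1)] by (rule subset_trans[OF subset_trans])
  then have "finite B"
    using cfun.independent_span_bound[OF finite_imageI[OF assms(1)] B(3)] by simp
  then have "card (\<eta> ` S) \<le> card B"
    using B(1) card_mono by blast
  moreover have "card (\<eta> ` S) = card S"
    by (intro card_image independent_dual_family(2)) (use assms in auto)
  moreover have "card B = cfun.dim V"
    using B(2,4,3) by (rule cfun.basis_card_eq_dim)
  ultimately show ?thesis by simp
qed

text \<open>Projection to the coordinates in S is injective on V by the last hypothesis, and the
  dual family makes it surjective.\<close>

lemma dim_eq_card_dual_family: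
  assumes "cfun.subspace V" "finite S" "\<And>k. k \<in> S \<Longrightarrow> \<eta> k \<in> V"
    and "\<And>j k. j \<in> S \<Longrightarrow> k \<in> S \<Longrightarrow> \<eta> k j = (if j = k then 1 else 0)"
    and "\<And>\<xi>. \<xi> \<in> V \<Longrightarrow> (\<And>k. k \<in> S \<Longrightarrow> \<xi> k = 0) \<Longrightarrow> \<xi> = 0"
  shows "cfun.dim V = card S"
proof -
  have "V \<subseteq> cfun.span (\<eta> ` S)"
  proof
    fix \<xi> assume \<xi>: "\<xi> \<in> V"
    define \<zeta> where "\<zeta> = (\<Sum>k\<in>S. (\<lambda>j. \<xi> k * \<eta> k j))"
    have "\<zeta> \<in> V"
      unfolding \<zeta>_def using assms(1,3)
      by (intro cfun.subspace_sum cfun.subspace_scale) auto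
    moreover have "\<zeta> j = \<xi> j" if "j \<in> S" for j
    proof -
      have "\<zeta> j = (\<Sum>k\<in>S. if j = k then \<xi> k else 0)"
        unfolding \<zeta>_def sum_fun_apply using assms(4) that by (intro sum.cong) auto
      then show ?thesis using that assms(2) by simp
    qed
    ultimately have "\<xi> - \<zeta> = 0"
      using \<xi> by (intro assms(5) cfun.subspace_diff[OF assms(1)]) auto
    then have "\<xi> = \<zeta>" by simp
    also have "\<zeta> \<in> cfun.span (\<eta> ` S)"
      unfolding \<zeta>_def by (intro cfun.span_sum cfun.span_scale cfun.span_base) auto
    finally show "\<xi> \<in> cfun.span (\<eta> ` S)" .
  qed
  then have "cfun.dim V = card (\<eta> ` S)"
    using assms(3) independent_dual_family(1)[OF assms(2,4)]
    by (intro cfun.dim_unique) auto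
  then show ?thesis
    using card_image[OF independent_dual_family(2)[OF assms(2,4)]] by simp
qed

section \<open>Closed sets without zero divisors\<close>

text \<open>For nonempty Z this says that the ring of polynomial functions on Z is a domain. Unlike
  \<open>irreducible_closed\<close> it applies to sets that are not closed, such as open pieces of a
  graph.\<close>

definition integral_set :: "'k set \<Rightarrow> ('k \<Rightarrow> complex) set \<Rightarrow> bool" where
  "integral_set K Z \<longleftrightarrow> (\<forall>f\<in>polynomials K. \<forall>g\<in>polynomials K.
     (\<forall>z\<in>Z. f z * g z = 0) \<longrightarrow> (\<forall>z\<in>Z. f z = 0) \<or> (\<forall>z\<in>Z. g z = 0))"

lemma integral_setD:
  assumes "integral_set K Z" "f \<in> polynomials K" "g \<in> polynomials K"
    and "\<And>z. z \<in> Z \<Longrightarrow> f z * g z = 0" "z0 \<in> Z" "f z0 \<noteq> 0" "z \<in> Z"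
  shows "g z = 0"
proof -
  have "(\<forall>z\<in>Z. f z = 0) \<or> (\<forall>z\<in>Z. g z = 0)"
    using assms(1)[unfolded integral_set_def, rule_format, OF assms(2,3)] assms(4) by simp
  with assms(5-7) show ?thesis by blast
qed

lemma zariski_closed_subset: "zariski_closed K Z \<Longrightarrow> Z \<subseteq> affine_space K"
  by (auto simp: zariski_closed_def)

lemma zariski_closed_separate:
  assumes "zariski_closed K Z" "z \<in> affine_space K" "z \<notin> Z"
  obtains f where "f \<in> vanishing_ideal K Z" "f z \<noteq> 0"
proof -
  from assms(1) obtain F where F: "F \<subseteq> polynomials K" "Z = {z \<in> affine_space K. \<forall>f\<in>F. f z = 0}"
    by (auto simp: zariski_closed_def)
  with assms(2,3) obtain f where "f \<in> F" "f z \<noteq> 0" by blast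
  with F that show thesis by (auto simp: vanishing_ideal_def)
qed

lemma zariski_closed_zero_locus:
  assumes "zariski_closed K Z" "f \<in> polynomials K"
  shows "zariski_closed K {z \<in> Z. f z = 0}"
proof -
  from assms(1) obtain F where "F \<subseteq> polynomials K" "Z = {z \<in> affine_space K. \<forall>f\<in>F. f z = 0}"
    by (auto simp: zariski_closed_def)
  with assms(2) show ?thesis
    unfolding zariski_closed_def by (intro exI[of _ "insert f F"]) auto
qed

lemma irreducible_closed_integral:
  assumes "irreducible_closed K Z"
  shows "integral_set K Z"
  unfolding integral_set_def
proof (intro ballI impI)
  fix f g assume f: "f \<in> polynomials K" and g: "g \<in> polynomials K"
    and fg: "\<forall>z\<in>Z. f z * g z = 0"
  have "Z = {z \<in> Z. f z = 0} \<union> {z \<in> Z. g z = 0}" using fg by auto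
  then have "Z = {z \<in> Z. f z = 0} \<or> Z = {z \<in> Z. g z = 0}"
    using assms f g zariski_closed_zero_locus unfolding irreducible_closed_def by blast
  then show "(\<forall>z\<in>Z. f z = 0) \<or> (\<forall>z\<in>Z. g z = 0)" by blast
qed

section \<open>Zariski closures and irreducibility\<close>

definition zariski_closure :: "'k set \<Rightarrow> ('k \<Rightarrow> complex) set \<Rightarrow> ('k \<Rightarrow> complex) set" where
  "zariski_closure K U = {z \<in> affine_space K. \<forall>f\<in>vanishing_ideal K U. f z = 0}"

lemma zariski_closed_closure: "zariski_closed K (zariski_closure K U)"
  unfolding zariski_closed_def zariski_closure_def
  by (intro exI[of _ "vanishing_ideal K U"]) (auto simp: vanishing_ideal_def)

lemma zariski_closure_subset: "U \<subseteq> affine_space K \<Longrightarrow> U \<subseteq> zariski_closure K U"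
  by (auto simp: zariski_closure_def vanishing_ideal_def)

lemma zariski_closure_mono: "U \<subseteq> U' \<Longrightarrow> zariski_closure K U \<subseteq> zariski_closure K U'"
  by (auto simp: zariski_closure_def vanishing_ideal_def)

lemma zariski_closure_minimal:
  assumes "zariski_closed K X" "U \<subseteq> X"
  shows "zariski_closure K U \<subseteq> X"
proof
  fix z assume z: "z \<in> zariski_closure K U"
  show "z \<in> X"
  proof (rule ccontr)
    assume "z \<notin> X"
    with z assms(1) obtain f where "f \<in> vanishing_ideal K X" "f z \<noteq> 0"
      by (metis (no_types, lifting) mem_Collect_eq zariski_closed_separate zariski_closure_def)
    with z assms(2) show False
      by (auto simp: zariski_closure_def vanishing_ideal_def)
  qed
qed

text \<open>Polynomials vanishing on U vanish on its closure. If the closure were a union of two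
  proper closed parts, functions separating a point from each part would be zero divisors on
  U.\<close>

lemma irreducible_closure:
  assumes "integral_set K U" "U \<noteq> {}" "U \<subseteq> affine_space K"
  shows "irreducible_closed K (zariski_closure K U)"
  unfolding irreducible_closed_def
proof (intro conjI allI impI zariski_closed_closure)
  let ?Z = "zariski_closure K U"
  show "?Z \<noteq> {}" using zariski_closure_subset assms(2,3) by blast
  fix A B assume AB: "zariski_closed K A" "zariski_closed K B" "?Z = A \<union> B"
  show "?Z = A \<or> ?Z = B"
  proof (rule ccontr)
    assume "\<not> (?Z = A \<or> ?Z = B)"
    then obtain a b where ab: "a \<in> ?Z" "a \<notin> A" "b \<in> ?Z" "b \<notin> B" using AB(3) by blast
    then have "a \<in> affine_space K" "b \<in> affine_space K" by (auto simp: zariski_closure_def)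
    with ab AB obtain f g where
      f: "f \<in> vanishing_ideal K A" "f a \<noteq> 0" and g: "g \<in> vanishing_ideal K B" "g b \<noteq> 0"
      by (metis zariski_closed_separate)
    have "\<forall>z\<in>U. f z * g z = 0"
      using f(1) g(1) AB(3) zariski_closure_subset[OF assms(3)]
      by (auto simp: vanishing_ideal_def)
    then have "(\<forall>z\<in>U. f z = 0) \<or> (\<forall>z\<in>U. g z = 0)"
      using assms(1) f(1) g(1) by (auto simp: integral_set_def vanishing_ideal_def)
    then show False
      using ab f g by (auto simp: zariski_closure_def vanishing_ideal_def)
  qed
qed

section \<open>Growth of coordinate rings and chains of irreducible sets\<close>

definition monomial :: "'k set \<Rightarrow> ('k \<Rightarrow> nat) \<Rightarrow> ('k \<Rightarrow> complex) \<Rightarrow> complex" where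
  "monomial K \<alpha> z = (\<Prod>k\<in>K. z k ^ \<alpha> k)"

text \<open>The bound M applies to each exponent separately, so there are exactly (M + 1) ^ card K
  exponents for finite K, and the bounds add under multiplication.\<close>

definition monomial_box :: "'k set \<Rightarrow> nat \<Rightarrow> (('k \<Rightarrow> complex) \<Rightarrow> complex) set" where
  "monomial_box K M = cfun.span (monomial K ` (K \<rightarrow>\<^sub>E {..M}))"

lemma monomial_add: "monomial K \<alpha> z * monomial K \<beta> z = monomial K (\<lambda>k. \<alpha> k + \<beta> k) z"
  by (simp add: monomial_def power_add prod.distrib)

lemma monomial_in_monomial_box:
  assumes "\<And>k. k \<in> K \<Longrightarrow> \<alpha> k \<le> M"
  shows "monomial K \<alpha> \<in> monomial_box K M"
proof -
  have "monomial K \<alpha> = monomial K (restrict \<alpha> K)"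
    by (auto simp: fun_eq_iff monomial_def)
  then show ?thesis
    using assms unfolding monomial_box_def by (intro cfun.span_base) auto
qed

lemma monomial_box_mono: "M \<le> N \<Longrightarrow> monomial_box K M \<subseteq> monomial_box K N"
  unfolding monomial_box_def by (intro cfun.span_mono image_mono PiE_mono) auto

lemma monomial_box_add: "f \<in> monomial_box K M \<Longrightarrow> g \<in> monomial_box K M \<Longrightarrow> (\<lambda>z. f z + g z) \<in> monomial_box K M"
  using cfun.span_add[of f _ g] by (simp add: monomial_box_def plus_fun_def)

lemma monomial_box_scale: "f \<in> monomial_box K M \<Longrightarrow> (\<lambda>z. c * f z) \<in> monomial_box K M"
  using cfun.span_scale[of f] by (simp add: monomial_box_def)

lemma monomial_box_induct [consumes 1, case_names zero step]:
  assumes "f \<in> monomial_box K M" "P (\<lambda>z. 0)"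
    and "\<And>c \<alpha> g. \<alpha> \<in> K \<rightarrow>\<^sub>E {..M} \<Longrightarrow> P g \<Longrightarrow> P (\<lambda>z. c * monomial K \<alpha> z + g z)"
  shows "P f"
  using assms(1) unfolding monomial_box_def
proof (induction rule: cfun.span_induct_alt)
  case base
  then show ?case using assms(2) by (simp add: zero_fun_def)
next
  case (step c x y)
  then show ?case using assms(3)[of _ y c] by (auto simp: plus_fun_def)
qed

lemma monomial_box_mult:
  assumes "f \<in> monomial_box K M" "g \<in> monomial_box K N"
  shows "(\<lambda>z. f z * g z) \<in> monomial_box K (M + N)"
  using assms(1)
proof (induction rule: monomial_box_induct)
  case zero
  then show ?case using cfun.span_zero by (simp add: monomial_box_def zero_fun_def)
next
  case (step c \<alpha> f)
  have "(\<lambda>z. monomial K \<alpha> z * g z) \<in> monomial_box K (M + N)"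
    using assms(2)
  proof (induction rule: monomial_box_induct)
    case zero
    then show ?case using cfun.span_zero by (simp add: monomial_box_def zero_fun_def)
  next
    case (step d \<beta> g)
    have "(\<lambda>z. d * monomial K (\<lambda>k. \<alpha> k + \<beta> k) z + monomial K \<alpha> z * g z) \<in> monomial_box K (M + N)"
      using step \<open>\<alpha> \<in> K \<rightarrow>\<^sub>E {..M}\<close>
      by (intro monomial_box_add monomial_box_scale monomial_in_monomial_box) (auto simp: PiE_iff intro!: add_mono)
    then show ?case by (simp add: monomial_add[symmetric] algebra_simps)
  qed
  from monomial_box_add[OF monomial_box_scale[OF this, of c] step.IH] show ?case
    by (simp add: algebra_simps)
qed

lemma monomial_box_const: "(\<lambda>z. c) \<in> monomial_box K M"
  using monomial_box_scale[OF monomial_in_monomial_box[of K "\<lambda>_. 0" M], of c] by (simp add: monomial_def)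

lemma polynomials_in_monomial_box:
  assumes "finite K" "f \<in> polynomials K"
  shows "\<exists>M. f \<in> monomial_box K M"
  using assms(2)
proof (induction rule: polynomials.induct)
  case (const c)
  then show ?case using monomial_box_const by blast
next
  case (coord k)
  have eq: "monomial K (\<lambda>j. if j = k then 1 else 0) = (\<lambda>z. z k)"
    using assms(1) coord by (auto simp: fun_eq_iff monomial_def if_distrib cong: if_cong)
  have "monomial K (\<lambda>j. if j = k then 1 else 0) \<in> monomial_box K 1"
    by (rule monomial_in_monomial_box) auto
  then show ?case unfolding eq by blast
next
  case (add f g)
  then obtain M N where "f \<in> monomial_box K M" "g \<in> monomial_box K N" by blast
  then have "f \<in> monomial_box K (max M N)" "g \<in> monomial_box K (max M N)"
    using monomial_box_mono max.cobounded1 max.cobounded2 by blast+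
  then show ?case using monomial_box_add by blast
next
  case (mult f g)
  then show ?case using monomial_box_mult by blast
qed

lemma monomial_box_power: "f \<in> monomial_box K e \<Longrightarrow> (\<lambda>z. f z ^ i) \<in> monomial_box K (i * e)"
proof (induction i)
  case (Suc i)
  then show ?case using monomial_box_mult[of f K e "\<lambda>z. f z ^ i" "i * e"] by simp
qed (simp add: monomial_box_const)

lemma monomial_box_polynomials: "f \<in> monomial_box K M \<Longrightarrow> f \<in> polynomials K"
  by (induction rule: monomial_box_induct)
    (auto simp: monomial_def intro!: polynomials_intros)

text \<open>Independence of the restrictions to Z. It concerns an indexed family, so a repeated
  function counts as dependent.\<close>

definition indep_on ::
  "('k \<Rightarrow> complex) set \<Rightarrow> 'i set \<Rightarrow> ('i \<Rightarrow> ('k \<Rightarrow> complex) \<Rightarrow> complex) \<Rightarrow> bool" where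
  "indep_on Z I G \<longleftrightarrow>
     (\<forall>c. (\<forall>z\<in>Z. (\<Sum>i\<in>I. c i * G i z) = 0) \<longrightarrow> (\<forall>i\<in>I. c i = 0))"

lemma indep_onD:
  "indep_on Z I G \<Longrightarrow> (\<And>z. z \<in> Z \<Longrightarrow> (\<Sum>i\<in>I. c i * G i z) = 0) \<Longrightarrow> i \<in> I \<Longrightarrow> c i = 0"
  by (auto simp: indep_on_def)

lemma indep_on_card_le:
  assumes "finite K" "finite I" "indep_on Z I G" "\<And>i. i \<in> I \<Longrightarrow> G i \<in> monomial_box K M"
  shows "card I \<le> (M + 1) ^ card K"
proof -
  have inj: "inj_on G I"
  proof (rule inj_onI)
    fix i j assume ij: "i \<in> I" "j \<in> I" "G i = G j"
    show "i = j"
    proof (rule ccontr)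
      assume "i \<noteq> j"
      define c :: "'b \<Rightarrow> complex" where "c l = (if l = i then 1 else if l = j then -1 else 0)" for l
      have "(\<Sum>l\<in>I. c l * G l z) = (\<Sum>l\<in>{i, j}. c l * G l z)" for z
        using ij assms(2) by (intro sum.mono_neutral_right) (auto simp: c_def)
      then have "(\<Sum>l\<in>I. c l * G l z) = 0" for z
        using \<open>i \<noteq> j\<close> ij by (simp add: c_def)
      from indep_onD[OF assms(3) this ij(1)] show False by (simp add: c_def)
    qed
  qed
  have "cfun.independent (G ` I)"
  proof (subst cfun.dependent_finite)
    show "finite (G ` I)" using assms(2) by simp
    show "\<not> (\<exists>u. (\<exists>v\<in>G ` I. u v \<noteq> 0) \<and> (\<Sum>v\<in>G ` I. (\<lambda>k. u v * v k)) = 0)"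
    proof clarify
      fix u i assume u: "(\<Sum>v\<in>G ` I. (\<lambda>k. u v * v k)) = 0" and i: "i \<in> I" "u (G i) \<noteq> 0"
      have "(\<Sum>i\<in>I. u (G i) * G i z) = 0" for z
        using fun_cong[OF u, of z] by (simp add: sum.reindex[OF inj] sum_fun_apply)
      from indep_onD[OF assms(3) this i(1)] i(2) show False by simp
    qed
  qed
  moreover have "G ` I \<subseteq> cfun.span (monomial K ` (K \<rightarrow>\<^sub>E {..M}))"
    using assms(4) by (auto simp: monomial_box_def)
  moreover have "finite (monomial K ` (K \<rightarrow>\<^sub>E {..M}))"
    using assms(1) by (intro finite_imageI finite_PiE) auto
  ultimately have "card (G ` I) \<le> card (monomial K ` (K \<rightarrow>\<^sub>E {..M}))"
    using cfun.independent_span_bound by blast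
  also have "\<dots> \<le> card (K \<rightarrow>\<^sub>E {..M})"
    using assms(1) by (intro card_image_le finite_PiE) auto
  also have "\<dots> = (M + 1) ^ card K"
    using assms(1) by (simp add: card_PiE)
  finally show ?thesis using card_image[OF inj] by simp
qed

text \<open>A substitute for an upper bound on the degree of the Hilbert polynomial of \<open>Z\<close>. Every
  finite family can be indexed by a subset of \<open>nat \<times> nat\<close>.\<close>

definition growth :: "'k set \<Rightarrow> ('k \<Rightarrow> complex) set \<Rightarrow> nat \<Rightarrow> bool" where
  "growth K Z n \<longleftrightarrow> (\<exists>C. \<forall>M (I :: (nat \<times> nat) set) G. finite I \<longrightarrow>
     (\<forall>i\<in>I. G i \<in> monomial_box K M) \<longrightarrow> indep_on Z I G \<longrightarrow> card I \<le> C * (M + 1) ^ n)"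

lemma growth_mono:
  assumes "growth K Z n" "Y \<subseteq> Z"
  shows "growth K Y n"
proof -
  have "indep_on Y I G \<Longrightarrow> indep_on Z I G" for I :: "(nat \<times> nat) set" and G
    using assms(2) unfolding indep_on_def by blast
  with assms(1) show ?thesis unfolding growth_def by meson
qed

text \<open>Restricting a linear relation to \<open>Y\<close> shows that the terms without \<open>f\<close> cancel, and the
  remaining terms can be divided by \<open>f\<close>.\<close>

lemma indep_on_powers:
  assumes "Y \<subseteq> Z" "integral_set K Z" "f \<in> polynomials K" "\<And>z. z \<in> Y \<Longrightarrow> f z = 0"
    and "\<exists>z\<in>Z. f z \<noteq> 0" "finite I" "indep_on Y I G" "\<And>i. i \<in> I \<Longrightarrow> G i \<in> polynomials K"
  shows "indep_on Z ({..<m} \<times> I) (\<lambda>(j, i) z. f z ^ j * G i z)"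
proof (induction m)
  case 0
  then show ?case by (simp add: indep_on_def)
next
  case (Suc m)
  show ?case
    unfolding indep_on_def
  proof (intro allI impI)
    fix c assume c: "\<forall>z\<in>Z. (\<Sum>p\<in>{..<Suc m} \<times> I. c p * (case p of (j, i) \<Rightarrow> \<lambda>z. f z ^ j * G i z) z) = 0"
    define s where "s z = (\<Sum>j<m. \<Sum>i\<in>I. c (Suc j, i) * (f z ^ j * G i z))" for z
    have split: "(\<Sum>i\<in>I. c (0, i) * G i z) + f z * s z = 0" if "z \<in> Z" for z
    proof -
      have "0 = (\<Sum>j<Suc m. \<Sum>i\<in>I. c (j, i) * (f z ^ j * G i z))"
        using c that by (simp add: sum.cartesian_product case_prod_beta)
      also have "\<dots> = (\<Sum>i\<in>I. c (0, i) * G i z) + f z * s z"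
        by (subst sum.lessThan_Suc_shift)
          (simp add: s_def sum_distrib_left mult.assoc mult.left_commute)
      finally show ?thesis by simp
    qed
    then have "(\<Sum>i\<in>I. c (0, i) * G i z) = 0" if "z \<in> Y" for z
      using assms(1,4) that by fastforce
    then have c0: "c (0, i) = 0" if "i \<in> I" for i
      using indep_onD[OF assms(7), of "\<lambda>i. c (0, i)"] that by blast
    with split have fs: "\<forall>z\<in>Z. f z * s z = 0" by simp
    have "s \<in> polynomials K"
      unfolding s_def[abs_def] using assms(3,8) by (intro polynomials_intros)
    then have "\<forall>z\<in>Z. s z = 0"
      using fs assms(2,3,5) unfolding integral_set_def by blast
    then have "(\<Sum>p\<in>{..<m} \<times> I. c (Suc (fst p), snd p) * (case p of (j, i) \<Rightarrow> \<lambda>z. f z ^ j * G i z) z) = 0"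
      if "z \<in> Z" for z
      using that by (simp add: s_def sum.cartesian_product case_prod_beta)
    from indep_onD[OF Suc.IH this] have "c (Suc j, i) = 0" if "j < m" "i \<in> I" for j i
      using that by fastforce
    with c0 show "\<forall>p\<in>{..<Suc m} \<times> I. c p = 0"
      by (auto simp: less_Suc_eq_0_disj)
  qed
qed


text \<open>Multiplying a family independent on Y by the powers f ^ j with j < m gives m times as
  many functions independent on Z, while the degrees grow only by m * e. Choosing m proportional to
  the degree bound gains one factor M + 1.\<close>

lemma growth_proper_subset:
  assumes "finite K" "growth K Z n" "Y \<subseteq> Z" "Y \<noteq> {}" "integral_set K Z"
    and "f \<in> polynomials K" "\<And>z. z \<in> Y \<Longrightarrow> f z = 0" "\<exists>z\<in>Z. f z \<noteq> 0"
  shows "0 < n" "growth K Y (n - 1)"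
proof -
  obtain e where e: "f \<in> monomial_box K e"
    using polynomials_in_monomial_box assms(1,6) by blast
  from assms(2)[unfolded growth_def] obtain C where
    C: "\<forall>M (I :: (nat \<times> nat) set) G. finite I \<longrightarrow> (\<forall>i\<in>I. G i \<in> monomial_box K M) \<longrightarrow>
      indep_on Z I G \<longrightarrow> card I \<le> C * (M + 1) ^ n" ..
  have main: "m * card I \<le> C * (m * e + M + 1) ^ n"
    if I: "finite I" and G: "\<And>i. i \<in> I \<Longrightarrow> G i \<in> monomial_box K M" and ind: "indep_on Y I G"
    for m M and I :: "(nat \<times> nat) set" and G
  proof -
    \<comment> \<open>\<open>growth\<close> speaks about index sets inside nat \<times> nat.
      Numbering I by an initial segment of nat makes the pairs of a power and an index such a set
      again.\<close>
    obtain h :: "nat \<Rightarrow> nat \<times> nat" where h: "bij_betw h {..<card I} I"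
      using I ex_bij_betw_nat_finite[OF I] by (auto simp: atLeast0LessThan)
    have "inj_on h {..<card I}" and hI: "\<And>i. i < card I \<Longrightarrow> h i \<in> I"
      using h by (auto simp: bij_betw_def)
    have "indep_on Y {..<card I} (\<lambda>i. G (h i))"
      unfolding indep_on_def
    proof (intro allI impI ballI)
      fix c i assume c: "\<forall>z\<in>Y. (\<Sum>i<card I. c i * G (h i) z) = 0" and i: "i \<in> {..<card I}"
      define c' where "c' = c \<circ> inv_into {..<card I} h"
      have c': "c' (h j) = c j" if "j < card I" for j
        using that \<open>inj_on h {..<card I}\<close> by (simp add: c'_def)
      have "(\<Sum>i\<in>I. c' i * G i z) = 0" if "z \<in> Y" for z
      proof -
        have "(\<Sum>i\<in>I. c' i * G i z) = (\<Sum>i<card I. c' (h i) * G (h i) z)"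
          by (rule sum.reindex_bij_betw[OF h, symmetric])
        also have "\<dots> = (\<Sum>i<card I. c i * G (h i) z)" by (simp add: c')
        finally show ?thesis using c that by simp
      qed
      from indep_onD[OF ind this, of "h i"] show "c i = 0"
        using i hI c' by simp
    qed
    then have "indep_on Z ({..<m} \<times> {..<card I}) (\<lambda>(j, i) z. f z ^ j * G (h i) z)"
      by (rule indep_on_powers[OF assms(3,5,6) _ assms(8) finite_lessThan, rotated])
        (simp_all add: assms(7) monomial_box_polynomials[OF G[OF hI]])
    moreover have "(case p of (j, i) \<Rightarrow> \<lambda>z. f z ^ j * G (h i) z) \<in> monomial_box K (m * e + M)"
      if "p \<in> {..<m} \<times> {..<card I}" for p
    proof -
      obtain j i where p: "p = (j, i)" "j < m" "i < card I" using \<open>p \<in> _\<close> by auto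
      have "(\<lambda>z. f z ^ j * G (h i) z) \<in> monomial_box K (j * e + M)"
        by (intro monomial_box_mult monomial_box_power e G hI p(3))
      moreover have "j * e + M \<le> m * e + M" using p(2) by simp
      ultimately have "(\<lambda>z. f z ^ j * G (h i) z) \<in> monomial_box K (m * e + M)"
        using monomial_box_mono by blast
      then show ?thesis by (simp add: p)
    qed
    ultimately have "card ({..<m} \<times> {..<card I}) \<le> C * (m * e + M + 1) ^ n"
      by (intro C[rule_format, of _ "\<lambda>(j, i) z. f z ^ j * G (h i) z"]) auto
    then show ?thesis by (simp add: card_cartesian_product)
  qed
  show n: "0 < n"
  proof (rule ccontr)
    \<comment> \<open>For n = 0 the bound on Z is the constant C, but the first \<open>Suc C\<close>
      powers of f are independent on Z, because the constant 1 is independent on the nonempty set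
      Y.\<close>
    assume "\<not> 0 < n"
    have "indep_on Y {(0, 0)} (\<lambda>i z. 1)"
      using assms(4) by (auto simp: indep_on_def)
    then have "Suc C * card {(0 :: nat, 0 :: nat)} \<le> C * (Suc C * e + 0 + 1) ^ n"
      by (intro main[of _ "\<lambda>i z. 1"]) (auto simp: monomial_box_const)
    with \<open>\<not> 0 < n\<close> show False by simp
  qed
  show "growth K Y (n - 1)"
    unfolding growth_def
  proof (intro exI allI impI)
    fix M and I :: "(nat \<times> nat) set" and G
    assume I: "finite I" "\<forall>i\<in>I. G i \<in> monomial_box K M" "indep_on Y I G"
    \<comment> \<open>With m = M + 1 the degree bound stays linear in M, so the factor M + 1 can be
      cancelled against one power on the right.\<close>
    have "(M + 1) * card I \<le> C * ((M + 1) * e + M + 1) ^ n"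
      using I by (intro main) auto
    also have "(M + 1) * e + M + 1 = (e + 1) * (M + 1)" by (simp add: algebra_simps)
    also have "C * ((e + 1) * (M + 1)) ^ n = C * (e + 1) ^ n * (M + 1) ^ n"
      by (simp only: power_mult_distrib mult.assoc)
    also have "(M + 1) ^ n = (M + 1) * (M + 1) ^ (n - 1)"
      using n by (simp add: power_eq_if)
    also have "C * (e + 1) ^ n * \<dots> = (M + 1) * (C * (e + 1) ^ n * (M + 1) ^ (n - 1))"
      by (simp only: mult_ac)
    finally show "card I \<le> C * (e + 1) ^ n * (M + 1) ^ (n - 1)"
      by (simp only: mult_le_cancel1)
  qed
qed

text \<open>Descending from the top, every strict inclusion lowers the growth exponent by one, and
  the exponent must be positive before each step.\<close>

lemma irreducible_chain_length_le:
  assumes "finite K" "\<And>i. i \<le> m \<Longrightarrow> irreducible_closed K (Z i)"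
    and "\<And>i. i < m \<Longrightarrow> Z i \<subset> Z (Suc i)" "growth K (Z m) n"
  shows "m \<le> n"
  using assms(2-)
proof (induction m arbitrary: n)
  case (Suc m)
  have irr: "irreducible_closed K (Z m)" "irreducible_closed K (Z (Suc m))" using Suc.prems(1) by auto
  have "Z m \<subset> Z (Suc m)" using Suc.prems(2) by simp
  then obtain z where z: "z \<in> Z (Suc m)" "z \<notin> Z m" by blast
  moreover have "z \<in> affine_space K"
    using z(1) irr(2) zariski_closed_subset by (auto simp: irreducible_closed_def)
  ultimately obtain f where f: "f \<in> vanishing_ideal K (Z m)" "f z \<noteq> 0"
    using zariski_closed_separate irr(1) by (metis irreducible_closed_def)
  have sub: "Z m \<subseteq> Z (Suc m)" using \<open>Z m \<subset> Z (Suc m)\<close> by simp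
  have ne: "Z m \<noteq> {}" using irr(1) by (simp add: irreducible_closed_def)
  have f': "f \<in> polynomials K" "\<And>z. z \<in> Z m \<Longrightarrow> f z = 0" "\<exists>z\<in>Z (Suc m). f z \<noteq> 0"
    using f z(1) by (auto simp: vanishing_ideal_def)
  have "0 < n" "growth K (Z m) (n - 1)"
    by (rule growth_proper_subset[OF assms(1) Suc.prems(3) sub ne
          irreducible_closed_integral[OF irr(2)] f'], assumption?)+
  moreover have "m \<le> n - 1"
    using Suc.prems calculation by (intro Suc.IH) auto
  ultimately show ?case by simp
qed simp

text \<open>Growth is required only for irreducible sets through x, since X may have larger
  components elsewhere.\<close>

lemma local_dim_le:
  assumes "finite K"
    and "\<And>Z. irreducible_closed K Z \<Longrightarrow> x \<in> Z \<Longrightarrow> Z \<subseteq> X \<Longrightarrow> growth K Z n"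
  shows "local_dim K X x \<le> enat n"
  unfolding local_dim_def
proof (rule Sup_least, clarify)
  fix m and Z :: "nat \<Rightarrow> ('a \<Rightarrow> complex) set"
  assume Z: "\<forall>i\<le>m. irreducible_closed K (Z i) \<and> x \<in> Z i \<and> Z i \<subseteq> X" "\<forall>i<m. Z i \<subset> Z (Suc i)"
  then have "m \<le> n"
    using assms by (intro irreducible_chain_length_le[of K m Z]) auto
  then show "enat m \<le> enat n" by simp
qed

lemma local_dim_ge:
  assumes "\<And>i. i \<le> m \<Longrightarrow> irreducible_closed K (Z i) \<and> x \<in> Z i \<and> Z i \<subseteq> X"
    and "\<And>i. i < m \<Longrightarrow> Z i \<subset> Z (Suc i)"
  shows "enat m \<le> local_dim K X x"
  unfolding local_dim_def using assms by (intro Sup_upper) auto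

section \<open>Sets that are locally graphs of rational maps\<close>

text \<open>The points of \<open>A\<^sup>K\<close> with \<open>z k = g k z / L z\<close> form the graph of a regular map on the
  open subset \<open>L \<noteq> 0\<close> of \<open>A\<^sup>S\<close>.\<close>

locale rational_graph =
  fixes K S :: "'k set" and L :: "('k \<Rightarrow> complex) \<Rightarrow> complex" and g :: "'k \<Rightarrow> ('k \<Rightarrow> complex) \<Rightarrow> complex"
  assumes finite_K: "finite K" and S_subset: "S \<subseteq> K"
    and L_poly: "L \<in> polynomials S" and g_poly: "k \<in> K \<Longrightarrow> g k \<in> polynomials S"
    and g_free: "k \<in> S \<Longrightarrow> g k = (\<lambda>z. L z * z k)"
begin

text \<open>Without denominators the equations are polynomial, so they make sense, and can be
  imposed, also at points where L vanishes.\<close>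

definition on_graph :: "('k \<Rightarrow> complex) \<Rightarrow> bool" where
  "on_graph z \<longleftrightarrow> (\<forall>k\<in>K. L z * z k = g k z)"

definition param :: "('k \<Rightarrow> complex) \<Rightarrow> 'k \<Rightarrow> complex" where
  "param s k = (if k \<in> S then s k else if k \<in> K then g k s / L s else 0)"

lemma finite_S: "finite S"
  using finite_K S_subset finite_subset by blast

lemma polynomials_param: "f \<in> polynomials S \<Longrightarrow> f (param s) = f s"
  by (rule polynomials_cong[of f S]) (auto simp: param_def)

lemma param_on_graph:
  assumes "L s \<noteq> 0"
  shows "param s \<in> affine_space K" "on_graph (param s)" "L (param s) = L s"
proof -
  show L: "L (param s) = L s" by (rule polynomials_param[OF L_poly])
  show "param s \<in> affine_space K" using S_subset by (auto simp: affine_space_def param_def)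
  have "L s * param s k = g k s" if "k \<in> K" for k
    using that assms g_free by (auto simp: param_def)
  then show "on_graph (param s)"
    by (simp add: on_graph_def L polynomials_param[OF g_poly])
qed

lemma param_eq:
  assumes "z \<in> affine_space K" "on_graph z" "L z \<noteq> 0" "\<And>k. k \<in> S \<Longrightarrow> s k = z k"
  shows "param s = z"
proof
  fix k
  have "L s = L z"
    using L_poly assms(4) by (rule polynomials_cong)
  moreover have "g k s = g k z" if "k \<in> K"
    using g_poly[OF that] assms(4) by (rule polynomials_cong)
  moreover have "k \<in> K \<Longrightarrow> L z * z k = g k z"
    using assms(2) by (simp add: on_graph_def)
  ultimately have "k \<in> K \<Longrightarrow> g k s / L s = z k"
    using assms(3) by (simp add: divide_eq_eq mult.commute)
  then show "param s k = z k"
    using assms(1,4) by (simp add: param_def affine_space_def)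
qed

text \<open>Each factor L turns one coordinate \<open>z k\<close> into \<open>g k z\<close>, which
  involves only the coordinates in S.\<close>

lemma clear_denominators:
  assumes "f \<in> polynomials K"
  shows "\<exists>M. \<exists>h\<in>polynomials S. \<forall>z. on_graph z \<longrightarrow> L z ^ M * f z = h z"
  using assms
proof (induction rule: polynomials.induct)
  case (const c)
  show ?case
    by (intro exI[of _ 0] bexI[of _ "\<lambda>z. c"]) (auto intro: polynomials_intros)
next
  case (coord k)
  then show ?case
    by (intro exI[of _ 1] bexI[of _ "g k"]) (auto simp: on_graph_def g_poly)
next
  case (add f1 f2)
  from add.IH(1) obtain M h where h: "h \<in> polynomials S"
    "\<forall>z. on_graph z \<longrightarrow> L z ^ M * f1 z = h z"
    by (elim exE bexE)
  from add.IH(2) obtain N h' where h': "h' \<in> polynomials S"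
    "\<forall>z. on_graph z \<longrightarrow> L z ^ N * f2 z = h' z"
    by (elim exE bexE)
  have "L z ^ (M + N) * (f1 z + f2 z) = L z ^ N * h z + L z ^ M * h' z" if "on_graph z" for z
    using h(2)[rule_format, OF that, symmetric] h'(2)[rule_format, OF that, symmetric]
    by (simp add: power_add distrib_left)
  then show ?case
    using h(1) h'(1) L_poly
    by (intro exI[of _ "M + N"] bexI[of _ "\<lambda>z. L z ^ N * h z + L z ^ M * h' z"] allI impI
        polynomials_intros)
next
  case (mult f1 f2)
  from mult.IH(1) obtain M h where h: "h \<in> polynomials S"
    "\<forall>z. on_graph z \<longrightarrow> L z ^ M * f1 z = h z"
    by (elim exE bexE)
  from mult.IH(2) obtain N h' where h': "h' \<in> polynomials S"
    "\<forall>z. on_graph z \<longrightarrow> L z ^ N * f2 z = h' z"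
    by (elim exE bexE)
  have "L z ^ (M + N) * (f1 z * f2 z) = h z * h' z" if "on_graph z" for z
    using h(2)[rule_format, OF that, symmetric] h'(2)[rule_format, OF that, symmetric]
    by (simp add: power_add)
  then show ?case
    using h(1) h'(1)
    by (intro exI[of _ "M + N"] bexI[of _ "\<lambda>z. h z * h' z"] allI impI polynomials_intros)
qed

lemma clear_denominators_uniform:
  assumes "finite I" "\<And>i. i \<in> I \<Longrightarrow> f i \<in> polynomials K"
  shows "\<exists>M h. (\<forall>i\<in>I. h i \<in> polynomials S) \<and>
    (\<forall>i\<in>I. \<forall>z. on_graph z \<longrightarrow> L z ^ M * f i z = h i z)"
proof -
  have "\<forall>i\<in>I. \<exists>M h. h \<in> polynomials S \<and> (\<forall>z. on_graph z \<longrightarrow> L z ^ M * f i z = h z)"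
    using clear_denominators assms(2) by blast
  then obtain N h where N: "\<And>i. i \<in> I \<Longrightarrow> h i \<in> polynomials S"
    "\<And>i z. i \<in> I \<Longrightarrow> on_graph z \<Longrightarrow> L z ^ N i * f i z = h i z"
    by metis
  show ?thesis
  proof (intro exI[of _ "sum N I"] exI[of _ "\<lambda>i z. L z ^ (sum N I - N i) * h i z"] conjI ballI
      allI impI)
    fix i assume i: "i \<in> I"
    then show "(\<lambda>z. L z ^ (sum N I - N i) * h i z) \<in> polynomials S"
      using N(1) by (intro polynomials_intros L_poly)
    fix z assume "on_graph z"
    have "N i \<le> sum N I" using assms(1) i by (simp add: member_le_sum)
    then have "L z ^ sum N I = L z ^ (sum N I - N i) * L z ^ N i"
      by (simp flip: power_add)
    then show "L z ^ sum N I * f i z = L z ^ (sum N I - N i) * h i z"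
      using N(2)[OF i \<open>on_graph z\<close>] by simp
  qed
qed

text \<open>Two points of the slice are joined by the image of a line in the parameter space.\<close>

lemma integral_slice:
  "integral_set K {z \<in> affine_space K. on_graph z \<and> L z \<noteq> 0 \<and> (\<forall>k\<in>F. z k = x k)}"
  (is "integral_set K ?U") if "F \<subseteq> S"
  unfolding integral_set_def
proof (intro ballI impI, rule ccontr)
  fix f1 f2 assume f: "f1 \<in> polynomials K" "f2 \<in> polynomials K"
    and zero: "\<forall>z\<in>?U. f1 z * f2 z = 0"
    and "\<not> ((\<forall>z\<in>?U. f1 z = 0) \<or> (\<forall>z\<in>?U. f2 z = 0))"
  then obtain a b where a: "a \<in> ?U" "f1 a \<noteq> 0" and b: "b \<in> ?U" "f2 b \<noteq> 0" by blast
  define c where "c t = (\<lambda>k. a k + t * (b k - a k))" for t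
  obtain M h1 where h1: "h1 \<in> polynomials S" "\<And>z. on_graph z \<Longrightarrow> L z ^ M * f1 z = h1 z"
    using clear_denominators f(1) by blast
  obtain N h2 where h2: "h2 \<in> polynomials S" "\<And>z. on_graph z \<Longrightarrow> L z ^ N * f2 z = h2 z"
    using clear_denominators f(2) by blast
  obtain p p1 p2 where p: "\<And>t. L (c t) = poly p t" "\<And>t. h1 (c t) = poly p1 t"
    "\<And>t. h2 (c t) = poly p2 t"
    using polynomial_on_line[OF L_poly, of a "\<lambda>k. b k - a k"]
      polynomial_on_line[OF h1(1), of a "\<lambda>k. b k - a k"]
      polynomial_on_line[OF h2(1), of a "\<lambda>k. b k - a k"]
    unfolding c_def by blast
  have [simp]: "c 0 = a" "c 1 = b" by (auto simp: c_def)
  have "h1 a \<noteq> 0" "h2 b \<noteq> 0" "L a \<noteq> 0"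
    using a b h1(2)[of a] h2(2)[of b] by auto
  then have "p \<noteq> 0" "p1 \<noteq> 0" "p2 \<noteq> 0"
    using p(1)[of 0] p(2)[of 0] p(3)[of 1] by auto
  then have "finite {t. poly (p * p1 * p2) t = 0}"
    by (intro poly_roots_finite) auto
  then obtain t where "t \<notin> {t. poly (p * p1 * p2) t = 0}"
    using ex_new_if_finite[OF infinite_UNIV_char_0[where 'a = complex]] by blast
  then have t: "L (c t) \<noteq> 0" "h1 (c t) \<noteq> 0" "h2 (c t) \<noteq> 0" by (auto simp: p)
  \<comment> \<open>The point \<open>c t\<close> of the line need not lie on the graph;
    \<open>param\<close> corrects its dependent coordinates and keeps those in S, hence also the
    values of L, \<open>h1\<close> and \<open>h2\<close>.\<close>
  let ?z = "param (c t)"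
  have "?z k = x k" if "k \<in> F" for k
    using that \<open>F \<subseteq> S\<close> a(1) b(1) by (auto simp: param_def c_def)
  then have "?z \<in> ?U"
    using param_on_graph[OF t(1)] t(1) by auto
  moreover have "f1 ?z \<noteq> 0" "f2 ?z \<noteq> 0"
    using h1(2)[of ?z] h2(2)[of ?z] param_on_graph(2)[OF t(1)] t
      polynomials_param[OF h1(1)] polynomials_param[OF h2(1)] by auto
  ultimately show False using zero by auto
qed

lemma monomial_clear_denominators:
  assumes "on_graph z" "\<And>k. k \<in> K \<Longrightarrow> \<alpha> k \<le> M"
  shows "L z ^ (M * card K) * monomial K \<alpha> z = (\<Prod>k\<in>K. L z ^ (M - \<alpha> k) * g k z ^ \<alpha> k)"
proof -
  have "L z ^ (M * card K) * monomial K \<alpha> z = (\<Prod>k\<in>K. L z ^ M * z k ^ \<alpha> k)"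
    by (simp add: monomial_def prod.distrib power_mult)
  also have "\<dots> = (\<Prod>k\<in>K. L z ^ (M - \<alpha> k) * g k z ^ \<alpha> k)"
  proof (intro prod.cong refl)
    fix k assume k: "k \<in> K"
    then have "L z ^ M = L z ^ (M - \<alpha> k) * L z ^ \<alpha> k"
      using assms(2) by (simp flip: power_add)
    moreover have "L z * z k = g k z" using assms(1) k by (simp add: on_graph_def)
    ultimately show "L z ^ M * z k ^ \<alpha> k = L z ^ (M - \<alpha> k) * g k z ^ \<alpha> k"
      by (simp flip: power_mult_distrib add: mult.assoc)
  qed
  finally show ?thesis .
qed

text \<open>A uniform version of \<open>clear_denominators\<close>: the power of L depends on M
  alone, and the new degree is linear in M with a factor e common to all f. Linearity is what
  preserves the growth exponent.\<close>

lemma monomial_box_clear_denominators: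
  "\<exists>e. \<forall>M. \<forall>f\<in>monomial_box K M. \<exists>h\<in>monomial_box S (M * e).
     \<forall>z. on_graph z \<longrightarrow> L z ^ (M * card K) * f z = h z"
proof -
  have "\<exists>e. L \<in> monomial_box S e \<and> (\<forall>k\<in>J. g k \<in> monomial_box S e)" if "finite J" "J \<subseteq> K" for J
    using that
  proof (induction J rule: finite_induct)
    case empty
    then show ?case using polynomials_in_monomial_box[OF finite_S L_poly] by auto
  next
    case (insert k J)
    then obtain e where e: "L \<in> monomial_box S e" "\<forall>k\<in>J. g k \<in> monomial_box S e" by auto
    obtain e' where e': "g k \<in> monomial_box S e'"
      using polynomials_in_monomial_box[OF finite_S g_poly] insert.prems by blast
    have "monomial_box S e \<subseteq> monomial_box S (e + e')" "monomial_box S e' \<subseteq> monomial_box S (e + e')"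
      by (intro monomial_box_mono; simp)+
    then have "L \<in> monomial_box S (e + e') \<and> (\<forall>j\<in>insert k J. g j \<in> monomial_box S (e + e'))"
      using e e' by auto
    then show ?case ..
  qed
  then obtain e where e: "L \<in> monomial_box S e" "\<And>k. k \<in> K \<Longrightarrow> g k \<in> monomial_box S e"
    by (metis finite_K order_refl)
  have prod: "(\<lambda>z. \<Prod>k\<in>J. L z ^ (M - \<alpha> k) * g k z ^ \<alpha> k) \<in> monomial_box S (card J * (M * e))"
    if "finite J" "J \<subseteq> K" "\<And>k. k \<in> K \<Longrightarrow> \<alpha> k \<le> M" for J M \<alpha>
    using that(1,2)
  proof (induction J rule: finite_induct)
    case empty
    then show ?case by (simp add: monomial_box_const)
  next
    case (insert k J)
    have "(\<lambda>z. L z ^ (M - \<alpha> k) * g k z ^ \<alpha> k) \<in> monomial_box S ((M - \<alpha> k) * e + \<alpha> k * e)"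
      using insert.prems by (intro monomial_box_mult monomial_box_power e) auto
    moreover have "(M - \<alpha> k) * e + \<alpha> k * e = M * e"
      using that(3)[of k] insert.prems by (metis add_mult_distrib insert_subset le_add_diff_inverse2)
    ultimately have "(\<lambda>z. (L z ^ (M - \<alpha> k) * g k z ^ \<alpha> k) *
        (\<Prod>k\<in>J. L z ^ (M - \<alpha> k) * g k z ^ \<alpha> k)) \<in> monomial_box S (M * e + card J * (M * e))"
      using insert.IH insert.prems by (intro monomial_box_mult) auto
    then show ?case using insert.hyps by simp
  qed
  have "\<exists>h\<in>monomial_box S (M * (card K * e)). \<forall>z. on_graph z \<longrightarrow> L z ^ (M * card K) * f z = h z"
    if "f \<in> monomial_box K M" for f M
    using that
  proof (induction rule: monomial_box_induct)
    case zero
    show ?case by (intro bexI[of _ "\<lambda>z. 0"]) (auto simp: monomial_box_const)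
  next
    case (step c \<alpha> f)
    from step.IH obtain h where h: "h \<in> monomial_box S (M * (card K * e))"
      "\<forall>z. on_graph z \<longrightarrow> L z ^ (M * card K) * f z = h z" ..
    define m where "m z = (\<Prod>k\<in>K. L z ^ (M - \<alpha> k) * g k z ^ \<alpha> k)" for z
    have \<alpha>: "\<And>k. k \<in> K \<Longrightarrow> \<alpha> k \<le> M" using step.hyps by auto
    have "m \<in> monomial_box S (M * (card K * e))"
      using prod[OF finite_K subset_refl \<alpha>] by (simp add: m_def[abs_def] mult.left_commute)
    then have "(\<lambda>z. c * m z + h z) \<in> monomial_box S (M * (card K * e))"
      by (intro monomial_box_add monomial_box_scale h)
    moreover have "L z ^ (M * card K) * (c * monomial K \<alpha> z + f z) = c * m z + h z"
      if "on_graph z" for z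
      using h(2)[rule_format, OF that] monomial_clear_denominators[OF that \<alpha>]
      by (simp add: m_def distrib_left mult.left_commute)
    ultimately show ?case
      by (intro bexI[of _ "\<lambda>z. c * m z + h z"] allI impI)
  qed
  then have "\<forall>M. \<forall>f\<in>monomial_box K M. \<exists>h\<in>monomial_box S (M * (card K * e)).
      \<forall>z. on_graph z \<longrightarrow> L z ^ (M * card K) * f z = h z" by (intro allI ballI)
  then show ?thesis ..
qed

text \<open>Multiplication by a power of L turns a family of degree M into polynomials of degree M *
  e in \<open>card S\<close> variables. It preserves independence, since L is not identically zero
  on Z and Z has no zero divisors.\<close>

lemma growth_graph:
  assumes "integral_set K Z" "\<And>z. z \<in> Z \<Longrightarrow> on_graph z" "z0 \<in> Z" "L z0 \<noteq> 0"
  shows "growth K Z (card S)"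
proof -
  obtain e where e: "\<forall>M. \<forall>f\<in>monomial_box K M. \<exists>h\<in>monomial_box S (M * e).
      \<forall>z. on_graph z \<longrightarrow> L z ^ (M * card K) * f z = h z"
    using monomial_box_clear_denominators ..
  have "card I \<le> (e + 1) ^ card S * (M + 1) ^ card S"
    if I: "finite I" "\<forall>i\<in>I. G i \<in> monomial_box K M" "indep_on Z I G"
    for M and I :: "(nat \<times> nat) set" and G
  proof -
    have "\<forall>i\<in>I. \<exists>h\<in>monomial_box S (M * e).
        \<forall>z. on_graph z \<longrightarrow> L z ^ (M * card K) * G i z = h z"
      by (intro ballI e[rule_format] I(2)[rule_format])
    from bchoice[OF this[unfolded Bex_def]] obtain H where
      H: "\<forall>i\<in>I. H i \<in> monomial_box S (M * e) \<and>
        (\<forall>z. on_graph z \<longrightarrow> L z ^ (M * card K) * G i z = H i z)" ..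
    have "indep_on Z I H"
      unfolding indep_on_def
    proof (intro allI impI ballI)
      fix c i assume c: "\<forall>z\<in>Z. (\<Sum>i\<in>I. c i * H i z) = 0" and i: "i \<in> I"
      have "L z ^ (M * card K) * (\<Sum>i\<in>I. c i * G i z) = 0" if "z \<in> Z" for z
      proof -
        have "L z ^ (M * card K) * (\<Sum>i\<in>I. c i * G i z) = (\<Sum>i\<in>I. c i * H i z)"
          using assms(2)[OF that] H
          by (simp add: sum_distrib_left mult.left_commute)
        then show ?thesis using c that by simp
      qed
      moreover have "(\<lambda>z. L z ^ (M * card K)) \<in> polynomials K"
        using polynomials_mono[OF L_poly S_subset] by (intro polynomials_intros)
      moreover have "(\<lambda>z. \<Sum>i\<in>I. c i * G i z) \<in> polynomials K"
        using I(2) by (intro polynomials_intros) (auto intro: monomial_box_polynomials)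
      ultimately have "(\<Sum>i\<in>I. c i * G i z) = 0" if "z \<in> Z" for z
        using assms(3,4) that
        by (intro integral_setD[OF assms(1), of "\<lambda>z. L z ^ (M * card K)" "\<lambda>z. \<Sum>i\<in>I. c i * G i z"]) auto
      with indep_onD[OF I(3)] i show "c i = 0" by blast
    qed
    then have "card I \<le> (M * e + 1) ^ card S"
      using finite_S I(1) H by (intro indep_on_card_le) auto
    also have "\<dots> \<le> ((e + 1) * (M + 1)) ^ card S"
      by (intro power_mono) auto
    finally show ?thesis by (simp only: power_mult_distrib)
  qed
  then show ?thesis unfolding growth_def by (intro exI allI impI)
qed

text \<open>The velocities of \<open>param\<close> in the coordinate directions of S are a dual
  family in the tangent space, and the graph equations force a tangent vector with zero S-part to
  vanish.\<close>

lemma dim_tangent_space_graph: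
  assumes "X \<subseteq> affine_space K" "x \<in> X" "L x \<noteq> 0"
    and X: "\<And>z. z \<in> affine_space K \<Longrightarrow> L z \<noteq> 0 \<Longrightarrow> z \<in> X \<longleftrightarrow> on_graph z"
  shows "cfun.dim (tangent_space K X x) = card S"
proof -
  have x: "x \<in> affine_space K" "on_graph x" using assms by auto
  define \<delta> where "\<delta> k = (\<lambda>j. if j = k then 1 else 0 :: complex)" for k :: 'k
  define c where "c k t = (\<lambda>j. x j + t * \<delta> k j)" for k t
  define \<eta> where "\<eta> k j = deriv (\<lambda>t. param (c k t) j) 0" for k j
  have c0: "c k 0 = x" for k by (simp add: c_def)
  have poly_c: "(\<lambda>t. f (c k t)) field_differentiable (at 0)" if "f \<in> polynomials S" for f k
    unfolding field_differentiable_def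
    by (rule exI, rule polynomial_chain_rule[OF finite_S that, where c' = "\<delta> k"])
      (auto simp: c_def intro!: derivative_eq_intros)
  have param_c: "((\<lambda>t. param (c k t) j) has_field_derivative \<eta> k j) (at 0)" for k j
    unfolding \<eta>_def
  proof (rule field_differentiable_derivI)
    consider "j \<in> S" | "j \<in> K - S" | "j \<notin> K" using S_subset by blast
    then show "(\<lambda>t. param (c k t) j) field_differentiable (at 0)"
    proof cases
      case 1
      then show ?thesis using poly_c[OF polynomials.coord[OF 1]] by (simp add: param_def)
    next
      case 2
      have "(\<lambda>t. g j (c k t) / L (c k t)) field_differentiable (at 0)"
        using 2 assms(3) c0 by (intro field_differentiable_divide poly_c g_poly L_poly) auto
      then show ?thesis using 2 by (simp add: param_def)
    next
      case 3
      then have "j \<notin> S" using S_subset by blast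
      with 3 show ?thesis by (simp add: param_def)
    qed
  qed
  have \<eta>_tangent: "\<eta> k \<in> tangent_space K X x" for k
  proof (rule tangent_spaceI_curve[OF finite_K])
    have "param (c k t) j = 0" if "j \<notin> K" for t j using that S_subset by (auto simp: param_def)
    then show "\<eta> k \<in> affine_space K" by (simp add: \<eta>_def affine_space_def)
    show "((\<lambda>t. param (c k t) j) has_field_derivative \<eta> k j) (at 0)" for j by (rule param_c)
    show "param (c k 0) = x" using x assms(3) by (intro param_eq) (auto simp: c0)
    have "isCont (\<lambda>t. L (c k t)) 0"
      using poly_c[OF L_poly] by (rule field_differentiable_imp_continuous_at)
    moreover have "L (c k 0) \<noteq> 0" using assms(3) by (simp add: c0)
    ultimately have "\<forall>\<^sub>F t in nhds 0. L (c k t) \<noteq> 0"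
      unfolding isCont_def eventually_nhds_conv_at by (auto dest: tendsto_imp_eventually_ne)
    then show "\<forall>\<^sub>F t in nhds 0. param (c k t) \<in> X"
    proof eventually_elim
      case (elim t)
      then show ?case using X param_on_graph by simp
    qed
  qed
  have \<eta>_S: "\<eta> k j = (if j = k then 1 else 0)" if "j \<in> S" for j k
  proof -
    have "((\<lambda>t. param (c k t) j) has_field_derivative \<delta> k j) (at 0)"
      using that by (auto simp: param_def c_def intro!: derivative_eq_intros)
    with param_c[of k j] have "\<eta> k j = \<delta> k j" by (rule DERIV_unique)
    then show ?thesis by (simp add: \<delta>_def)
  qed
  have zero: "\<xi> = 0" if \<xi>: "\<xi> \<in> tangent_space K X x" and \<xi>S: "\<And>k. k \<in> S \<Longrightarrow> \<xi> k = 0" for \<xi>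
  proof
    fix k
    show "\<xi> k = 0 k"
    proof (cases "k \<in> K")
      case False
      then show ?thesis using \<xi> by (simp add: tangent_space_def affine_space_def)
    next
      case True
      \<comment> \<open>The outer factor L makes f vanish on all of X, including the points with L z
        = 0, where X need not satisfy the graph equation.\<close>
      define f where "f z = L z * (L z * z k - g k z)" for z
      have "f \<in> polynomials K"
        unfolding f_def[abs_def]
        by (intro polynomials_intros True polynomials_mono[OF L_poly S_subset]
            polynomials_mono[OF g_poly[OF True] S_subset])
      moreover have "f z = 0" if "z \<in> X" for z
        using that X[of z] assms(1) True by (cases "L z = 0") (auto simp: f_def on_graph_def)
      ultimately have "f \<in> vanishing_ideal K X" by (simp add: vanishing_ideal_def)
      then have "((\<lambda>t. f (\<lambda>k. x k + t * \<xi> k)) has_field_derivative 0) (at 0)"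
        by (rule tangent_space_line[OF finite_K \<xi>])
      moreover have "f (\<lambda>k. x k + t * \<xi> k) = L x * (L x * (x k + t * \<xi> k) - g k x)" for t
      proof -
        have "h (\<lambda>k. x k + t * \<xi> k) = h x" if "h \<in> polynomials S" for h
          using that \<xi>S by (intro polynomials_cong[OF that]) auto
        from this[OF L_poly] this[OF g_poly[OF True]] show ?thesis by (simp add: f_def)
      qed
      moreover have "((\<lambda>t. L x * (L x * (x k + t * \<xi> k) - g k x)) has_field_derivative
          L x * (L x * \<xi> k)) (at 0)"
        by (auto intro!: derivative_eq_intros)
      ultimately have "L x * (L x * \<xi> k) = 0"
        using DERIV_unique by fastforce
      then show ?thesis using assms(3) by simp
    qed
  qed
  show ?thesis
    by (rule dim_eq_card_dual_family[OF subspace_tangent_space finite_S \<eta>_tangent \<eta>_S zero])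
qed

text \<open>X is a graph only where L is nonzero. On an irreducible Z through x the factor L is not
  identically zero, so it can be cancelled from L z * (L z * z k - g k z) = 0, and all of Z
  satisfies the graph equations.\<close>

lemma local_dim_graph_le:
  assumes "X \<subseteq> affine_space K" "x \<in> X" "L x \<noteq> 0"
    and X: "\<And>z. z \<in> affine_space K \<Longrightarrow> L z \<noteq> 0 \<Longrightarrow> z \<in> X \<longleftrightarrow> on_graph z"
  shows "local_dim K X x \<le> enat (card S)"
proof (rule local_dim_le[OF finite_K])
  fix Z assume Z: "irreducible_closed K Z" "x \<in> Z" "Z \<subseteq> X"
  have int: "integral_set K Z" using Z(1) by (rule irreducible_closed_integral)
  have "on_graph z" if "z \<in> Z" for z
    unfolding on_graph_def
  proof
    fix k assume k: "k \<in> K"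
    have "L z * z k - g k z = 0"
    proof (rule integral_setD[OF int, of L "\<lambda>z. L z * z k - g k z" x z])
      show "L \<in> polynomials K" by (rule polynomials_mono[OF L_poly S_subset])
      show "(\<lambda>z. L z * z k - g k z) \<in> polynomials K"
        by (intro polynomials_intros k polynomials_mono[OF L_poly S_subset]
            polynomials_mono[OF g_poly[OF k] S_subset])
      show "L z * (L z * z k - g k z) = 0" if "z \<in> Z" for z
        using that X[of z] assms(1) Z(3) k by (cases "L z = 0") (auto simp: on_graph_def)
    qed (use Z(2) assms(3) that in auto)
    then show "L z * z k = g k z" by simp
  qed
  then show "growth K Z (card S)"
    using int Z(2) assms(3) by (intro growth_graph)
qed

text \<open>The chain consists of the closures of slices of the graph: U i releases the first i
  coordinates of S and keeps the others at their values in x.\<close>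

lemma local_dim_graph_ge:
  assumes "zariski_closed K X" "x \<in> X" "L x \<noteq> 0"
    and X: "\<And>z. z \<in> affine_space K \<Longrightarrow> L z \<noteq> 0 \<Longrightarrow> z \<in> X \<longleftrightarrow> on_graph z"
  shows "enat (card S) \<le> local_dim K X x"
proof -
  have x: "x \<in> affine_space K" "on_graph x"
    using assms zariski_closed_subset[OF assms(1)] by auto
  obtain h where h: "bij_betw h {..<card S} S"
    using ex_bij_betw_nat_finite[OF finite_S] by (auto simp: atLeast0LessThan)
  have inj: "inj_on h {..<card S}" and hS: "h ` {..<card S} = S"
    using h by (auto simp: bij_betw_def)
  define U where "U i = {z \<in> affine_space K. on_graph z \<and> L z \<noteq> 0 \<and> (\<forall>k\<in>S - h ` {..<i}. z k = x k)}" for i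
  have U_affine: "U i \<subseteq> affine_space K" for i by (auto simp: U_def)
  have x_U: "x \<in> U i" for i using x assms(3) by (simp add: U_def)
  show ?thesis
  proof (rule local_dim_ge[of _ K "\<lambda>i. zariski_closure K (U i)"])
    fix i assume "i \<le> card S"
    have "irreducible_closed K (zariski_closure K (U i))"
      using U_affine x_U unfolding U_def by (intro irreducible_closure integral_slice) auto
    moreover have "x \<in> zariski_closure K (U i)"
      using zariski_closure_subset[OF U_affine] x_U by blast
    moreover have "zariski_closure K (U i) \<subseteq> X"
      using X by (intro zariski_closure_minimal[OF assms(1)]) (auto simp: U_def)
    ultimately show "irreducible_closed K (zariski_closure K (U i)) \<and>
        x \<in> zariski_closure K (U i) \<and> zariski_closure K (U i) \<subseteq> X" by blast
  next
    fix i assume i: "i < card S"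
    have hi: "h i \<in> S" using i hS by blast
    have "h i \<notin> h ` {..<i}"
    proof
      assume "h i \<in> h ` {..<i}"
      then obtain j where "j < i" "h i = h j" by auto
      with inj_onD[OF inj, of i j] i show False by simp
    qed
    \<comment> \<open>To see that releasing \<open>h i\<close> enlarges the closure, this one
      coordinate is moved away from x by some t that is no root of L. The function z (h i) - x (h i)
      then separates the new point from the smaller closure.\<close>
    obtain p where p: "\<And>t. L (\<lambda>k. x k + t * (if k = h i then 1 else 0)) = poly p t"
        using polynomial_on_line[OF L_poly, of x "\<lambda>k. if k = h i then 1 else 0"] by (elim exE) simp
    have "poly p 0 \<noteq> 0" using assms(3) unfolding p[rule_format, of 0, symmetric] by simp
    then have "finite (insert 0 {t. poly p t = 0})"
      by (intro finite.insertI poly_roots_finite) auto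
    then obtain t where t: "t \<noteq> 0" "poly p t \<noteq> 0"
      using ex_new_if_finite[OF infinite_UNIV_char_0[where 'a = complex]] by blast
    define s where "s k = x k + t * (if k = h i then 1 else 0)" for k
    have Ls: "L s \<noteq> 0" using t(2) unfolding s_def[abs_def] p[rule_format] .
    have "param s \<in> U (Suc i)"
      using param_on_graph[OF Ls] Ls by (auto simp: U_def param_def s_def lessThan_Suc)
    then have 1: "param s \<in> zariski_closure K (U (Suc i))"
      using zariski_closure_subset[OF U_affine] by blast
    have van: "(\<lambda>z. z (h i) - x (h i)) \<in> vanishing_ideal K (U i)"
      using hi S_subset \<open>h i \<notin> h ` {..<i}\<close>
      by (auto simp: vanishing_ideal_def U_def intro!: polynomials_intros)
    have 2: "param s \<notin> zariski_closure K (U i)"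
    proof
      assume "param s \<in> zariski_closure K (U i)"
      then have "\<forall>f\<in>vanishing_ideal K (U i). f (param s) = 0" by (simp add: zariski_closure_def)
      from bspec[OF this van] show False
        using hi t(1) by (simp add: param_def s_def)
    qed
    have "zariski_closure K (U i) \<subseteq> zariski_closure K (U (Suc i))"
      by (intro zariski_closure_mono) (auto simp: U_def)
    with 1 2 show "zariski_closure K (U i) \<subset> zariski_closure K (U (Suc i))" by blast
  qed
qed

end

section \<open>Local graphs and their extension by new coordinates\<close>

definition locally_graph ::
  "'k set \<Rightarrow> ('k \<Rightarrow> complex) set \<Rightarrow> ('k \<Rightarrow> complex) \<Rightarrow> 'k set \<Rightarrow> bool" where
  "locally_graph K X x S \<longleftrightarrow> (\<exists>L g. rational_graph K S L g \<and> L x \<noteq> 0 \<and>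
     (\<forall>z\<in>affine_space K. L z \<noteq> 0 \<longrightarrow> (z \<in> X \<longleftrightarrow> (\<forall>k\<in>K. L z * z k = g k z))))"

lemma locally_graphE:
  assumes "locally_graph K X x S"
  obtains L g where "rational_graph K S L g" "L x \<noteq> 0"
    "\<And>z. z \<in> affine_space K \<Longrightarrow> L z \<noteq> 0 \<Longrightarrow> z \<in> X \<longleftrightarrow> (\<forall>k\<in>K. L z * z k = g k z)"
proof -
  from assms obtain L g where "rational_graph K S L g \<and> L x \<noteq> 0 \<and>
     (\<forall>z\<in>affine_space K. L z \<noteq> 0 \<longrightarrow> (z \<in> X \<longleftrightarrow> (\<forall>k\<in>K. L z * z k = g k z)))"
    unfolding locally_graph_def by (elim exE)
  then show thesis by (intro that[of L g]) auto
qed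

lemma affine_smooth_locally_graph:
  assumes "zariski_closed K X" "\<And>x. x \<in> X \<Longrightarrow> \<exists>S. locally_graph K X x S"
  shows "affine_smooth K X"
  unfolding affine_smooth_def
proof
  fix x assume x: "x \<in> X"
  obtain S where "locally_graph K X x S" using assms(2)[OF x] ..
  then obtain L g where rg: "rational_graph K S L g" and L: "L x \<noteq> 0"
    and X: "\<And>z. z \<in> affine_space K \<Longrightarrow> L z \<noteq> 0 \<Longrightarrow> z \<in> X \<longleftrightarrow> (\<forall>k\<in>K. L z * z k = g k z)"
    by (rule locally_graphE) (rule that)
  interpret rational_graph K S L g by (rule rg)
  note X' = X[folded on_graph_def]
  note sub = zariski_closed_subset[OF assms(1)]
  show "enat (cfun.dim (tangent_space K X x)) = local_dim K X x"
    using dim_tangent_space_graph[OF sub x L X'] local_dim_graph_le[OF sub x L X']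
      local_dim_graph_ge[OF assms(1) x L X'] by simp
qed

text \<open>The new equations may involve dependent coordinates of K. These are eliminated by
  clearing denominators; afterwards L times the cleared Q serves as a common denominator for old and
  new coordinates.\<close>

lemma locally_graph_extend:
  assumes "locally_graph K X (\<lambda>k. if k \<in> K then x k else 0) S"
    and "finite N" "K \<inter> N = {}" "F \<subseteq> N"
    and Q: "Q \<in> polynomials (K \<union> F)" "Q x \<noteq> 0" and P: "\<And>k. k \<in> N - F \<Longrightarrow> P k \<in> polynomials (K \<union> F)"
    and X'_X: "\<And>z. z \<in> X' \<Longrightarrow> (\<lambda>k. if k \<in> K then z k else 0) \<in> X"
    and X': "\<And>z. z \<in> affine_space (K \<union> N) \<Longrightarrow> Q z \<noteq> 0 \<Longrightarrow>
      (\<lambda>k. if k \<in> K then z k else 0) \<in> X \<Longrightarrow> z \<in> X' \<longleftrightarrow> (\<forall>k\<in>N - F. Q z * z k = P k z)"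
    and x: "x \<in> X'"
  shows "locally_graph (K \<union> N) X' x (S \<union> F)"
proof -
  define r where "r z = (\<lambda>k. if k \<in> K then z k else 0 :: complex)" for z :: "'a \<Rightarrow> complex"
  obtain L g where rg: "rational_graph K S L g" and L: "L (r x) \<noteq> 0"
    and X: "\<And>z. z \<in> affine_space K \<Longrightarrow> L z \<noteq> 0 \<Longrightarrow> z \<in> X \<longleftrightarrow> (\<forall>k\<in>K. L z * z k = g k z)"
    using assms(1)[folded r_def] by (rule locally_graphE) (rule that)
  interpret A: rational_graph K S L g by (rule rg)
  have r_poly: "h (r z) = h z" if "h \<in> polynomials S" for h z
    using that A.S_subset by (intro polynomials_cong[OF that]) (auto simp: r_def)
  have r_affine: "r z \<in> affine_space K" for z by (simp add: r_def affine_space_def)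
  have X_iff: "r z \<in> X \<longleftrightarrow> (\<forall>k\<in>K. L z * z k = g k z)" if "L z \<noteq> 0" for z
    using X[OF r_affine, of z] that r_poly[OF A.L_poly, of z] r_poly[OF A.g_poly, of _ z]
    by (simp add: r_def[of z] cong: ball_cong)
  define g' where "g' k = (if k \<in> K then g k else (\<lambda>z. L z * z k))" for k
  \<comment> \<open>The same graph with the coordinates in F as additional parameters, so that
    denominators can be cleared in polynomials over K \<union> F.\<close>
  interpret B: rational_graph "K \<union> F" "S \<union> F" L g'
  proof
    show "finite (K \<union> F)" using A.finite_K assms(2,4) finite_subset by auto
    show "S \<union> F \<subseteq> K \<union> F" using A.S_subset by auto
    show "L \<in> polynomials (S \<union> F)" using A.L_poly by (rule polynomials_mono) auto
    show "g' k \<in> polynomials (S \<union> F)" if "k \<in> K \<union> F" for k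
      using that A.g_poly[of k] A.L_poly
      by (auto simp: g'_def intro!: polynomials_intros elim: polynomials_mono)
    show "g' k = (\<lambda>z. L z * z k)" if "k \<in> S \<union> F" for k
      using that A.g_free[of k] assms(3,4) by (auto simp: g'_def)
  qed
  have B_on: "B.on_graph z \<longleftrightarrow> (\<forall>k\<in>K. L z * z k = g k z)" for z
    by (auto simp: B.on_graph_def g'_def)
  \<comment> \<open>\<open>None\<close> stands for Q and \<open>Some k\<close> for
    \<open>P k\<close>, so that one exponent M serves for all of them.\<close>
  define J where "J = insert None (Some ` (N - F))"
  define f where "f = case_option Q P"
  have fin: "finite J" using assms(2) by (simp add: J_def)
  have pol: "f i \<in> polynomials (K \<union> F)" if "i \<in> J" for i
    using that P Q(1) by (auto simp: J_def f_def)
  have "\<exists>M h. (\<forall>i\<in>J. h i \<in> polynomials (S \<union> F)) \<and>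
      (\<forall>i\<in>J. \<forall>z. B.on_graph z \<longrightarrow> L z ^ M * f i z = h i z)"
    using fin pol by (rule B.clear_denominators_uniform)
  then obtain M h where
    h: "\<forall>i\<in>J. h i \<in> polynomials (S \<union> F)"
    "\<forall>i\<in>J. \<forall>z. B.on_graph z \<longrightarrow> L z ^ M * f i z = h i z"
    by (elim exE conjE) (rule that)
  define q where "q = h None"
  have q: "q \<in> polynomials (S \<union> F)" "\<And>z. B.on_graph z \<Longrightarrow> L z ^ M * Q z = q z"
    using h(1)[rule_format, of None] h(2)[rule_format, of None] by (auto simp: q_def J_def f_def)
  have p: "h (Some k) \<in> polynomials (S \<union> F)" "\<And>z. B.on_graph z \<Longrightarrow> L z ^ M * P k z = h (Some k) z"
    if "k \<in> N - F" for k
    using h(1)[rule_format, of "Some k"] h(2)[rule_format, of "Some k"] that by (auto simp: J_def f_def)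
  \<comment> \<open>On the graph q equals L ^ M * Q, so where \<open>L'\<close> is nonzero both L
    and Q are. The numerators \<open>g''\<close> carry the matching extra factors.\<close>
  define L' where "L' z = L z * q z" for z
  define g'' where "g'' k = (if k \<in> K then (\<lambda>z. g k z * q z)
      else if k \<in> F then (\<lambda>z. L' z * z k) else (\<lambda>z. L z * h (Some k) z))" for k
  have L'_poly: "L' \<in> polynomials (S \<union> F)"
    unfolding L'_def[abs_def] by (intro polynomials_intros B.L_poly q)
  have "rational_graph (K \<union> N) (S \<union> F) L' g''"
  proof
    show "finite (K \<union> N)" using A.finite_K assms(2) by simp
    show "S \<union> F \<subseteq> K \<union> N" using A.S_subset assms(4) by auto
    show "L' \<in> polynomials (S \<union> F)" by (rule L'_poly)
    show "g'' k \<in> polynomials (S \<union> F)" if "k \<in> K \<union> N" for k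
    proof -
      consider "k \<in> K" | "k \<in> F" "k \<notin> K" | "k \<in> N - F" "k \<notin> K" using \<open>k \<in> K \<union> N\<close> by blast
      then show ?thesis
      proof cases
        case 1
        have "g k \<in> polynomials (S \<union> F)" using A.g_poly[OF 1] by (rule polynomials_mono) simp
        with 1 show ?thesis by (auto simp: g''_def intro!: polynomials_intros q)
      next
        case 2
        then show ?thesis by (auto simp: g''_def intro!: polynomials_intros L'_poly)
      next
        case 3
        then show ?thesis using p(1)[OF 3(1)] by (auto simp: g''_def intro!: polynomials_intros B.L_poly)
      qed
    qed
    show "g'' k = (\<lambda>z. L' z * z k)" if "k \<in> S \<union> F" for k
      using that A.g_free[of k] A.S_subset assms(3,4) by (auto simp: g''_def L'_def fun_eq_iff)
  qed
  moreover have "L' x \<noteq> 0"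
  proof -
    have "L x \<noteq> 0" using L r_poly[OF A.L_poly] by simp
    moreover have "B.on_graph x" unfolding B_on
      using X_iff[OF calculation] X'_X[OF x] by (simp add: r_def)
    ultimately show ?thesis using q(2)[of x] Q(2) by (auto simp: L'_def)
  qed
  moreover have "z \<in> X' \<longleftrightarrow> (\<forall>k\<in>K \<union> N. L' z * z k = g'' k z)"
    if z: "z \<in> affine_space (K \<union> N)" "L' z \<noteq> 0" for z
  proof -
    have Lz: "L z \<noteq> 0" "q z \<noteq> 0" using z(2) by (auto simp: L'_def)
    have K: "(\<forall>k\<in>K. L' z * z k = g'' k z) \<longleftrightarrow> B.on_graph z"
      using Lz(2) by (auto simp: B_on g''_def L'_def)
    have F: "\<forall>k\<in>F. L' z * z k = g'' k z"
      using assms(3,4) by (auto simp: g''_def)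
    have N: "(\<forall>k\<in>N - F. L' z * z k = g'' k z) \<longleftrightarrow> (\<forall>k\<in>N - F. Q z * z k = P k z)"
      if on: "B.on_graph z"
    proof (intro ball_cong refl)
      fix k assume k: "k \<in> N - F"
      then have "g'' k z = L z * (L z ^ M * P k z)"
        using assms(3) p(2)[OF k on] by (auto simp: g''_def)
      moreover have "L' z = L z * (L z ^ M * Q z)"
        using q(2)[OF on] by (simp add: L'_def)
      ultimately show "(L' z * z k = g'' k z) = (Q z * z k = P k z)"
        using Lz(1) by (simp add: mult.assoc)
    qed
    have Qz: "Q z \<noteq> 0" if "B.on_graph z"
      using q(2)[OF that] Lz(2) by auto
    have "z \<in> X' \<longleftrightarrow> B.on_graph z \<and> (\<forall>k\<in>N - F. Q z * z k = P k z)"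
      using X'_X[of z, folded r_def] X'[OF z(1), folded r_def] Qz X_iff[OF Lz(1)] B_on by blast
    also have "\<dots> \<longleftrightarrow> (\<forall>k\<in>K \<union> N. L' z * z k = g'' k z)"
      using K F N assms(4) by blast
    finally show ?thesis .
  qed
  ultimately show ?thesis
    unfolding locally_graph_def by (intro exI[of _ L'] exI[of _ g''] conjI ballI impI)
qed

section \<open>Incidence equations in a chart\<close>

definition coords :: "'v set \<Rightarrow> 'e set \<Rightarrow> ('v, 'e, 'n) coordinate set" where
  "coords V E = {Pt v i |v i. v \<in> V} \<union> {Pl e i j |e i j. e \<in> E}"

lemma mem_coords [simp]:
  "Pt v i \<in> coords V E \<longleftrightarrow> v \<in> V" "Pl e i j \<in> coords V E \<longleftrightarrow> e \<in> E"
  by (auto simp: coords_def)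

lemma coords_Un: "coords V E \<union> coords V' E' = coords (V \<union> V') (E \<union> E')"
  by (auto simp: coords_def)

lemma coords_disjoint: "V \<inter> V' = {} \<Longrightarrow> E \<inter> E' = {} \<Longrightarrow> coords V E \<inter> coords V' E' = {}"
  by (auto simp: coords_def)

lemma finite_coords:
  assumes "finite V" "finite E"
  shows "finite (coords V E :: ('v, 'e, 'n::finite) coordinate set)"
proof -
  have "coords V E = (\<lambda>(v, i). Pt v i) ` (V \<times> (UNIV :: 'n set)) \<union>
      (\<lambda>(e, i, j). Pl e i j) ` (E \<times> (UNIV :: 'n set) \<times> (UNIV :: 'n set))"
    by (auto simp: coords_def image_iff)
  then show ?thesis using assms by simp
qed

text \<open>The point \<open>v\<close> is normalised by \<open>Pt v (c v) = 1\<close> and the line \<open>e\<close> by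
  \<open>Pl e (a e) (b e) = 1\<close>; the latter is then spanned by the vectors with entries
  \<open>Pl e i (b e)\<close> and \<open>Pl e (a e) i\<close>.\<close>

locale incidence_chart =
  fixes c :: "'v \<Rightarrow> 'n::finite" and a b :: "'e \<Rightarrow> 'n"
begin

text \<open>The matrix \<open>Pl e\<close> is the exterior product of its column \<open>b e\<close>
  and its row \<open>a e\<close>. Among matrices with entry 1 at that position this characterises
  the Pluecker matrices of lines; antisymmetry is included.\<close>

definition line_eqs :: "'e \<Rightarrow> (('v, 'e, 'n) coordinate \<Rightarrow> complex) \<Rightarrow> bool" where
  "line_eqs e z \<longleftrightarrow> z (Pl e (a e) (b e)) = 1 \<and>
     (\<forall>i j. z (Pl e i j) = z (Pl e i (b e)) * z (Pl e (a e) j) - z (Pl e j (b e)) * z (Pl e (a e) i))"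

text \<open>At positions \<open>a e\<close> and \<open>b e\<close> the two spanning vectors have
  entries 1, 0 and 0, 1, so the coefficients of a point on the line are its own entries
  there.\<close>

definition inc_eqs :: "'v \<Rightarrow> 'e \<Rightarrow> (('v, 'e, 'n) coordinate \<Rightarrow> complex) \<Rightarrow> bool" where
  "inc_eqs v e z \<longleftrightarrow>
     (\<forall>i. z (Pt v i) = z (Pt v (a e)) * z (Pl e i (b e)) + z (Pt v (b e)) * z (Pl e (a e) i))"

definition inc_space ::
  "'v set \<Rightarrow> 'e set \<Rightarrow> ('v \<times> 'e) set \<Rightarrow> (('v, 'e, 'n) coordinate \<Rightarrow> complex) set" where
  "inc_space V E I = {z \<in> affine_space (coords V E).
     (\<forall>v\<in>V. z (Pt v (c v)) = 1) \<and> (\<forall>e\<in>E. line_eqs e z) \<and> (\<forall>(v, e)\<in>I. inc_eqs v e z)}"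

text \<open>Diagonal entries cancel in the exterior product. Hence a chart that normalises a
  diagonal entry is empty, and any point of a chart provides
  \<open>a e \<noteq> b e\<close>.\<close>

lemma line_eqsD:
  assumes "line_eqs e z"
  shows "z (Pl e (a e) (b e)) = 1" "z (Pl e i i) = 0" "a e \<noteq> b e"
proof -
  show 1: "z (Pl e (a e) (b e)) = 1"
    using assms unfolding line_eqs_def ..
  have "z (Pl e i i) = z (Pl e i (b e)) * z (Pl e (a e) i) - z (Pl e i (b e)) * z (Pl e (a e) i)" for i
    using assms[unfolded line_eqs_def] by (elim conjE allE)
  then show 2: "z (Pl e i i) = 0" for i by simp
  show "a e \<noteq> b e" using 1 2[of "a e"] by auto
qed

lemma zariski_closed_inc_space:
  assumes "I \<subseteq> V \<times> E"
  shows "zariski_closed (coords V E) (inc_space V E I)"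
proof -
  define F :: "((('v, 'e, 'n) coordinate \<Rightarrow> complex) \<Rightarrow> complex) set" where
    "F = (\<Union>v\<in>V. {\<lambda>z. z (Pt v (c v)) - 1}) \<union>
    (\<Union>e\<in>E. {\<lambda>z. z (Pl e (a e) (b e)) - 1}) \<union>
    (\<Union>e\<in>E. \<Union>i. \<Union>j. {\<lambda>z. z (Pl e i j) -
      (z (Pl e i (b e)) * z (Pl e (a e) j) - z (Pl e j (b e)) * z (Pl e (a e) i))}) \<union>
    (\<Union>p\<in>I. \<Union>i. {\<lambda>z. z (Pt (fst p) i) -
      (z (Pt (fst p) (a (snd p))) * z (Pl (snd p) i (b (snd p))) +
       z (Pt (fst p) (b (snd p))) * z (Pl (snd p) (a (snd p)) i))})"
  have "F \<subseteq> polynomials (coords V E)"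
  proof
    fix f assume "f \<in> F"
    moreover have "fst p \<in> V" "snd p \<in> E" if "p \<in> I" for p using that assms by auto
    ultimately show "f \<in> polynomials (coords V E)"
      unfolding F_def by (elim UnE UN_E singletonE; hypsubst; intro polynomials_intros; simp)
  qed
  moreover have "(\<forall>f\<in>F. f z = 0) \<longleftrightarrow> (\<forall>v\<in>V. z (Pt v (c v)) = 1) \<and> (\<forall>e\<in>E. line_eqs e z) \<and>
      (\<forall>(v, e)\<in>I. inc_eqs v e z)" for z
    by (simp add: F_def ball_Un line_eqs_def inc_eqs_def ball_conj_distrib case_prod_beta)
  ultimately show ?thesis
    unfolding zariski_closed_def inc_space_def by (intro exI[of _ F]) auto
qed

lemma restrict_inc_space:
  fixes z :: "('v, 'e, 'n) coordinate \<Rightarrow> complex"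
  assumes "I \<subseteq> V \<times> E"
  shows "(\<lambda>k. if k \<in> coords V E then z k else 0) \<in> inc_space V E I \<longleftrightarrow>
    (\<forall>v\<in>V. z (Pt v (c v)) = 1) \<and> (\<forall>e\<in>E. line_eqs e z) \<and> (\<forall>(v, e)\<in>I. inc_eqs v e z)"
proof -
  define r where "r = (\<lambda>k. if k \<in> coords V E then z k else 0)"
  have "r \<in> affine_space (coords V E)" by (simp add: r_def affine_space_def)
  moreover have "r (Pt v i) = z (Pt v i)" if "v \<in> V" for v i using that by (simp add: r_def)
  moreover have "r (Pl e i j) = z (Pl e i j)" if "e \<in> E" for e i j using that by (simp add: r_def)
  then have "line_eqs e r \<longleftrightarrow> line_eqs e z" if "e \<in> E" for e
    using that by (simp add: line_eqs_def)
  moreover have "inc_eqs v e r \<longleftrightarrow> inc_eqs v e z" if "(v, e) \<in> I" for v e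
  proof -
    have "v \<in> V" "e \<in> E" using that assms by auto
    then show ?thesis by (simp add: inc_eqs_def r_def)
  qed
  ultimately show ?thesis unfolding r_def[symmetric] inc_space_def by auto
qed

text \<open>A building order for a forest: each new object has at most one incidence with the
  earlier ones, and a line always enters through an existing point.\<close>

inductive inc_forest :: "'v set \<Rightarrow> 'e set \<Rightarrow> ('v \<times> 'e) set \<Rightarrow> bool" where
  empty: "inc_forest {} {} {}"
| point: "inc_forest V E I \<Longrightarrow> v \<notin> V \<Longrightarrow> inc_forest (insert v V) E I"
| line: "inc_forest V E I \<Longrightarrow> v \<in> V \<Longrightarrow> e \<notin> E \<Longrightarrow> inc_forest V (insert e E) (insert (v, e) I)"
| point_on_line: "inc_forest V E I \<Longrightarrow> v \<notin> V \<Longrightarrow> e \<in> E \<Longrightarrow>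
    inc_forest (insert v V) E (insert (v, e) I)"

lemma inc_forest_subset: "inc_forest V E I \<Longrightarrow> I \<subseteq> V \<times> E"
  by (induction rule: inc_forest.induct) auto

text \<open>The line is spanned by p and the row w = m \<alpha>, whose entries outside \<alpha> and
  \<beta> are free. The other spanning vector is (p - p \<beta> * w) / p \<alpha>, whence the
  exterior product on the right. W is the row with its two forced entries written as constants, so
  that the right sides use free entries only.\<close>

lemma line_through_point:
  fixes p :: "'n \<Rightarrow> complex" and m :: "'n \<Rightarrow> 'n \<Rightarrow> complex"
  assumes "\<alpha> \<noteq> \<beta>" "p \<alpha> \<noteq> 0"
  defines "W \<equiv> \<lambda>j. if j = \<alpha> then 0 else if j = \<beta> then 1 else m \<alpha> j"
  shows "(m \<alpha> \<beta> = 1 \<and> (\<forall>i j. m i j = m i \<beta> * m \<alpha> j - m j \<beta> * m \<alpha> i) \<and>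
      (\<forall>i. p i = p \<alpha> * m i \<beta> + p \<beta> * m \<alpha> i)) \<longleftrightarrow>
    (\<forall>i j. \<not> (i = \<alpha> \<and> j \<noteq> \<alpha> \<and> j \<noteq> \<beta>) \<longrightarrow>
      p \<alpha> * m i j = (p i - p \<beta> * W i) * W j - (p j - p \<beta> * W j) * W i)" (is "?L \<longleftrightarrow> ?R")
proof
  assume L: ?L
  note L1 = L[THEN conjunct1]
    and L2 = L[THEN conjunct2, THEN conjunct1, rule_format]
    and L3 = L[THEN conjunct2, THEN conjunct2, rule_format]
  have "m \<alpha> \<alpha> = 0" using L2[of \<alpha> \<alpha>] unfolding diff_self .
  then have W: "W j = m \<alpha> j" for j using L1 by (simp add: W_def)
  have T: "p i - p \<beta> * W i = p \<alpha> * m i \<beta>" for i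
    using L3[of i] by (simp add: W)
  show ?R
  proof (intro allI impI)
    fix i j
    show "p \<alpha> * m i j = (p i - p \<beta> * W i) * W j - (p j - p \<beta> * W j) * W i"
      unfolding T unfolding W L2[of i j] right_diff_distrib by (simp add: mult.assoc)
  qed
next
  assume R: ?R
  have "p \<alpha> * m \<alpha> j = (p \<alpha> - p \<beta> * W \<alpha>) * W j - (p j - p \<beta> * W j) * W \<alpha>"
    if "j \<noteq> \<alpha>" "j \<noteq> \<beta>" for j
    using that by (simp add: W_def)
  then have R': "p \<alpha> * m i j = (p i - p \<beta> * W i) * W j - (p j - p \<beta> * W j) * W i" for i j
    using R by (cases "i = \<alpha> \<and> j \<noteq> \<alpha> \<and> j \<noteq> \<beta>") auto
  have "W \<alpha> = 0" "W \<beta> = 1" using assms(1) by (auto simp: W_def)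
  then have pa: "p \<alpha> * m \<alpha> j = p \<alpha> * W j" and pb: "p \<alpha> * m i \<beta> = p i - p \<beta> * W i" for i j
    using R'[of \<alpha> j] R'[of i \<beta>] by (auto simp: algebra_simps)
  then have W: "m \<alpha> j = W j" for j using assms(2) by simp
  have "p \<alpha> * m i j = p \<alpha> * (m i \<beta> * m \<alpha> j - m j \<beta> * m \<alpha> i)" for i j
    unfolding right_diff_distrib mult.assoc[symmetric] pb W by (rule R')
  then have "m i j = m i \<beta> * m \<alpha> j - m j \<beta> * m \<alpha> i" for i j
    using assms(2) by (metis mult_left_cancel)
  moreover have "m \<alpha> \<beta> = 1" using W \<open>W \<beta> = 1\<close> by simp
  moreover have "p i = p \<alpha> * m i \<beta> + p \<beta> * m \<alpha> i" for i
    using pb[of i] W[of i] by simp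
  ultimately show ?L by blast
qed

text \<open>The mirror image for p \<beta> \<noteq> 0: the column u = m _ \<beta> is free and the
  row is recovered as (p - p \<alpha> * u) / p \<beta>.\<close>

lemma line_through_point':
  fixes p :: "'n \<Rightarrow> complex" and m :: "'n \<Rightarrow> 'n \<Rightarrow> complex"
  assumes "\<alpha> \<noteq> \<beta>" "p \<beta> \<noteq> 0"
  defines "U \<equiv> \<lambda>i. if i = \<alpha> then 1 else if i = \<beta> then 0 else m i \<beta>"
  shows "(m \<alpha> \<beta> = 1 \<and> (\<forall>i j. m i j = m i \<beta> * m \<alpha> j - m j \<beta> * m \<alpha> i) \<and>
      (\<forall>i. p i = p \<alpha> * m i \<beta> + p \<beta> * m \<alpha> i)) \<longleftrightarrow>
    (\<forall>i j. \<not> (j = \<beta> \<and> i \<noteq> \<alpha> \<and> i \<noteq> \<beta>) \<longrightarrow>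
      p \<beta> * m i j = U i * (p j - p \<alpha> * U j) - U j * (p i - p \<alpha> * U i))" (is "?L \<longleftrightarrow> ?R")
proof
  assume L: ?L
  note L1 = L[THEN conjunct1]
    and L2 = L[THEN conjunct2, THEN conjunct1, rule_format]
    and L3 = L[THEN conjunct2, THEN conjunct2, rule_format]
  have "m \<beta> \<beta> = 0" using L2[of \<beta> \<beta>] unfolding diff_self .
  then have U: "U i = m i \<beta>" for i using L1 by (simp add: U_def)
  have T: "p i - p \<alpha> * U i = p \<beta> * m \<alpha> i" for i
    using L3[of i] by (simp add: U)
  show ?R
  proof (intro allI impI)
    fix i j
    show "p \<beta> * m i j = U i * (p j - p \<alpha> * U j) - U j * (p i - p \<alpha> * U i)"
      unfolding T unfolding U L2[of i j] right_diff_distrib by (simp add: mult.left_commute)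
  qed
next
  assume R: ?R
  have "p \<beta> * m i \<beta> = U i * (p \<beta> - p \<alpha> * U \<beta>) - U \<beta> * (p i - p \<alpha> * U i)"
    if "i \<noteq> \<alpha>" "i \<noteq> \<beta>" for i
    using that assms(1) by (simp add: U_def)
  then have R': "p \<beta> * m i j = U i * (p j - p \<alpha> * U j) - U j * (p i - p \<alpha> * U i)" for i j
    using R by (cases "j = \<beta> \<and> i \<noteq> \<alpha> \<and> i \<noteq> \<beta>") auto
  have U1: "U \<alpha> = 1" "U \<beta> = 0" using assms(1) by (auto simp: U_def)
  then have pa: "p \<beta> * m \<alpha> j = p j - p \<alpha> * U j" and pb: "p \<beta> * m i \<beta> = p \<beta> * U i" for i j
    using R'[of \<alpha> j] R'[of i \<beta>] by (auto simp: algebra_simps)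
  then have U: "m i \<beta> = U i" for i using assms(2) by simp
  have "p \<beta> * (m i \<beta> * m \<alpha> j - m j \<beta> * m \<alpha> i) =
      m i \<beta> * (p \<beta> * m \<alpha> j) - m j \<beta> * (p \<beta> * m \<alpha> i)" for i j
    by (simp add: algebra_simps)
  then have "p \<beta> * m i j = p \<beta> * (m i \<beta> * m \<alpha> j - m j \<beta> * m \<alpha> i)" for i j
    unfolding pa U using R' by simp
  then have "m i j = m i \<beta> * m \<alpha> j - m j \<beta> * m \<alpha> i" for i j
    using assms(2) by (metis mult_left_cancel)
  moreover have "m \<alpha> \<beta> = 1" using U U1 by simp
  moreover have "p i = p \<alpha> * m i \<beta> + p \<beta> * m \<alpha> i" for i
    using pa[of i] U[of i] by simp
  ultimately show ?L by blast
qed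

text \<open>The entry p \<beta> is free, and the normalisation p \<gamma> = 1 determines p \<alpha>
  = (1 - p \<beta> * w \<gamma>) / u \<gamma>. The right side is the equation of the line multiplied
  by u \<gamma>.\<close>

lemma point_on_line_param:
  fixes p u w :: "'n \<Rightarrow> complex"
  assumes "\<alpha> \<noteq> \<beta>" "u \<alpha> = 1" "u \<beta> = 0" "w \<alpha> = 0" "w \<beta> = 1" "u \<gamma> \<noteq> 0"
  shows "(p \<gamma> = 1 \<and> (\<forall>i. p i = p \<alpha> * u i + p \<beta> * w i)) \<longleftrightarrow>
    (\<forall>i. i \<noteq> \<beta> \<longrightarrow> u \<gamma> * p i = (1 - p \<beta> * w \<gamma>) * u i + u \<gamma> * (p \<beta> * w i))" (is "?L \<longleftrightarrow> ?R")
proof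
  assume L: ?L
  note L1 = L[THEN conjunct1] and L2 = L[THEN conjunct2, rule_format]
  have pa: "1 - p \<beta> * w \<gamma> = u \<gamma> * p \<alpha>"
    using L2[of \<gamma>] unfolding L1 by (simp add: diff_eq_eq mult.commute)
  show ?R
  proof (intro allI impI)
    fix i
    show "u \<gamma> * p i = (1 - p \<beta> * w \<gamma>) * u i + u \<gamma> * (p \<beta> * w i)"
      unfolding pa L2[of i] by (simp add: distrib_left)
  qed
next
  assume R: ?R
  then have pa: "1 - p \<beta> * w \<gamma> = u \<gamma> * p \<alpha>" using assms by auto
  have "u \<gamma> * p i = u \<gamma> * (p \<alpha> * u i + p \<beta> * w i)" for i
    using R assms unfolding pa by (cases "i = \<beta>") (auto simp: algebra_simps)
  then have eq: "p i = p \<alpha> * u i + p \<beta> * w i" for i using assms(6) by (metis mult_left_cancel)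
  moreover have "p \<gamma> = 1"
    using eq[of \<gamma>] pa by (simp add: diff_eq_eq mult.commute)
  ultimately show ?L by blast
qed

text \<open>Each rule of \<open>inc_forest\<close> is an instance of
  \<open>locally_graph_extend\<close>. The entry used as denominator depends on the picture x, and
  the free coordinates depend on it too.\<close>

lemma inc_forest_locally_graph:
  assumes "inc_forest V E I" "x \<in> inc_space V E I"
  shows "\<exists>S. locally_graph (coords V E) (inc_space V E I) x S"
  using assms
proof (induction arbitrary: x rule: inc_forest.induct)
  case empty
  have coords: "coords {} {} = ({} :: ('v, 'e, 'n) coordinate set)" by (auto simp: coords_def)
  have "rational_graph {} {} (\<lambda>z. 1) (\<lambda>k z. z k)"
    by unfold_locales (auto intro: polynomials_intros)
  then show ?case
    unfolding locally_graph_def coords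
    by (intro exI[of _ "{}"] exI[of _ "\<lambda>z. 1"] exI[of _ "\<lambda>k z. z k"])
      (auto simp: inc_space_def coords)
next
  case (point V E I v)
  let ?K = "coords V E :: ('v, 'e, 'n) coordinate set"
  let ?r = "\<lambda>z k. if k \<in> ?K then z k else 0 :: complex"
  note sub = inc_forest_subset[OF point.hyps(1)]
  have "?r x \<in> inc_space V E I"
    unfolding restrict_inc_space[OF sub] using point.prems by (simp add: inc_space_def)
  from point.IH[OF this] obtain S where S: "locally_graph ?K (inc_space V E I) (?r x) S" ..
  \<comment> \<open>An isolated point has all coordinates free except the normalised one, which
    solves 1 * z k = 1.\<close>
  have "locally_graph (?K \<union> coords {v} {}) (inc_space (insert v V) E I) x (S \<union> {Pt v i |i. i \<noteq> c v})"
  proof (rule locally_graph_extend[OF S])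
    show "finite (coords {v} {} :: ('v, 'e, 'n) coordinate set)" by (simp add: finite_coords)
    show "?K \<inter> coords {v} {} = {}" using point.hyps(2) by (intro coords_disjoint) auto
    show "(\<lambda>z. 1) \<in> polynomials (?K \<union> {Pt v i |i. i \<noteq> c v})"
      by (intro polynomials_intros)
    show "(\<lambda>z. 1) \<in> polynomials (?K \<union> {Pt v i |i. i \<noteq> c v})" for k :: "('v, 'e, 'n) coordinate"
      by (intro polynomials_intros)
    show "?r z \<in> inc_space V E I" if "z \<in> inc_space (insert v V) E I" for z
      unfolding restrict_inc_space[OF sub] using that by (simp add: inc_space_def)
    fix z :: "('v, 'e, 'n) coordinate \<Rightarrow> complex"
    assume "z \<in> affine_space (?K \<union> coords {v} {})" and r: "?r z \<in> inc_space V E I"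
    then have "z \<in> affine_space (coords (insert v V) E)" by (simp add: coords_Un)
    then show "z \<in> inc_space (insert v V) E I \<longleftrightarrow>
        (\<forall>k\<in>coords {v} {} - {Pt v i |i. i \<noteq> c v}. 1 * z k = 1)"
      using r[unfolded restrict_inc_space[OF sub]]
      by (auto simp: inc_space_def coords_def)
  qed (use point.prems in \<open>auto simp: coords_def\<close>)
  then show ?case by (auto simp: coords_Un)
next
  case (line V E I v e)
  let ?K = "coords V E :: ('v, 'e, 'n) coordinate set"
  let ?r = "\<lambda>z k. if k \<in> ?K then z k else 0 :: complex"
  let ?N = "coords {} {e} :: ('v, 'e, 'n) coordinate set"
  note sub = inc_forest_subset[OF line.hyps(1)]
  have "?r x \<in> inc_space V E I"
    unfolding restrict_inc_space[OF sub] using line.prems by (simp add: inc_space_def)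
  from line.IH[OF this] obtain S where S: "locally_graph ?K (inc_space V E I) (?r x) S" ..
  have x: "line_eqs e x" "inc_eqs v e x" "x (Pt v (c v)) = 1"
    using line.prems line.hyps(2) by (auto simp: inc_space_def)
  have ab: "a e \<noteq> b e" using line_eqsD(3)[OF x(1)] .
  have N: "finite ?N" "?K \<inter> ?N = {}"
    using line.hyps(3) by (simp_all add: finite_coords coords_disjoint)
  have res: "?r z \<in> inc_space V E I" if "z \<in> inc_space V (insert e E) (insert (v, e) I)" for z
    unfolding restrict_inc_space[OF sub] using that by (simp add: inc_space_def)
  have iff: "z \<in> inc_space V (insert e E) (insert (v, e) I) \<longleftrightarrow> line_eqs e z \<and> inc_eqs v e z"
    if "z \<in> affine_space (?K \<union> ?N)" "?r z \<in> inc_space V E I" for z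
    using that(1) that(2)[unfolded restrict_inc_space[OF sub]]
    by (auto simp: inc_space_def coords_Un)
  \<comment> \<open>The normalised entry 1 of the point is a combination of entries of the line with
    these two coefficients.\<close>
  have "x (Pt v (a e)) \<noteq> 0 \<or> x (Pt v (b e)) \<noteq> 0"
    using x(2,3) unfolding inc_eqs_def by (metis add_cancel_right_left mult_zero_left zero_neq_one)
  then have "\<exists>S. locally_graph (?K \<union> ?N) (inc_space V (insert e E) (insert (v, e) I)) x S"
  proof
    assume nz: "x (Pt v (a e)) \<noteq> 0"
    define F :: "('v, 'e, 'n) coordinate set" where "F = {Pl e (a e) j |j. j \<noteq> a e \<and> j \<noteq> b e}"
    define W where "W j z = (if j = a e then 0 else if j = b e then 1 else z (Pl e (a e) j))"
      for j and z :: "('v, 'e, 'n) coordinate \<Rightarrow> complex"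
    define T where "T i z = z (Pt v i) - z (Pt v (b e)) * W i z" for i z
    define P where "P k z = (case k of Pt _ _ \<Rightarrow> 0 | Pl _ i j \<Rightarrow> T i z * W j z - T j z * W i z)"
      for k :: "('v, 'e, 'n) coordinate" and z
    have pt: "(\<lambda>z. z (Pt v i)) \<in> polynomials (?K \<union> F)" for i
      using line.hyps(2) by (intro polynomials.coord) simp
    have W_poly: "W j \<in> polynomials (?K \<union> F)" for j
      unfolding W_def[abs_def]
      by (cases "j = a e"; cases "j = b e") (auto simp: F_def intro: polynomials.intros)
    have T_poly: "T j \<in> polynomials (?K \<union> F)" for j
      unfolding T_def[abs_def] by (intro polynomials_intros pt W_poly)
    have P_poly: "P k \<in> polynomials (?K \<union> F)" for k
    proof (cases k)
      case (Pl e' i j)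
      show ?thesis unfolding P_def[abs_def] Pl coordinate.case
        by (intro polynomials_intros T_poly W_poly)
    qed (auto simp: P_def[abs_def] intro: polynomials.const)
    have "locally_graph (?K \<union> ?N) (inc_space V (insert e E) (insert (v, e) I)) x (S \<union> F)"
    proof (rule locally_graph_extend[OF S N _ pt nz P_poly res _ line.prems])
      fix z :: "('v, 'e, 'n) coordinate \<Rightarrow> complex"
      assume z: "z \<in> affine_space (?K \<union> ?N)" "?r z \<in> inc_space V E I" "z (Pt v (a e)) \<noteq> 0"
      have "Pl e i j \<in> F \<longleftrightarrow> i = a e \<and> j \<noteq> a e \<and> j \<noteq> b e" for i j
        by (auto simp: F_def)
      moreover have "(\<forall>k\<in>?N - F. z (Pt v (a e)) * z k = P k z) \<longleftrightarrow>
          (\<forall>i j. Pl e i j \<notin> F \<longrightarrow> z (Pt v (a e)) * z (Pl e i j) = P (Pl e i j) z)"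
        by (auto simp: coords_def)
      ultimately have "(\<forall>k\<in>?N - F. z (Pt v (a e)) * z k = P k z) \<longleftrightarrow>
          (\<forall>i j. \<not> (i = a e \<and> j \<noteq> a e \<and> j \<noteq> b e) \<longrightarrow>
            z (Pt v (a e)) * z (Pl e i j) = T i z * W j z - T j z * W i z)"
        by (simp add: P_def)
      also have "\<dots> \<longleftrightarrow> line_eqs e z \<and> inc_eqs v e z"
        unfolding T_def W_def line_eqs_def inc_eqs_def conj_assoc
        by (rule line_through_point[OF ab, of "\<lambda>i. z (Pt v i)" "\<lambda>i j. z (Pl e i j)", OF z(3),
              symmetric])
      finally show "z \<in> inc_space V (insert e E) (insert (v, e) I) \<longleftrightarrow>
          (\<forall>k\<in>?N - F. z (Pt v (a e)) * z k = P k z)"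
        using iff[OF z(1,2)] by simp
    qed (auto simp: F_def coords_def)
    then show ?thesis ..
  next
    assume nz: "x (Pt v (b e)) \<noteq> 0"
    define F :: "('v, 'e, 'n) coordinate set" where "F = {Pl e i (b e) |i. i \<noteq> a e \<and> i \<noteq> b e}"
    define U where "U i z = (if i = a e then 1 else if i = b e then 0 else z (Pl e i (b e)))"
      for i and z :: "('v, 'e, 'n) coordinate \<Rightarrow> complex"
    define T where "T i z = z (Pt v i) - z (Pt v (a e)) * U i z" for i z
    define P where "P k z = (case k of Pt _ _ \<Rightarrow> 0 | Pl _ i j \<Rightarrow> U i z * T j z - U j z * T i z)"
      for k :: "('v, 'e, 'n) coordinate" and z
    have pt: "(\<lambda>z. z (Pt v i)) \<in> polynomials (?K \<union> F)" for i
      using line.hyps(2) by (intro polynomials.coord) simp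
    have U_poly: "U j \<in> polynomials (?K \<union> F)" for j
      unfolding U_def[abs_def]
      by (cases "j = a e"; cases "j = b e") (auto simp: F_def intro: polynomials.intros)
    have T_poly: "T j \<in> polynomials (?K \<union> F)" for j
      unfolding T_def[abs_def] by (intro polynomials_intros pt U_poly)
    have P_poly: "P k \<in> polynomials (?K \<union> F)" for k
    proof (cases k)
      case (Pl e' i j)
      show ?thesis unfolding P_def[abs_def] Pl coordinate.case
        by (intro polynomials_intros T_poly U_poly)
    qed (auto simp: P_def[abs_def] intro: polynomials.const)
    have "locally_graph (?K \<union> ?N) (inc_space V (insert e E) (insert (v, e) I)) x (S \<union> F)"
    proof (rule locally_graph_extend[OF S N _ pt nz P_poly res _ line.prems])
      fix z :: "('v, 'e, 'n) coordinate \<Rightarrow> complex"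
      assume z: "z \<in> affine_space (?K \<union> ?N)" "?r z \<in> inc_space V E I" "z (Pt v (b e)) \<noteq> 0"
      have "Pl e i j \<in> F \<longleftrightarrow> j = b e \<and> i \<noteq> a e \<and> i \<noteq> b e" for i j
        by (auto simp: F_def)
      moreover have "(\<forall>k\<in>?N - F. z (Pt v (b e)) * z k = P k z) \<longleftrightarrow>
          (\<forall>i j. Pl e i j \<notin> F \<longrightarrow> z (Pt v (b e)) * z (Pl e i j) = P (Pl e i j) z)"
        by (auto simp: coords_def)
      ultimately have "(\<forall>k\<in>?N - F. z (Pt v (b e)) * z k = P k z) \<longleftrightarrow>
          (\<forall>i j. \<not> (j = b e \<and> i \<noteq> a e \<and> i \<noteq> b e) \<longrightarrow>
            z (Pt v (b e)) * z (Pl e i j) = U i z * T j z - U j z * T i z)"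
        by (simp add: P_def)
      also have "\<dots> \<longleftrightarrow> line_eqs e z \<and> inc_eqs v e z"
        unfolding T_def U_def line_eqs_def inc_eqs_def conj_assoc
        by (rule line_through_point'[OF ab, of "\<lambda>i. z (Pt v i)" "\<lambda>i j. z (Pl e i j)", OF z(3),
              symmetric])
      finally show "z \<in> inc_space V (insert e E) (insert (v, e) I) \<longleftrightarrow>
          (\<forall>k\<in>?N - F. z (Pt v (b e)) * z k = P k z)"
        using iff[OF z(1,2)] by simp
    qed (auto simp: F_def coords_def)
    then show ?thesis ..
  qed
  then show ?case by (simp add: coords_Un)
next
  case (point_on_line V E I v e)
  let ?K = "coords V E :: ('v, 'e, 'n) coordinate set"
  let ?r = "\<lambda>z k. if k \<in> ?K then z k else 0 :: complex"
  let ?N = "coords {v} {} :: ('v, 'e, 'n) coordinate set"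
  note sub = inc_forest_subset[OF point_on_line.hyps(1)]
  have "?r x \<in> inc_space V E I"
    unfolding restrict_inc_space[OF sub] using point_on_line.prems by (simp add: inc_space_def)
  from point_on_line.IH[OF this] obtain S where S: "locally_graph ?K (inc_space V E I) (?r x) S" ..
  have x: "line_eqs e x" "inc_eqs v e x" "x (Pt v (c v)) = 1"
    using point_on_line.prems point_on_line.hyps(3) by (auto simp: inc_space_def)
  have ab: "a e \<noteq> b e" using line_eqsD(3)[OF x(1)] .
  have N: "finite ?N" "?K \<inter> ?N = {}"
    using point_on_line.hyps(2) by (simp_all add: finite_coords coords_disjoint)
  have res: "?r z \<in> inc_space V E I" if "z \<in> inc_space (insert v V) E (insert (v, e) I)" for z
    unfolding restrict_inc_space[OF sub] using that by (simp add: inc_space_def)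
  have iff: "z \<in> inc_space (insert v V) E (insert (v, e) I) \<longleftrightarrow> z (Pt v (c v)) = 1 \<and> inc_eqs v e z"
    if "z \<in> affine_space (?K \<union> ?N)" "?r z \<in> inc_space V E I" for z
    using that(1) that(2)[unfolded restrict_inc_space[OF sub]]
    by (auto simp: inc_space_def coords_Un)
  have eqs: "z (Pl e (a e) (b e)) = 1" "z (Pl e i i) = 0" if "?r z \<in> inc_space V E I" for z i
    using line_eqsD[of e z] that[unfolded restrict_inc_space[OF sub]] point_on_line.hyps(3) by auto
  \<comment> \<open>The entry 1 of the point at \<open>c v\<close> is a combination of these two
    entries of the line.\<close>
  have "x (Pl e (c v) (b e)) \<noteq> 0 \<or> x (Pl e (a e) (c v)) \<noteq> 0"
    using x(2,3) unfolding inc_eqs_def by (metis add_cancel_right_left mult_zero_right zero_neq_one)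
  then have "\<exists>S. locally_graph (?K \<union> ?N) (inc_space (insert v V) E (insert (v, e) I)) x S"
  proof
    assume nz: "x (Pl e (c v) (b e)) \<noteq> 0"
    define F :: "('v, 'e, 'n) coordinate set" where "F = {Pt v (b e)}"
    define P where "P k z = (case k of Pl _ _ _ \<Rightarrow> 0 | Pt _ i \<Rightarrow>
        (1 - z (Pt v (b e)) * z (Pl e (a e) (c v))) * z (Pl e i (b e)) +
        z (Pl e (c v) (b e)) * (z (Pt v (b e)) * z (Pl e (a e) i)))"
      for k :: "('v, 'e, 'n) coordinate" and z :: "('v, 'e, 'n) coordinate \<Rightarrow> complex"
    have pl: "(\<lambda>z. z (Pl e i j)) \<in> polynomials (?K \<union> F)" for i j
      using point_on_line.hyps(3) by (intro polynomials.coord) simp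
    have pt: "(\<lambda>z. z (Pt v (b e))) \<in> polynomials (?K \<union> F)"
      by (intro polynomials.coord) (simp add: F_def)
    have P_poly: "P k \<in> polynomials (?K \<union> F)" for k
    proof (cases k)
      case (Pt v' i)
      show ?thesis unfolding P_def[abs_def] Pt coordinate.case
        by (intro polynomials_intros pt pl)
    qed (auto simp: P_def[abs_def] intro: polynomials.const)
    have "locally_graph (?K \<union> ?N) (inc_space (insert v V) E (insert (v, e) I)) x (S \<union> F)"
    proof (rule locally_graph_extend[OF S N _ pl nz P_poly res _ point_on_line.prems])
      fix z :: "('v, 'e, 'n) coordinate \<Rightarrow> complex"
      assume z: "z \<in> affine_space (?K \<union> ?N)" "?r z \<in> inc_space V E I" "z (Pl e (c v) (b e)) \<noteq> 0"
      have "(\<forall>k\<in>?N - F. z (Pl e (c v) (b e)) * z k = P k z) \<longleftrightarrow>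
          (\<forall>i. i \<noteq> b e \<longrightarrow> z (Pl e (c v) (b e)) * z (Pt v i) = P (Pt v i) z)"
        by (auto simp: coords_def F_def)
      also have "\<dots> \<longleftrightarrow> z (Pt v (c v)) = 1 \<and> inc_eqs v e z"
        unfolding P_def inc_eqs_def coordinate.case
        by (rule point_on_line_param[OF ab, of "\<lambda>i. z (Pl e i (b e))" "\<lambda>i. z (Pl e (a e) i)" "c v"
              "\<lambda>i. z (Pt v i)", OF eqs(1)[OF z(2)] eqs(2)[OF z(2)] eqs(2)[OF z(2)]
              eqs(1)[OF z(2)] z(3), symmetric])
      finally show "z \<in> inc_space (insert v V) E (insert (v, e) I) \<longleftrightarrow>
          (\<forall>k\<in>?N - F. z (Pl e (c v) (b e)) * z k = P k z)"
        using iff[OF z(1,2)] by simp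
    qed (auto simp: F_def coords_def)
    then show ?thesis ..
  next
    \<comment> \<open>The same parametrisation with the two spanning vectors, and so
      \<open>a e\<close> and \<open>b e\<close>, exchanged.\<close>
    assume nz: "x (Pl e (a e) (c v)) \<noteq> 0"
    define F :: "('v, 'e, 'n) coordinate set" where "F = {Pt v (a e)}"
    define P where "P k z = (case k of Pl _ _ _ \<Rightarrow> 0 | Pt _ i \<Rightarrow>
        (1 - z (Pt v (a e)) * z (Pl e (c v) (b e))) * z (Pl e (a e) i) +
        z (Pl e (a e) (c v)) * (z (Pt v (a e)) * z (Pl e i (b e))))"
      for k :: "('v, 'e, 'n) coordinate" and z :: "('v, 'e, 'n) coordinate \<Rightarrow> complex"
    have pl: "(\<lambda>z. z (Pl e i j)) \<in> polynomials (?K \<union> F)" for i j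
      using point_on_line.hyps(3) by (intro polynomials.coord) simp
    have pt: "(\<lambda>z. z (Pt v (a e))) \<in> polynomials (?K \<union> F)"
      by (intro polynomials.coord) (simp add: F_def)
    have P_poly: "P k \<in> polynomials (?K \<union> F)" for k
    proof (cases k)
      case (Pt v' i)
      show ?thesis unfolding P_def[abs_def] Pt coordinate.case
        by (intro polynomials_intros pt pl)
    qed (auto simp: P_def[abs_def] intro: polynomials.const)
    have "locally_graph (?K \<union> ?N) (inc_space (insert v V) E (insert (v, e) I)) x (S \<union> F)"
    proof (rule locally_graph_extend[OF S N _ pl nz P_poly res _ point_on_line.prems])
      fix z :: "('v, 'e, 'n) coordinate \<Rightarrow> complex"
      assume z: "z \<in> affine_space (?K \<union> ?N)" "?r z \<in> inc_space V E I" "z (Pl e (a e) (c v)) \<noteq> 0"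
      have "(\<forall>k\<in>?N - F. z (Pl e (a e) (c v)) * z k = P k z) \<longleftrightarrow>
          (\<forall>i. i \<noteq> a e \<longrightarrow> z (Pl e (a e) (c v)) * z (Pt v i) = P (Pt v i) z)"
        by (auto simp: coords_def F_def)
      also have "\<dots> \<longleftrightarrow> z (Pt v (c v)) = 1 \<and>
          (\<forall>i. z (Pt v i) = z (Pt v (b e)) * z (Pl e (a e) i) + z (Pt v (a e)) * z (Pl e i (b e)))"
        unfolding P_def coordinate.case
        by (rule point_on_line_param[OF ab[symmetric], of "\<lambda>i. z (Pl e (a e) i)"
              "\<lambda>i. z (Pl e i (b e))" "c v" "\<lambda>i. z (Pt v i)", OF eqs(1)[OF z(2)] eqs(2)[OF z(2)]
              eqs(2)[OF z(2)] eqs(1)[OF z(2)] z(3), symmetric])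
      finally show "z \<in> inc_space (insert v V) E (insert (v, e) I) \<longleftrightarrow>
          (\<forall>k\<in>?N - F. z (Pl e (a e) (c v)) * z k = P k z)"
        using iff[OF z(1,2)] by (simp add: inc_eqs_def add.commute)
    qed (auto simp: F_def coords_def)
    then show ?thesis ..
  qed
  then show ?case by (simp add: coords_Un)
qed

end

section \<open>Charts of picture spaces\<close>

text \<open>A loop contributes a single pair, so it is a leaf of the incidence graph.\<close>

definition incidences :: "('v, 'e) graph \<Rightarrow> ('v \<times> 'e) set" where
  "incidences G = {(v, e). e \<in> edges G \<and> v \<in> set_uprod (ends G e)}"

lemma incidences_subset: "multigraph G \<Longrightarrow> incidences G \<subseteq> verts G \<times> edges G"
  using multigraph.ends_in_verts by (fastforce simp: incidences_def)

lemma Union_blocks: "\<Union>(blocks G) = coords (verts G) (edges G)"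
  by (auto simp: blocks_def coords_def)

lemma span_pairE:
  fixes p :: "complex ^ 'n"
  assumes "p \<in> vec.span {u, w}"
  obtains \<alpha> \<beta> where "p = \<alpha> *s u + \<beta> *s w"
proof -
  from assms obtain \<alpha> where "p - \<alpha> *s u \<in> vec.span {w}"
    unfolding vec.span_insert by blast
  then obtain \<beta> where "p - \<alpha> *s u = \<beta> *s w"
    unfolding vec.span_singleton by blast
  then have "p = \<alpha> *s u + \<beta> *s w" by (simp add: diff_eq_eq add.commute)
  then show thesis by (rule that)
qed

lemma span_singleton_in_grassmannian:
  fixes p :: "complex ^ 'n"
  assumes "p \<noteq> 0"
  shows "vec.span {p} \<in> grassmannian 1"
  using assms vec.dim_span_eq_card_independent[of "{p}"]
  by (simp add: grassmannian_def vec.dim_span)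

lemma span_pair_in_grassmannian:
  fixes u w :: "complex ^ 'n"
  assumes "u $ \<alpha> = 1" "u $ \<beta> = 0" "w $ \<alpha> = 0" "w $ \<beta> = 1"
  shows "vec.span {u, w} \<in> grassmannian 2"
proof -
  have "w \<noteq> 0" using assms(4) by auto
  moreover have "u \<notin> vec.span {w}"
  proof
    assume "u \<in> vec.span {w}"
    then obtain k where "u = k *s w" unfolding vec.span_singleton by blast
    with assms(1,3) show False by simp
  qed
  ultimately have "vec.independent {u, w}"
    by (intro vec.independent_insertI vec.independent_empty) auto
  moreover have "u \<noteq> w" using assms by auto
  ultimately have "vec.dim (vec.span {u, w}) = 2"
    using vec.dim_span_eq_card_independent[of "{u, w}"] by simp
  then show ?thesis by (simp add: grassmannian_def)
qed

context incidence_chart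
begin

text \<open>The normalisation makes the 2 by 2 minor of the spanning vectors at rows
  \<open>a e\<close>, \<open>b e\<close> equal to 1; Cramer's rule then gives the equations.
  Conversely, a solution contains vectors spanning its points and lines.\<close>

lemma chart_eq_inc_space:
  fixes G :: "('v, 'e) graph"
  assumes "multigraph G"
    and \<sigma>_pt: "\<And>v. v \<in> verts G \<Longrightarrow> \<sigma> {Pt v i |i. True} = Pt v (c v)"
    and \<sigma>_pl: "\<And>e. e \<in> edges G \<Longrightarrow> \<sigma> {Pl e i j |i j. True} = Pl e (a e) (b e)"
  shows "{z \<in> (\<Union>P\<in>picture_space G. homogeneous_coords G P). \<forall>B\<in>blocks G. z (\<sigma> B) = 1} =
    inc_space (verts G) (edges G) (incidences G)" (is "?C = ?X")
proof
  have norm: "(\<forall>B\<in>blocks G. z (\<sigma> B) = 1) \<longleftrightarrow>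
      (\<forall>v\<in>verts G. z (Pt v (c v)) = 1) \<and> (\<forall>e\<in>edges G. z (Pl e (a e) (b e)) = 1)"
    for z :: "('v, 'e, 'n) coordinate \<Rightarrow> complex"
    by (simp add: blocks_def ball_Un \<sigma>_pt[simplified] \<sigma>_pl[simplified])
  show "?C \<subseteq> ?X"
  proof
    fix z assume "z \<in> ?C"
    then obtain P where P: "P \<in> picture_space G" and zP: "z \<in> homogeneous_coords G P"
      and z1: "\<And>v. v \<in> verts G \<Longrightarrow> z (Pt v (c v)) = 1"
      and ze: "\<And>e. e \<in> edges G \<Longrightarrow> z (Pl e (a e) (b e)) = 1"
      using norm[of z] by auto
    have aff: "z \<in> affine_space (coords (verts G) (edges G))"
      using zP by (simp add: homogeneous_coords_def Union_blocks)
    have line: "line_eqs e z \<and> (\<forall>v\<in>set_uprod (ends G e). inc_eqs v e z)" if e: "e \<in> edges G" for e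
    proof -
      have "\<exists>u w. vec.span {u, w} = line P e \<and> (\<forall>i j. z (Pl e i j) = u $ i * w $ j - u $ j * w $ i)"
        using zP e by (simp add: homogeneous_coords_def)
      then obtain u w where uw: "vec.span {u, w} = line P e"
        and pl': "\<forall>i j. z (Pl e i j) = u $ i * w $ j - u $ j * w $ i"
        by (elim exE conjE)
      note pl = pl'[rule_format]
      have 1: "u $ a e * w $ b e - u $ b e * w $ a e = 1"
        using ze[OF e] by (simp add: pl)
      have "line_eqs e z"
        unfolding line_eqs_def
      proof (intro conjI allI ze[OF e])
        fix i j
        \<comment> \<open>Multiplying by the minor, which is 1, turns the claim into a quadratic
          identity between 2 by 2 minors.\<close>
        have "u $ i * w $ j - u $ j * w $ i =
            (u $ a e * w $ b e - u $ b e * w $ a e) * (u $ i * w $ j - u $ j * w $ i)"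
          unfolding 1 by simp
        also have "\<dots> = (u $ i * w $ b e - u $ b e * w $ i) * (u $ a e * w $ j - u $ j * w $ a e) -
            (u $ j * w $ b e - u $ b e * w $ j) * (u $ a e * w $ i - u $ i * w $ a e)"
          by (simp add: algebra_simps)
        finally show "z (Pl e i j) = z (Pl e i (b e)) * z (Pl e (a e) j) -
            z (Pl e j (b e)) * z (Pl e (a e) i)"
          unfolding pl .
      qed
      moreover have "inc_eqs v e z" if v: "v \<in> set_uprod (ends G e)" for v
      proof -
        have vG: "v \<in> verts G" using multigraph.ends_in_verts[OF assms(1) e] v by blast
        then have "\<exists>p. vec.span {p} = point P v \<and> (\<forall>i. z (Pt v i) = p $ i)"
          using zP by (simp add: homogeneous_coords_def)
        then obtain p where p1: "vec.span {p} = point P v" and p2: "\<forall>i. z (Pt v i) = p $ i"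
          by (elim exE conjE)
        note p = p1 p2[rule_format]
        have "point P v \<subseteq> line P e" using P e v unfolding picture_space_def by blast
        then have "p \<in> vec.span {u, w}"
          using p(1) uw vec.span_base[of p "{p}"] by auto
        then obtain \<alpha> \<beta> where p_eq: "p = \<alpha> *s u + \<beta> *s w" by (rule span_pairE)
        show ?thesis
          unfolding inc_eqs_def
        proof
          fix i
          have "p $ i = (u $ a e * w $ b e - u $ b e * w $ a e) * (\<alpha> * u $ i + \<beta> * w $ i)"
            unfolding 1 by (simp add: p_eq)
          also have "\<dots> = p $ a e * (u $ i * w $ b e - u $ b e * w $ i) +
              p $ b e * (u $ a e * w $ i - u $ i * w $ a e)"
            by (simp add: p_eq algebra_simps)
          finally show "z (Pt v i) = z (Pt v (a e)) * z (Pl e i (b e)) + z (Pt v (b e)) * z (Pl e (a e) i)"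
            unfolding pl p(2) .
        qed
      qed
      ultimately show ?thesis by blast
    qed
    show "z \<in> ?X"
      unfolding inc_space_def using aff z1 line by (auto simp: incidences_def)
  qed
  show "?X \<subseteq> ?C"
  proof
    fix z assume z: "z \<in> ?X"
    define p where "p v = (\<chi> i. z (Pt v i))" for v
    define u where "u e = (\<chi> i. z (Pl e i (b e)))" for e
    define w where "w e = (\<chi> i. z (Pl e (a e) i))" for e
    define P where "P = \<lparr>point = restrict (\<lambda>v. vec.span {p v}) (verts G),
      line = restrict (\<lambda>e. vec.span {u e, w e}) (edges G)\<rparr>"
    have pt: "z (Pt v (c v)) = 1" if "v \<in> verts G" for v
      using z that by (simp add: inc_space_def)
    have le: "line_eqs e z" if "e \<in> edges G" for e
      using z that by (simp add: inc_space_def)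
    have inc: "inc_eqs v e z" if "e \<in> edges G" "v \<in> set_uprod (ends G e)" for v e
      using z that by (auto simp: inc_space_def incidences_def)
    have "vec.span {p v} \<in> grassmannian 1" if "v \<in> verts G" for v
    proof (rule span_singleton_in_grassmannian)
      have "p v $ c v = 1" using pt[OF that] by (simp add: p_def)
      then show "p v \<noteq> 0" by auto
    qed
    moreover have "vec.span {u e, w e} \<in> grassmannian 2" if "e \<in> edges G" for e
      using line_eqsD(1,2)[OF le[OF that]]
      by (intro span_pair_in_grassmannian[of _ "a e" "b e"]) (simp_all add: u_def w_def)
    moreover have "vec.span {p v} \<subseteq> vec.span {u e, w e}"
      if e: "e \<in> edges G" and v: "v \<in> set_uprod (ends G e)" for v e
    proof (rule vec.span_minimal)
      have "p v = z (Pt v (a e)) *s u e + z (Pt v (b e)) *s w e"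
        unfolding vec_eq_iff
      proof
        fix i
        show "p v $ i = (z (Pt v (a e)) *s u e + z (Pt v (b e)) *s w e) $ i"
          using inc[OF e v, unfolded inc_eqs_def, rule_format, of i] by (simp add: p_def u_def w_def)
      qed
      also have "\<dots> \<in> vec.span {u e, w e}"
        by (intro vec.span_add vec.span_scale vec.span_base) auto
      finally show "{p v} \<subseteq> vec.span {u e, w e}" by simp
    qed simp
    moreover have "v \<in> verts G" if "e \<in> edges G" "v \<in> set_uprod (ends G e)" for v e
      using multigraph.ends_in_verts[OF assms(1)] that by blast
    ultimately have "P \<in> picture_space G"
      by (auto simp: picture_space_def P_def)
    moreover have "z \<in> homogeneous_coords G P"
    proof -
      have "\<exists>u. vec.span {u} = point P v \<and> (\<forall>i. z (Pt v i) = u $ i)" if "v \<in> verts G" for v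
        using that by (intro exI[of _ "p v"]) (simp add: P_def p_def)
      moreover have "\<exists>u w. vec.span {u, w} = line P e \<and> (\<forall>i j. z (Pl e i j) = u $ i * w $ j - u $ j * w $ i)"
        if "e \<in> edges G" for e
      proof (rule exI[of _ "u e"], rule exI[of _ "w e"], intro conjI allI)
        show "vec.span {u e, w e} = line P e" using that by (simp add: P_def)
        show "z (Pl e i j) = u e $ i * w e $ j - u e $ j * w e $ i" for i j
          using le[OF that, unfolded line_eqs_def] unfolding u_def w_def vec_lambda_beta
          by (elim conjE allE)
      qed
      moreover have "z \<in> affine_space (\<Union>(blocks G))"
        using z by (simp add: Union_blocks inc_space_def)
      ultimately show ?thesis by (simp add: homogeneous_coords_def)
    qed
    moreover have "\<forall>B\<in>blocks G. z (\<sigma> B) = 1"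
      unfolding norm by (intro conjI ballI pt line_eqsD(1)[OF le])
    ultimately show "z \<in> ?C" by (intro CollectI conjI UN_I[of P])
  qed
qed

end

section \<open>Isthmuses and orchards\<close>

lemma sym_adjacency: "sym (adjacency G)"
proof (rule symI)
  have "Upair x y = Upair y x" for x y :: 'a by simp
  then show "(y, x) \<in> adjacency G" if "(x, y) \<in> adjacency G" for x y
    using that unfolding adjacency_def mem_Collect_eq case_prod_conv by metis
qed

lemma adjacency_delete_subset: "adjacency (delete_edge G e) \<subseteq> adjacency G"
  by (auto simp: adjacency_def delete_edge_def)

lemma adjacency_verts:
  assumes "multigraph G" "(u, v) \<in> adjacency G"
  shows "u \<in> verts G" "v \<in> verts G"
proof -
  from assms(2) obtain e where "e \<in> edges G" "ends G e = Upair u v" by (auto simp: adjacency_def)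
  with multigraph.ends_in_verts[OF assms(1), of e] show "u \<in> verts G" "v \<in> verts G" by auto
qed

lemma reachable_verts:
  assumes "multigraph G" "(u, v) \<in> (adjacency G)\<^sup>*" "u \<in> verts G"
  shows "v \<in> verts G"
  using assms(2,3) adjacency_verts[OF assms(1)] by (induction rule: rtrancl_induct) auto

lemma multigraph_delete_edge: "multigraph G \<Longrightarrow> multigraph (delete_edge G e)"
  by (auto simp: multigraph_def delete_edge_def)

lemma equiv_reachable: "equiv V ((adjacency G)\<^sup>* \<inter> V \<times> V)"
proof (rule equivI)
  show "refl_on V ((adjacency G)\<^sup>* \<inter> V \<times> V)" by (auto simp: refl_on_def)
  show "sym ((adjacency G)\<^sup>* \<inter> V \<times> V)"
    using sym_rtrancl[OF sym_adjacency, of G] by (auto simp: sym_def)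
  show "trans ((adjacency G)\<^sup>* \<inter> V \<times> V)"
    by (rule transI) (auto intro: rtrancl_trans)
qed auto

text \<open>Components after deletion map onto the components of G. If the ends stay connected,
  reachability is unchanged; otherwise the classes of u and v are merged, so this map of finite sets
  is not injective.\<close>

lemma isthmus_iff:
  assumes "multigraph G" "e \<in> edges G" "ends G e = Upair u v"
  shows "isthmus G e \<longleftrightarrow> (u, v) \<notin> (adjacency (delete_edge G e))\<^sup>*"
proof
  let ?R = "(adjacency G)\<^sup>*" and ?R' = "(adjacency (delete_edge G e))\<^sup>*"
  show "(u, v) \<notin> ?R'" if "isthmus G e"
  proof
    assume uv: "(u, v) \<in> ?R'"
    then have vu: "(v, u) \<in> ?R'" by (rule symD[OF sym_rtrancl[OF sym_adjacency]])
    have "(x, y) \<in> ?R'" if "(x, y) \<in> adjacency G" for x y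
    proof -
      from that obtain f where f: "f \<in> edges G" "ends G f = Upair x y" by (auto simp: adjacency_def)
      show ?thesis
      proof (cases "f = e")
        case True
        with f assms(3) uv vu show ?thesis by (auto simp: Upair_inject)
      next
        case False
        with f have "(x, y) \<in> adjacency (delete_edge G e)"
          by (auto simp: adjacency_def delete_edge_def)
        then show ?thesis by blast
      qed
    qed
    then have "?R \<subseteq> ?R'"
      by (intro rtrancl_subset_rtrancl subrelI)
    moreover have "?R' \<subseteq> ?R"
      by (intro rtrancl_mono adjacency_delete_subset)
    ultimately have "?R = ?R'" by blast
    then have "components (delete_edge G e) = components G"
      by (simp add: components_def) (simp add: delete_edge_def)
    with that show False by (simp add: isthmus_def)
  qed
  assume uv: "(u, v) \<notin> ?R'"
  let ?V = "verts G"
  define E where "E = ?R \<inter> ?V \<times> ?V"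
  define E' where "E' = ?R' \<inter> ?V \<times> ?V"
  have eq: "equiv ?V E" "equiv ?V E'" unfolding E_def E'_def by (rule equiv_reachable)+
  have "E' \<subseteq> E" using rtrancl_mono[OF adjacency_delete_subset[of G e]] unfolding E_def E'_def by blast
  have V: "u \<in> ?V" "v \<in> ?V"
    using multigraph.ends_in_verts[OF assms(1,2)] assms(3) by auto
  have img: "E `` (E' `` {x}) = E `` {x}" if "x \<in> ?V" for x
  proof -
    have "(x, x) \<in> E'" using that by (simp add: E'_def)
    moreover have "trans E" using eq(1) by (rule equivE)
    ultimately show ?thesis using \<open>E' \<subseteq> E\<close> by (blast dest: transD)
  qed
  have "?V // E = (\<lambda>C. E `` C) ` (?V // E')"
    unfolding quotient_def using img by auto
  moreover have fin: "finite (?V // E')"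
    using multigraph.finite_verts[OF assms(1)] by (simp add: quotient_def)
  moreover have "\<not> inj_on (\<lambda>C. E `` C) (?V // E')"
  proof
    assume inj: "inj_on (\<lambda>C. E `` C) (?V // E')"
    have "(u, v) \<in> E"
      using V assms(2,3) by (auto simp: E_def adjacency_def)
    then have "E `` (E' `` {u}) = E `` (E' `` {v})"
      using V eq(1) by (simp add: img equiv_class_eq)
    then have "E' `` {u} = E' `` {v}"
      using inj_onD[OF inj] V by (simp add: quotientI)
    then have "(u, v) \<in> E'"
      using eq(2) V by (simp add: eq_equiv_class)
    with uv show False by (simp add: E'_def)
  qed
  ultimately have "card (?V // E) < card (?V // E')"
    using card_image_le[OF fin] eq_card_imp_inj_on[OF fin] by (metis le_neq_implies_less)
  then show "isthmus G e"
    by (simp add: isthmus_def components_def E_def E'_def) (simp add: delete_edge_def)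
qed

text \<open>Some vertex of W has at most one edge to the rest of W. Otherwise a walk could leave
  every vertex by an edge other than the one it came along, and the part of the graph still ahead
  would shrink forever.\<close>

lemma orchard_leaf:
  assumes "multigraph G" "orchard G" "W \<subseteq> verts G" "W \<noteq> {}"
  shows "\<exists>v\<in>W. \<forall>e\<in>edges G. \<forall>f\<in>edges G. \<forall>u\<in>W - {v}. \<forall>w\<in>W - {v}.
    ends G e = Upair v u \<longrightarrow> ends G f = Upair v w \<longrightarrow> e = f"
proof (rule ccontr)
  assume "\<not> ?thesis"
  then have two: "\<exists>e\<in>edges G. \<exists>f\<in>edges G. e \<noteq> f \<and> (\<exists>u\<in>W - {v}. ends G e = Upair v u) \<and>
      (\<exists>w\<in>W - {v}. ends G f = Upair v w)" if "v \<in> W" for v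
    using that by blast
  \<comment> \<open>The part ahead at v when coming along e: all that is reachable from v without e.
    Its size decreases along the walk.\<close>
  define B where "B e v = {y. (v, y) \<in> (adjacency (delete_edge G e))\<^sup>*}" for e v
  have "False" if "e \<in> edges G" "v \<in> W" "u \<in> W - {v}" "ends G e = Upair v u" for e u v
    using that
  proof (induction "card (B e v)" arbitrary: e u v rule: less_induct)
    case less
    obtain f w where f: "f \<in> edges G" "f \<noteq> e" "w \<in> W - {v}" "ends G f = Upair v w"
      using two[OF less.prems(2)] by metis
    then have fwv: "ends G f = Upair w v" by (simp add: Upair_inject)
    have "\<not> loop G f" using f(3) fwv by (auto simp: loop_def Upair_inject)
    then have "isthmus G f" using assms(2) f(1) by (auto simp: orchard_def)
    then have wv: "(w, v) \<notin> (adjacency (delete_edge G f))\<^sup>*"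
      using isthmus_iff[OF assms(1) f(1) fwv] by simp
    have vw: "(v, w) \<in> adjacency (delete_edge G e)"
      using f(1,2,4) by (auto simp: adjacency_def delete_edge_def)
    \<comment> \<open>Since f is an isthmus, a path from w avoiding f never meets v and hence never
      uses e, which ends at v.\<close>
    have "(w, y) \<in> (adjacency (delete_edge G e))\<^sup>*" if "(w, y) \<in> (adjacency (delete_edge G f))\<^sup>*" for y
      using that
    proof (induction rule: rtrancl_induct)
      case (step y y')
      from step.hyps(2) obtain g where g: "g \<in> edges G" "g \<noteq> f" "ends G g = Upair y y'"
        by (auto simp: adjacency_def delete_edge_def)
      have "y \<noteq> v" using step.hyps(1) wv by blast
      moreover have "y' \<noteq> v" using step.hyps wv by (metis rtrancl.rtrancl_into_rtrancl)
      ultimately have "g \<noteq> e" using g(3) less.prems(4) by (auto simp: Upair_inject)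
      then have "(y, y') \<in> adjacency (delete_edge G e)"
        using g by (auto simp: adjacency_def delete_edge_def)
      with step.IH show ?case by simp
    qed simp
    then have "B f w \<subseteq> B e v"
      unfolding B_def using vw by (blast intro: converse_rtrancl_into_rtrancl)
    moreover have "v \<in> B e v" "v \<notin> B f w" using wv by (auto simp: B_def)
    ultimately have "B f w \<subset> B e v" by blast
    moreover have "B e v \<subseteq> verts G"
      using reachable_verts[OF multigraph_delete_edge[OF assms(1)], of v _ e] less.prems(2) assms(3)
      by (auto simp: B_def delete_edge_def)
    then have "finite (B e v)"
      using multigraph.finite_verts[OF assms(1)] finite_subset by blast
    ultimately have "card (B f w) < card (B e v)" by (simp add: psubset_card_mono)
    then show False
      using f(1,3) fwv less.prems(2) by (intro less.hyps[of f w v]) auto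
  qed
  with two assms(4) show False by blast
qed

section \<open>Orchards have incidence forests\<close>

context incidence_chart
begin

lemma inc_forest_loops:
  assumes "inc_forest V E I" "v \<in> V" "finite L" "L \<inter> E = {}"
  shows "inc_forest V (L \<union> E) ({v} \<times> L \<union> I)"
  using assms(3,4)
proof (induction L rule: finite_induct)
  case empty
  then show ?case using assms(1) by simp
next
  case (insert e L)
  have eq: "{v} \<times> insert e L \<union> I = insert (v, e) ({v} \<times> L \<union> I)" by auto
  show ?case
    unfolding eq Un_insert_left using insert assms(2) by (intro inc_forest.line) auto
qed

text \<open>Induction on W, removing a vertex v as in \<open>orchard_leaf\<close>. Apart from loops
  at v at most one edge is new; it is attached at its old end, then v is placed on it, then the
  loops at v follow.\<close>

lemma orchard_inc_forest:
  fixes G :: "('v, 'e) graph"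
  assumes "multigraph G" "orchard G" "W \<subseteq> verts G"
  shows "inc_forest W {e \<in> edges G. set_uprod (ends G e) \<subseteq> W}
    {(v, e). e \<in> edges G \<and> set_uprod (ends G e) \<subseteq> W \<and> v \<in> set_uprod (ends G e)}"
proof -
  have "finite W" using assms(1,3) multigraph.finite_verts finite_subset by blast
  define E where "E W = {e \<in> edges G. set_uprod (ends G e) \<subseteq> W}" for W
  define I where "I W = {(v, e). e \<in> E W \<and> v \<in> set_uprod (ends G e)}" for W
  have "inc_forest W (E W) (I W)"
    using \<open>finite W\<close> assms(3)
  proof (induction W rule: finite_psubset_induct)
    case (psubset W)
    show ?case
    proof (cases "W = {}")
      case True
      have "set_uprod (ends G e) \<noteq> {}" for e
        by (cases "ends G e" rule: uprod_exhaust) simp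
      then have "E W = {}" "I W = {}" using True by (auto simp: E_def I_def)
      with True show ?thesis by (simp add: inc_forest.empty)
    next
      case False
      obtain v where v: "v \<in> W"
        and leaf: "\<forall>e\<in>edges G. \<forall>f\<in>edges G. \<forall>u\<in>W - {v}. \<forall>w\<in>W - {v}.
          ends G e = Upair v u \<longrightarrow> ends G f = Upair v w \<longrightarrow> e = f"
        using orchard_leaf[OF assms(1,2) psubset.prems False] by (elim bexE)
      define W' where "W' = W - {v}"
      have IH: "inc_forest W' (E W') (I W')"
        using v psubset.prems by (intro psubset.IH) (auto simp: W'_def)
      have W: "W = insert v W'" "v \<notin> W'" using v by (auto simp: W'_def)
      define L where "L = {e \<in> edges G. ends G e = Upair v v}"
      have "finite L" using multigraph.finite_edges[OF assms(1)] by (simp add: L_def)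
      define N where "N = {e \<in> edges G. \<exists>u\<in>W'. ends G e = Upair v u}"
      have E_W: "E W = L \<union> (N \<union> E W')"
      proof -
        have "e \<in> E W \<longleftrightarrow> e \<in> L \<or> e \<in> N \<or> e \<in> E W'" for e
          by (cases "ends G e" rule: uprod_exhaust)
            (auto simp: E_def L_def N_def W(1) Upair_inject)
        then show ?thesis by blast
      qed
      have I_W: "I W = {v} \<times> L \<union> ({(x, e). e \<in> N \<and> x \<in> set_uprod (ends G e)} \<union> I W')"
        unfolding I_def E_W by (auto simp: L_def)
      have disj: "L \<inter> (N \<union> E W') = {}"
        using W(2) by (auto simp: L_def N_def E_def Upair_inject)
      have "inc_forest W (N \<union> E W') ({(x, e). e \<in> N \<and> x \<in> set_uprod (ends G e)} \<union> I W')"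
      proof (cases "N = {}")
        case True
        then show ?thesis using inc_forest.point[OF IH W(2)] by (simp add: W(1))
      next
        case False
        then obtain e u where e: "e \<in> edges G" "u \<in> W'" "ends G e = Upair v u" by (auto simp: N_def)
        have "f = e" if "f \<in> N" for f
          using that leaf[rule_format, OF _ e(1) _ _ _ e(3), of f] e(2)
          unfolding N_def W'_def[symmetric] by blast
        with e have "N = {e}" by (auto simp: N_def)
        have "e \<notin> E W'" using e W(2) by (auto simp: E_def)
        then have "inc_forest (insert v W') (insert e (E W')) (insert (v, e) (insert (u, e) (I W')))"
          using W(2) by (intro inc_forest.point_on_line inc_forest.line IH e(2)) auto
        moreover have "{(x, f). f \<in> N \<and> x \<in> set_uprod (ends G f)} \<union> I W' =
            insert (v, e) (insert (u, e) (I W'))"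
          using e(3) by (auto simp: \<open>N = {e}\<close>)
        moreover have "N \<union> E W' = insert e (E W')" by (simp add: \<open>N = {e}\<close>)
        ultimately show ?thesis by (simp only: W(1))
      qed
      then show ?thesis
        unfolding E_W I_W using v \<open>finite L\<close> disj by (rule inc_forest_loops)
    qed
  qed
  then show ?thesis by (simp add: E_def I_def conj_assoc)
qed

lemma affine_smooth_orchard:
  fixes G :: "('v, 'e) graph"
  assumes "multigraph G" "orchard G"
  shows "affine_smooth (coords (verts G) (edges G)) (inc_space (verts G) (edges G) (incidences G))"
proof (rule affine_smooth_locally_graph)
  show "zariski_closed (coords (verts G) (edges G)) (inc_space (verts G) (edges G) (incidences G))"
    by (rule zariski_closed_inc_space[OF incidences_subset[OF assms(1)]])
  have E: "{e \<in> edges G. set_uprod (ends G e) \<subseteq> verts G} = edges G"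
    using multigraph.ends_in_verts[OF assms(1)] by blast
  have I: "{(v, e). e \<in> edges G \<and> set_uprod (ends G e) \<subseteq> verts G \<and> v \<in> set_uprod (ends G e)} =
      incidences G"
    using multigraph.ends_in_verts[OF assms(1)] by (auto simp: incidences_def)
  have "inc_forest (verts G) (edges G) (incidences G)"
    using orchard_inc_forest[OF assms subset_refl] unfolding E I .
  then show "\<exists>S. locally_graph (coords (verts G) (edges G))
      (inc_space (verts G) (edges G) (incidences G)) x S"
    if "x \<in> inc_space (verts G) (edges G) (incidences G)" for x
    using that by (rule inc_forest_locally_graph)
qed

end

section \<open>The totally degenerate picture\<close>

lemma component_representative:
  "\<exists>rep. (\<forall>v. (v, rep v) \<in> (adjacency G)\<^sup>*) \<and> (\<forall>u v. (u, v) \<in> (adjacency G)\<^sup>* \<longrightarrow> rep u = rep v)"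
proof -
  let ?R = "(adjacency G)\<^sup>*"
  define rep where "rep v = (SOME r. (v, r) \<in> ?R)" for v
  have "(v, rep v) \<in> ?R" for v
    unfolding rep_def by (rule someI[of _ v]) simp
  moreover have "rep u = rep v" if uv: "(u, v) \<in> ?R" for u v
  proof -
    have vu: "(v, u) \<in> ?R" using sym_rtrancl[OF sym_adjacency] uv by (rule symD)
    have "(u, r) \<in> ?R \<longleftrightarrow> (v, r) \<in> ?R" for r
      using uv vu by (auto intro: rtrancl_trans)
    then show ?thesis by (simp add: rep_def)
  qed
  ultimately show ?thesis by (intro exI[of _ rep]) simp
qed

text \<open>In the chart with \<open>c = a = \<omega>\<close> and \<open>b = \<kappa>\<close>, the points \<open>e\<^sub>\<omega>\<close> and lines \<open>\<langle>e\<^sub>\<omega>, e\<^sub>\<kappa>\<rangle>\<close> form a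
  picture; all points coincide and all lines coincide. There \<open>Pl e \<omega> i\<close> is a slope of the
  line \<open>e\<close> and \<open>Pl e i \<kappa>\<close> an intercept, so that all coordinates are polynomials in the
  slopes, the coordinates \<open>Pt v \<kappa>\<close>, and the other coordinates of one point per component.\<close>

locale degenerate_picture = multigraph G
  for G :: "('v, 'e) graph" +
  fixes \<omega> \<kappa> :: "'n::finite" and rep :: "'v \<Rightarrow> 'v"
  assumes neq: "\<omega> \<noteq> \<kappa>"
    and rep: "(v, rep v) \<in> (adjacency G)\<^sup>*"
    and rep_eq: "(u, v) \<in> (adjacency G)\<^sup>* \<Longrightarrow> rep u = rep v"
begin

sublocale incidence_chart "\<lambda>v::'v. \<omega>" "\<lambda>e::'e. \<omega>" "\<lambda>e. \<kappa>" .

abbreviation "V \<equiv> verts G"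
abbreviation "E \<equiv> edges G"
abbreviation "X \<equiv> inc_space V E (incidences G)"
abbreviation "K \<equiv> coords V E :: ('v, 'e, 'n) coordinate set"

text \<open>With \<open>CARD('n)\<close> = d + 1 there are d - 1 choices for i, and
  \<open>rep\<close> takes one value per component, so the cardinality is the number n of the
  overview.\<close>

definition free :: "('v, 'e, 'n) coordinate set" where
  "free = {Pt v \<kappa> |v. v \<in> V} \<union> {Pt (rep v) i |v i. v \<in> V \<and> i \<noteq> \<omega> \<and> i \<noteq> \<kappa>} \<union>
    {Pl e \<omega> i |e i. e \<in> E \<and> i \<noteq> \<omega> \<and> i \<noteq> \<kappa>}"

lemma mg: "multigraph G" ..

lemma finite_K: "finite K"
  using finite_verts finite_edges by (rule finite_coords)

lemma rep_verts: "v \<in> V \<Longrightarrow> rep v \<in> V"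
  using reachable_verts[OF mg rep] .

lemma rep_rep: "rep (rep v) = rep v"
  using rep_eq[OF rep] by simp

lemma free_subset: "free \<subseteq> K"
  using rep_verts by (auto simp: free_def)

lemma ends_nonempty: "\<exists>v. v \<in> set_uprod (ends G e)"
  by (cases "ends G e" rule: uprod_exhaust) auto

lemma inc_verts: "e \<in> E \<Longrightarrow> v \<in> set_uprod (ends G e) \<Longrightarrow> v \<in> V"
  using ends_in_verts by blast

section \<open>Pictures given by vectors, and tangent vectors at the degenerate picture\<close>

definition pic :: "('v \<Rightarrow> 'n \<Rightarrow> complex) \<Rightarrow> ('e \<Rightarrow> 'n \<Rightarrow> complex) \<Rightarrow> ('e \<Rightarrow> 'n \<Rightarrow> complex) \<Rightarrow>
    ('v, 'e, 'n) coordinate \<Rightarrow> complex" where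
  "pic p u w k = (case k of Pt v i \<Rightarrow> if v \<in> V then p v i else 0
    | Pl e i j \<Rightarrow> if e \<in> E then u e i * w e j - u e j * w e i else 0)"

lemma pic_in_X:
  assumes "\<And>v. v \<in> V \<Longrightarrow> p v \<omega> = 1"
    and "\<And>e. e \<in> E \<Longrightarrow> u e \<omega> = 1 \<and> u e \<kappa> = 0 \<and> w e \<omega> = 0 \<and> w e \<kappa> = 1"
    and "\<And>v e i. e \<in> E \<Longrightarrow> v \<in> set_uprod (ends G e) \<Longrightarrow> p v i = u e i + p v \<kappa> * w e i"
  shows "pic p u w \<in> X"
proof -
  have "pic p u w k = 0" if "k \<notin> K" for k
    using that by (cases k) (auto simp: pic_def)
  then have "pic p u w \<in> affine_space K" by (simp add: affine_space_def)
  moreover have "pic p u w (Pt v \<omega>) = 1" if "v \<in> V" for v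
    using that assms(1) by (simp add: pic_def)
  moreover have "line_eqs e (pic p u w)" if "e \<in> E" for e
    unfolding line_eqs_def using that assms(2)[OF that] by (simp add: pic_def)
  moreover have "inc_eqs v e (pic p u w)" if "(v, e) \<in> incidences G" for v e
  proof -
    have ve: "e \<in> E" "v \<in> set_uprod (ends G e)" "v \<in> V"
      using that inc_verts by (auto simp: incidences_def)
    show ?thesis
      unfolding inc_eqs_def
    proof
      fix i
      show "pic p u w (Pt v i) = pic p u w (Pt v \<omega>) * pic p u w (Pl e i \<kappa>) +
          pic p u w (Pt v \<kappa>) * pic p u w (Pl e \<omega> i)"
        using ve assms(1)[OF ve(3)] assms(2)[OF ve(1)] assms(3)[OF ve(1,2), of i]
        by (simp add: pic_def)
    qed
  qed
  ultimately show ?thesis unfolding inc_space_def by auto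
qed

definition origin :: "('v, 'e, 'n) coordinate \<Rightarrow> complex" where
  "origin = pic (\<lambda>v i. if i = \<omega> then 1 else 0) (\<lambda>e i. if i = \<omega> then 1 else 0)
    (\<lambda>e i. if i = \<kappa> then 1 else 0)"

lemma origin_in_X: "origin \<in> X"
  unfolding origin_def using neq by (intro pic_in_X) auto

text \<open>Here p, u and w are velocities of the points and of the two spanning vectors of each
  line. The last hypothesis, for all t, makes the motion with these constant velocities stay inside
  the picture space, without corrections of higher order.\<close>

lemma tangent_vector:
  assumes "\<And>v. v \<in> V \<Longrightarrow> p v \<omega> = 0"
    and "\<And>e. e \<in> E \<Longrightarrow> u e \<omega> = 0 \<and> u e \<kappa> = 0 \<and> w e \<omega> = 0 \<and> w e \<kappa> = 0"
    and "\<And>v e i t. e \<in> E \<Longrightarrow> v \<in> set_uprod (ends G e) \<Longrightarrow>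
      p v i = u e i + p v \<kappa> * ((if i = \<kappa> then 1 else 0) + t * w e i)"
  shows "\<exists>\<xi>\<in>tangent_space K X origin. (\<forall>v\<in>V. \<forall>i. \<xi> (Pt v i) = p v i) \<and>
    (\<forall>e\<in>E. \<forall>i. \<xi> (Pl e \<omega> i) = w e i)"
proof -
  define P where "P t v i = (if i = \<omega> then 1 else 0) + t * p v i" for t v i
  define U where "U t e i = (if i = \<omega> then 1 else 0) + t * u e i" for t e i
  define W where "W t e i = (if i = \<kappa> then 1 else 0) + t * w e i" for t e i
  define \<xi> where "\<xi> k = (case k of Pt v i \<Rightarrow> if v \<in> V then p v i else 0
    | Pl e i j \<Rightarrow> if e \<in> E then
        (u e i * W 0 e j + w e j * U 0 e i) - (u e j * W 0 e i + w e i * U 0 e j) else 0)" for k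
  have d: "((\<lambda>t. U t e i) has_field_derivative u e i) (at 0)"
    "((\<lambda>t. W t e i) has_field_derivative w e i) (at 0)"
    "((\<lambda>t. P t v i) has_field_derivative p v i) (at 0)" for e i v
    unfolding U_def W_def P_def by (auto intro!: derivative_eq_intros)
  have "\<xi> \<in> tangent_space K X origin"
  proof (rule tangent_spaceI_curve[OF finite_K])
    have "\<xi> k = 0" if "k \<notin> K" for k using that by (cases k) (auto simp: \<xi>_def)
    then show "\<xi> \<in> affine_space K" by (simp add: affine_space_def)
    fix k :: "('v, 'e, 'n) coordinate" assume k: "k \<in> K"
    show "((\<lambda>t. pic (P t) (U t) (W t) k) has_field_derivative \<xi> k) (at 0)"
    proof (cases k)
      case (Pt v i)
      with k d(3)[of v i] show ?thesis by (simp add: pic_def \<xi>_def)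
    next
      case (Pl e i j)
      have "((\<lambda>t. U t e i * W t e j - U t e j * W t e i) has_field_derivative
          (u e i * W 0 e j + w e j * U 0 e i) - (u e j * W 0 e i + w e i * U 0 e j)) (at 0)"
        by (intro DERIV_diff DERIV_mult d)
      with k Pl show ?thesis by (simp add: pic_def \<xi>_def)
    qed
  next
    show "pic (P 0) (U 0) (W 0) = origin"
      unfolding origin_def by (simp add: P_def[abs_def] U_def[abs_def] W_def[abs_def])
    have "pic (P t) (U t) (W t) \<in> X" for t
    proof (rule pic_in_X)
      fix v assume "v \<in> V"
      then show "P t v \<omega> = 1" using assms(1) by (simp add: P_def)
    next
      fix e assume "e \<in> E"
      then show "U t e \<omega> = 1 \<and> U t e \<kappa> = 0 \<and> W t e \<omega> = 0 \<and> W t e \<kappa> = 1"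
        using assms(2) neq by (simp add: U_def W_def)
    next
      fix v e i assume e: "e \<in> E" "v \<in> set_uprod (ends G e)"
      \<comment> \<open>The hypothesis is the incidence equation at time t divided by t.\<close>
      have "t * p v i = t * (u e i + p v \<kappa> * W t e i)"
        unfolding W_def using assms(3)[OF e, of i t] by (rule arg_cong)
      moreover have "P t v \<kappa> = t * p v \<kappa>" using neq by (simp add: P_def)
      ultimately show "P t v i = U t e i + P t v \<kappa> * W t e i"
        by (simp add: P_def[of t v i] U_def distrib_left)
    qed
    then show "\<forall>\<^sub>F t in nhds 0. pic (P t) (U t) (W t) \<in> X" by simp
  qed
  moreover have "\<forall>v\<in>V. \<forall>i. \<xi> (Pt v i) = p v i" by (simp add: \<xi>_def)
  moreover have "\<xi> (Pl e \<omega> i) = w e i" if "e \<in> E" for e i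
    using that neq assms(2)[OF that] by (simp add: \<xi>_def U_def W_def)
  ultimately show ?thesis by blast
qed

lemma tangent_dual:
  assumes "k \<in> free"
  shows "\<exists>\<xi>\<in>tangent_space K X origin. \<forall>j\<in>free. \<xi> j = (if j = k then 1 else 0)"
proof -
  consider (lam) v where "k = Pt v \<kappa>" "v \<in> V"
    | (root) r i where "k = Pt (rep r) i" "r \<in> V" "i \<noteq> \<omega>" "i \<noteq> \<kappa>"
    | (slope) e i where "k = Pl e \<omega> i" "e \<in> E" "i \<noteq> \<omega>" "i \<noteq> \<kappa>"
    using assms unfolding free_def by blast
  then show ?thesis
  proof cases
    case lam
    \<comment> \<open>One point slides along the common line while everything else rests.\<close>
    have "\<exists>\<xi>\<in>tangent_space K X origin.
        (\<forall>v'\<in>V. \<forall>i. \<xi> (Pt v' i) = (if v' = v \<and> i = \<kappa> then 1 else 0)) \<and>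
        (\<forall>e\<in>E. \<forall>i. \<xi> (Pl e \<omega> i) = 0)"
      using neq by (intro tangent_vector[where u = "\<lambda>e i. 0"]) auto
    then obtain \<xi> where \<xi>: "\<xi> \<in> tangent_space K X origin"
      "\<forall>v'\<in>V. \<forall>i. \<xi> (Pt v' i) = (if v' = v \<and> i = \<kappa> then 1 else 0)"
      "\<forall>e\<in>E. \<forall>i. \<xi> (Pl e \<omega> i) = 0" by blast
    then show ?thesis
      by (intro bexI[of _ \<xi>]) (auto simp: free_def lam rep_verts split: if_splits)
  next
    case root
    define re where "re e = rep (SOME v. v \<in> set_uprod (ends G e))" for e
    have re: "rep v = re e" if "e \<in> E" "v \<in> set_uprod (ends G e)" for v e
    proof -
      have s: "(SOME v. v \<in> set_uprod (ends G e)) \<in> set_uprod (ends G e)"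
        using ends_nonempty by (rule someI_ex)
      have "x = y \<or> (x, y) \<in> adjacency G"
        if "x \<in> set_uprod (ends G e)" "y \<in> set_uprod (ends G e)" for x y
        using that \<open>e \<in> E\<close> by (cases "ends G e" rule: uprod_exhaust)
          (auto simp: adjacency_def intro!: bexI[of _ e])
      from this[OF that(2) s] show ?thesis
        unfolding re_def by (auto intro: rep_eq)
    qed
    \<comment> \<open>A whole component, points and lines alike, is translated in direction
      i.\<close>
    have "\<exists>\<xi>\<in>tangent_space K X origin.
        (\<forall>v\<in>V. \<forall>j. \<xi> (Pt v j) = (if rep v = rep r \<and> j = i then 1 else 0)) \<and>
        (\<forall>e\<in>E. \<forall>j. \<xi> (Pl e \<omega> j) = 0)"
      using root(3,4) re
      by (intro tangent_vector[where u = "\<lambda>e j. if re e = rep r \<and> j = i then 1 else 0"]) auto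
    then obtain \<xi> where \<xi>: "\<xi> \<in> tangent_space K X origin"
      "\<forall>v\<in>V. \<forall>j. \<xi> (Pt v j) = (if rep v = rep r \<and> j = i then 1 else 0)"
      "\<forall>e\<in>E. \<forall>j. \<xi> (Pl e \<omega> j) = 0" by blast
    have "\<xi> (Pt v \<kappa>) = 0" if "v \<in> V" for v
      using \<xi>(2) that root(4) by simp
    moreover have "\<xi> (Pt (rep v) j) = (if rep v = rep r \<and> j = i then 1 else 0)" if "v \<in> V" for v j
      using \<xi>(2)[rule_format, OF rep_verts[OF that], of j] by (simp only: rep_rep)
    ultimately have "\<xi> j = (if j = k then 1 else 0)" if "j \<in> free" for j
      using that root(1,4) \<xi>(3) unfolding free_def by (elim UnE CollectE exE conjE) simp_all
    with \<xi>(1) show ?thesis by blast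
  next
    case slope
    \<comment> \<open>One line pivots about the common point in direction i.\<close>
    have "\<exists>\<xi>\<in>tangent_space K X origin. (\<forall>v\<in>V. \<forall>j. \<xi> (Pt v j) = 0) \<and>
        (\<forall>f\<in>E. \<forall>j. \<xi> (Pl f \<omega> j) = (if f = e \<and> j = i then 1 else 0))"
      using slope by (intro tangent_vector[where u = "\<lambda>e j. 0"]) auto
    then obtain \<xi> where \<xi>: "\<xi> \<in> tangent_space K X origin"
      "\<forall>v\<in>V. \<forall>j. \<xi> (Pt v j) = 0"
      "\<forall>f\<in>E. \<forall>j. \<xi> (Pl f \<omega> j) = (if f = e \<and> j = i then 1 else 0)" by blast
    then show ?thesis
      using slope by (intro bexI[of _ \<xi>]) (auto simp: free_def rep_verts split: if_splits)
  qed
qed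

lemma card_free_le_dim_tangent_space: "card free \<le> cfun.dim (tangent_space K X origin)"
proof -
  have "\<forall>k\<in>free. \<exists>\<xi>. \<xi> \<in> tangent_space K X origin \<and> (\<forall>j\<in>free. \<xi> j = (if j = k then 1 else 0))"
    using tangent_dual by blast
  from bchoice[OF this] obtain \<eta> where \<eta>: "\<forall>k\<in>free. \<eta> k \<in> tangent_space K X origin \<and>
      (\<forall>j\<in>free. \<eta> k j = (if j = k then 1 else 0))" ..
  show ?thesis
  proof (rule card_le_dim_dual_family[OF finite_K])
    show "tangent_space K X origin \<subseteq> affine_space K" by (auto simp: tangent_space_def)
    show "finite free" using free_subset finite_K by (rule finite_subset)
    show "\<eta> k \<in> tangent_space K X origin" if "k \<in> free" for k using \<eta> that by blast
    show "\<eta> k j = (if j = k then 1 else 0)" if "j \<in> free" "k \<in> free" for j k using \<eta> that by blast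
  qed
qed

section \<open>Polynomial dependence on the free coordinates\<close>

lemma incidence:
  assumes "z \<in> X" "e \<in> E" "v \<in> set_uprod (ends G e)"
  shows "z (Pt v i) = z (Pl e i \<kappa>) + z (Pt v \<kappa>) * z (Pl e \<omega> i)"
proof -
  have "inc_eqs v e z" using assms by (auto simp: inc_space_def incidences_def)
  moreover have "z (Pt v \<omega>) = 1" using assms inc_verts by (simp add: inc_space_def)
  ultimately show ?thesis by (metis inc_eqs_def mult_1)
qed

text \<open>The intercept cancels between the two ends of an edge, leaving slope times difference of
  \<open>\<kappa>\<close>-coordinates; these add up along a path. Recording F shows that h avoids
  the slopes of the other edges.\<close>

lemma displacement:
  assumes "F \<subseteq> E" "v \<in> V" "(v, v') \<in> {(x, y). \<exists>e\<in>F. ends G e = Upair x y}\<^sup>*"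
  shows "\<exists>h\<in>polynomials ({Pt v \<kappa> |v. v \<in> V} \<union> {Pl e \<omega> i |e. e \<in> F}).
    \<forall>z\<in>X. z (Pt v' i) = z (Pt v i) + h z"
  using assms(3)
proof (induction rule: rtrancl_induct)
  case base
  show ?case by (intro bexI[of _ "\<lambda>z. 0"]) (auto intro: polynomials.const)
next
  case (step y y')
  from step.hyps(2) obtain e where e: "e \<in> F" "ends G e = Upair y y'" by blast
  with assms(1) have eE: "e \<in> E" by blast
  have ends: "y \<in> set_uprod (ends G e)" "y' \<in> set_uprod (ends G e)" by (simp_all add: e(2))
  let ?S = "{Pt v \<kappa> |v. v \<in> V} \<union> {Pl e \<omega> i |e. e \<in> F}"
  from step.IH obtain h where h: "h \<in> polynomials ?S" "\<forall>z\<in>X. z (Pt y i) = z (Pt v i) + h z" ..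
  have "(\<lambda>z. h z + (z (Pt y' \<kappa>) - z (Pt y \<kappa>)) * z (Pl e \<omega> i)) \<in> polynomials ?S"
    using e(1) inc_verts[OF eE] ends by (intro polynomials_intros h(1)) auto
  moreover have "z (Pt y' i) = z (Pt v i) + (h z + (z (Pt y' \<kappa>) - z (Pt y \<kappa>)) * z (Pl e \<omega> i))"
    if "z \<in> X" for z
  proof -
    have "z (Pt y' i) - z (Pt y i) = (z (Pt y' \<kappa>) - z (Pt y \<kappa>)) * z (Pl e \<omega> i)"
      using incidence[OF that eE ends(1), of i] incidence[OF that eE ends(2), of i]
      by (simp add: algebra_simps)
    moreover have "z (Pt y i) = z (Pt v i) + h z" using h(2) that by blast
    ultimately show ?thesis by (simp add: diff_eq_eq)
  qed
  ultimately show ?case by (intro bexI ballI)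
qed

text \<open>Slopes are free or constant, points follow by transport from the representative,
  intercepts from an end of the edge, and the remaining Pluecker coordinates from
  \<open>line_eqs\<close>. No denominators arise, so X lies on a graph with L = 1.\<close>

lemma coordinate_polynomial:
  assumes "k \<in> K"
  shows "\<exists>g\<in>polynomials free. \<forall>z\<in>X. z k = g z"
proof -
  have slope: "\<exists>g\<in>polynomials free. \<forall>z\<in>X. z (Pl e \<omega> i) = g z" if e: "e \<in> E" for e i
  proof -
    have z: "z (Pl e \<omega> \<omega>) = 0" "z (Pl e \<omega> \<kappa>) = 1" if "z \<in> X" for z
      using that e line_eqsD[of e z] by (auto simp: inc_space_def)
    consider "i = \<omega>" | "i = \<kappa>" | "i \<noteq> \<omega>" "i \<noteq> \<kappa>" by blast
    then show ?thesis
    proof cases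
      case 1
      with z show ?thesis by (intro bexI[of _ "\<lambda>z. 0"]) (auto intro: polynomials.const)
    next
      case 2
      with z show ?thesis by (intro bexI[of _ "\<lambda>z. 1"]) (auto intro: polynomials.const)
    next
      case 3
      with e have "Pl e \<omega> i \<in> free" by (auto simp: free_def)
      then show ?thesis by (intro bexI[of _ "\<lambda>z. z (Pl e \<omega> i)"]) (auto intro: polynomials.coord)
    qed
  qed
  have pt: "\<exists>g\<in>polynomials free. \<forall>z\<in>X. z (Pt v i) = g z" if v: "v \<in> V" for v i
  proof -
    consider "i = \<omega>" | "i = \<kappa>" | "i \<noteq> \<omega>" "i \<noteq> \<kappa>" by blast
    then show ?thesis
    proof cases
      case 1
      with v show ?thesis
        by (intro bexI[of _ "\<lambda>z. 1"]) (auto simp: inc_space_def intro: polynomials.const)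
    next
      case 2
      with v have "Pt v i \<in> free" by (auto simp: free_def)
      then show ?thesis by (intro bexI[of _ "\<lambda>z. z (Pt v i)"]) (auto intro: polynomials.coord)
    next
      case 3
      have "(rep v, v) \<in> (adjacency G)\<^sup>*"
        using sym_rtrancl[OF sym_adjacency] rep by (rule symD)
      from displacement[OF subset_refl rep_verts[OF v] this[unfolded adjacency_def], of i]
      obtain h where h: "h \<in> polynomials ({Pt v \<kappa> |v. v \<in> V} \<union> {Pl e \<omega> i |e. e \<in> E})"
        "\<forall>z\<in>X. z (Pt v i) = z (Pt (rep v) i) + h z" ..
      have "h \<in> polynomials free"
        using h(1) by (rule polynomials_mono) (use 3 in \<open>auto simp: free_def\<close>)
      moreover have "Pt (rep v) i \<in> free" using 3 v by (auto simp: free_def)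
      ultimately show ?thesis
        using h(2) by (intro bexI[of _ "\<lambda>z. z (Pt (rep v) i) + h z"] polynomials_intros)
    qed
  qed
  have intercept: "\<exists>g\<in>polynomials free. \<forall>z\<in>X. z (Pl e i \<kappa>) = g z" if e: "e \<in> E" for e i
  proof -
    obtain v where v: "v \<in> set_uprod (ends G e)" using ends_nonempty by blast
    note vV = inc_verts[OF e v]
    obtain g1 where g1: "g1 \<in> polynomials free" "\<forall>z\<in>X. z (Pt v i) = g1 z" using pt[OF vV] ..
    obtain g2 where g2: "g2 \<in> polynomials free" "\<forall>z\<in>X. z (Pt v \<kappa>) = g2 z" using pt[OF vV] ..
    obtain g3 where g3: "g3 \<in> polynomials free" "\<forall>z\<in>X. z (Pl e \<omega> i) = g3 z" using slope[OF e] ..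
    have "z (Pl e i \<kappa>) = g1 z - g2 z * g3 z" if "z \<in> X" for z
      using incidence[OF that e v, of i] g1(2) g2(2) g3(2) that by (simp add: eq_diff_eq)
    then show ?thesis
      by (intro bexI[of _ "\<lambda>z. g1 z - g2 z * g3 z"] ballI polynomials_intros g1(1) g2(1) g3(1))
  qed
  show ?thesis
  proof (cases k)
    case (Pt v i)
    with assms pt show ?thesis by simp
  next
    case (Pl e i j)
    with assms have e: "e \<in> E" by simp
    obtain g1 where g1: "g1 \<in> polynomials free" "\<forall>z\<in>X. z (Pl e i \<kappa>) = g1 z" using intercept[OF e] ..
    obtain g2 where g2: "g2 \<in> polynomials free" "\<forall>z\<in>X. z (Pl e \<omega> j) = g2 z" using slope[OF e] ..
    obtain g3 where g3: "g3 \<in> polynomials free" "\<forall>z\<in>X. z (Pl e j \<kappa>) = g3 z" using intercept[OF e] ..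
    obtain g4 where g4: "g4 \<in> polynomials free" "\<forall>z\<in>X. z (Pl e \<omega> i) = g4 z" using slope[OF e] ..
    have "z k = g1 z * g2 z - g3 z * g4 z" if "z \<in> X" for z
    proof -
      have "line_eqs e z" using that e by (simp add: inc_space_def)
      then have "z (Pl e i j) = z (Pl e i \<kappa>) * z (Pl e \<omega> j) - z (Pl e j \<kappa>) * z (Pl e \<omega> i)"
        unfolding line_eqs_def by (elim conjE allE)
      then show ?thesis using g1(2) g2(2) g3(2) g4(2) that Pl by simp
    qed
    then show ?thesis
      by (intro bexI[of _ "\<lambda>z. g1 z * g2 z - g3 z * g4 z"] ballI polynomials_intros
          g1(1) g2(1) g3(1) g4(1))
  qed
qed

text \<open>Going around a cycle yields a nontrivial relation between the free coordinates.\<close>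

lemma cycle_relation:
  assumes "e \<in> E" "ends G e = Upair u v" "u \<noteq> v" "(u, v) \<in> (adjacency (delete_edge G e))\<^sup>*"
    and "i \<noteq> \<omega>" "i \<noteq> \<kappa>"
  shows "\<exists>f\<in>polynomials free. (\<forall>z\<in>X. f z = 0) \<and> (\<exists>s. f s \<noteq> 0)"
proof -
  have uv: "u \<in> set_uprod (ends G e)" "v \<in> set_uprod (ends G e)" by (simp_all add: assms(2))
  note V = inc_verts[OF assms(1)]
  let ?S = "{Pt v \<kappa> |v. v \<in> V} \<union> {Pl f \<omega> i |f. f \<in> E - {e}}"
  have "adjacency (delete_edge G e) = {(x, y). \<exists>f\<in>E - {e}. ends G f = Upair x y}"
    by (simp add: adjacency_def delete_edge_def)
  from displacement[OF Diff_subset V[OF uv(1)] assms(4)[unfolded this], of i]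
  obtain h where h: "h \<in> polynomials ?S" "\<forall>z\<in>X. z (Pt v i) = z (Pt u i) + h z" ..
  define f where "f z = h z - (z (Pt v \<kappa>) - z (Pt u \<kappa>)) * z (Pl e \<omega> i)" for z
  have "h \<in> polynomials free"
    using h(1) by (rule polynomials_mono) (use assms(5,6) in \<open>auto simp: free_def\<close>)
  moreover have "Pt v \<kappa> \<in> free" "Pt u \<kappa> \<in> free" "Pl e \<omega> i \<in> free"
    using assms V uv by (auto simp: free_def)
  ultimately have "f \<in> polynomials free"
    unfolding f_def[abs_def] by (intro polynomials_intros)
  moreover have "f z = 0" if "z \<in> X" for z
  proof -
    have "z (Pt v i) - z (Pt u i) = (z (Pt v \<kappa>) - z (Pt u \<kappa>)) * z (Pl e \<omega> i)"
      using incidence[OF that assms(1) uv(1), of i] incidence[OF that assms(1) uv(2), of i]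
      by (simp add: algebra_simps)
    moreover have "z (Pt v i) - z (Pt u i) = h z" using h(2)[rule_format, OF that] by simp
    ultimately show ?thesis by (simp add: f_def)
  qed
  moreover have "\<exists>s. f s \<noteq> 0"
  proof -
    \<comment> \<open>The polynomial h does not involve the slope of e, so changing that slope from
      0 to 1 changes only the product term; u \<noteq> v gives this term the coefficient 1.\<close>
    define s where "s x k = (if k = Pt v \<kappa> then 1 else if k = Pl e \<omega> i then x else 0 :: complex)" for x k
    have "h (s 0) = h (s 1)"
      using h(1) by (rule polynomials_cong) (auto simp: s_def)
    moreover have "f (s x) = h (s x) - x" for x
      using assms(3) by (simp add: f_def s_def)
    ultimately have "f (s 0) \<noteq> 0 \<or> f (s 1) \<noteq> 0" by auto
    then show ?thesis by blast
  qed
  ultimately show ?thesis by blast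
qed

text \<open>X lies in the graph Y over \<open>free\<close>, whose growth exponent is at most
  \<open>card free\<close>. The relation f vanishes on X but not on Y, which lowers the exponent by
  one.\<close>

lemma local_dim_origin_less:
  assumes "f \<in> polynomials free" "\<And>z. z \<in> X \<Longrightarrow> f z = 0" "f s \<noteq> 0"
  shows "local_dim K X origin < enat (card free)"
proof -
  \<comment> \<open>A free coordinate must be represented by itself, as
    \<open>rational_graph\<close> demands.\<close>
  define g where "g k = (if k \<in> free then (\<lambda>z. z k)
    else SOME g. g \<in> polynomials free \<and> (\<forall>z\<in>X. z k = g z))" for k
  have g: "g k \<in> polynomials free \<and> (\<forall>z\<in>X. z k = g k z)" if "k \<in> K" for k
  proof (cases "k \<in> free")
    case True
    then show ?thesis by (simp add: g_def polynomials.coord)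
  next
    case False
    have "\<exists>g. g \<in> polynomials free \<and> (\<forall>z\<in>X. z k = g z)"
      using coordinate_polynomial[OF that] by (simp add: Bex_def)
    from someI_ex[OF this] show ?thesis using False by (simp add: g_def)
  qed
  interpret A: rational_graph K free "\<lambda>z. 1" g
  proof
    show "g k = (\<lambda>z. 1 * z k)" if "k \<in> free" for k using that by (simp add: g_def)
  qed (use finite_K free_subset g in \<open>auto intro: polynomials.const\<close>)
  define Y where "Y = {z \<in> affine_space K. A.on_graph z}"
  have int: "integral_set K Y"
    using A.integral_slice[of "{}"] by (simp add: Y_def)
  have sub: "X \<subseteq> Y"
    using g by (auto simp: Y_def A.on_graph_def inc_space_def)
  have "growth K Y (card free)"
    using sub origin_in_X by (intro A.growth_graph[OF int]) (auto simp: Y_def)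
  moreover have "X \<noteq> {}" using origin_in_X by blast
  moreover have "f \<in> polynomials K" using assms(1) free_subset by (rule polynomials_mono)
  moreover have "\<exists>z\<in>Y. f z \<noteq> 0"
    using A.param_on_graph(1,2)[of s] A.polynomials_param[OF assms(1)] assms(3)
    by (intro bexI[of _ "A.param s"]) (auto simp: Y_def)
  ultimately have pos: "0 < card free" and gr: "growth K X (card free - 1)"
    using growth_proper_subset[OF finite_K _ sub _ int] assms(2) by metis+
  have "local_dim K X origin \<le> enat (card free - 1)"
    by (intro local_dim_le[OF finite_K] growth_mono[OF gr])
  also have "\<dots> < enat (card free)" using pos by simp
  finally show ?thesis .
qed

lemma not_affine_smooth:
  assumes "e \<in> E" "ends G e = Upair u v" "u \<noteq> v" "(u, v) \<in> (adjacency (delete_edge G e))\<^sup>*"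
    and "i \<noteq> \<omega>" "i \<noteq> \<kappa>"
  shows "\<not> affine_smooth K X"
proof
  assume "affine_smooth K X"
  then have "enat (cfun.dim (tangent_space K X origin)) = local_dim K X origin"
    using origin_in_X by (simp add: affine_smooth_def)
  moreover obtain f s where "f \<in> polynomials free" "\<And>z. z \<in> X \<Longrightarrow> f z = 0" "f s \<noteq> 0"
    using cycle_relation[OF assms] by blast
  then have "local_dim K X origin < enat (card free)"
    by (rule local_dim_origin_less)
  ultimately have "cfun.dim (tangent_space K X origin) < card free"
    by (metis enat_ord_simps(2))
  with card_free_le_dim_tangent_space show False by simp
qed

end

section \<open>Smoothness of picture spaces\<close>

theorem proposition15:
  fixes G :: "('v, 'e) graph" and d :: nat
  assumes "multigraph G"
    and "d \<ge> 2"
    and "CARD('n::finite) = d + 1"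
  shows "smooth G (picture_space G :: ('v, 'e, 'n) picture set) \<longleftrightarrow> orchard G"
proof
  assume orchard: "orchard G"
  show "smooth G (picture_space G :: ('v, 'e, 'n) picture set)"
    unfolding smooth_def multiprojective_smooth_def
  proof (intro allI impI)
    fix \<sigma> :: "('v, 'e, 'n) coordinate set \<Rightarrow> ('v, 'e, 'n) coordinate"
    assume \<sigma>: "\<forall>B\<in>blocks G. \<sigma> B \<in> B"
    \<comment> \<open>Every choice of one coordinate per block comes from maps c, a and b as in
      \<open>incidence_chart\<close>.\<close>
    have "\<exists>i. \<sigma> {Pt v i |i. True} = Pt v i" if "v \<in> verts G" for v
    proof -
      have "{Pt v i |i. True} \<in> blocks G" using that by (simp add: blocks_def)
      with \<sigma> have "\<sigma> {Pt v i |i. True} \<in> {Pt v i |i. True}" by (rule bspec)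
      then show ?thesis by (elim CollectE exE conjE) (rule exI)
    qed
    then obtain c where c: "\<And>v. v \<in> verts G \<Longrightarrow> \<sigma> {Pt v i |i. True} = Pt v (c v)" by metis
    have "\<exists>i j. \<sigma> {Pl e i j |i j. True} = Pl e i j" if "e \<in> edges G" for e
    proof -
      have "{Pl e i j |i j. True} \<in> blocks G" using that by (simp add: blocks_def)
      with \<sigma> have "\<sigma> {Pl e i j |i j. True} \<in> {Pl e i j |i j. True}" by (rule bspec)
      then show ?thesis by (elim CollectE exE conjE) (intro exI)
    qed
    then obtain a b where ab: "\<And>e. e \<in> edges G \<Longrightarrow> \<sigma> {Pl e i j |i j. True} = Pl e (a e) (b e)"
      by metis
    have eq: "{z \<in> (\<Union>P\<in>picture_space G. homogeneous_coords G P). \<forall>B\<in>blocks G. z (\<sigma> B) = 1} =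
        incidence_chart.inc_space c a b (verts G) (edges G) (incidences G)"
      using assms(1) c ab by (rule incidence_chart.chart_eq_inc_space)
    show "affine_smooth (\<Union>(blocks G))
        {z \<in> (\<Union>P\<in>picture_space G. homogeneous_coords G P). \<forall>B\<in>blocks G. z (\<sigma> B) = 1}"
      unfolding eq Union_blocks
      using assms(1) orchard by (rule incidence_chart.affine_smooth_orchard)
  qed
next
  assume smooth: "smooth G (picture_space G :: ('v, 'e, 'n) picture set)"
  show "orchard G"
    unfolding orchard_def
  proof (intro ballI, rule ccontr)
    fix e assume e: "e \<in> edges G" and "\<not> (loop G e \<or> isthmus G e)"
    then have "\<not> loop G e" "\<not> isthmus G e" by auto
    obtain u v where uv: "ends G e = Upair u v"
      by (cases "ends G e" rule: uprod_exhaust) blast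
    have "u \<noteq> v" using \<open>\<not> loop G e\<close> uv by (auto simp: loop_def)
    have path: "(u, v) \<in> (adjacency (delete_edge G e))\<^sup>*"
      using isthmus_iff[OF assms(1) e uv] \<open>\<not> isthmus G e\<close> by blast
    have "3 \<le> card (UNIV :: 'n set)" using assms(2,3) by simp
    then obtain T :: "'n set" where "card T = 3"
      by (rule obtain_subset_with_card_n)
    then obtain \<omega> \<kappa> i :: 'n where ind: "\<omega> \<noteq> \<kappa>" "i \<noteq> \<omega>" "i \<noteq> \<kappa>"
      unfolding card_3_iff by metis
    obtain rep where rep: "\<forall>v. (v, rep v) \<in> (adjacency G)\<^sup>*"
      "\<forall>u v. (u, v) \<in> (adjacency G)\<^sup>* \<longrightarrow> rep u = rep v"
      using component_representative[of G] by (elim exE conjE)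
    interpret degenerate_picture G \<omega> \<kappa> rep
      by (rule degenerate_picture.intro[OF assms(1)], unfold_locales) (use ind rep in auto)
    \<comment> \<open>A chart is a function on blocks, and the choice is unique on each block of G:
      \<open>Pt v \<omega>\<close> for a vertex and \<open>Pl e \<omega> \<kappa>\<close> for an
      edge.\<close>
    define \<sigma> :: "('v, 'e, 'n) coordinate set \<Rightarrow> ('v, 'e, 'n) coordinate" where
      "\<sigma> B = (SOME k. k \<in> B \<and> ((\<exists>v. k = Pt v \<omega>) \<or> (\<exists>e. k = Pl e \<omega> \<kappa>)))" for B
    have pt: "\<sigma> {Pt v i |i. True} = Pt v \<omega>" for v
      unfolding \<sigma>_def by (rule some_equality) auto
    have pl: "\<sigma> {Pl e i j |i j. True} = Pl e \<omega> \<kappa>" for e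
      unfolding \<sigma>_def by (rule some_equality) auto
    have "\<forall>B\<in>blocks G. \<sigma> B \<in> B"
      unfolding blocks_def ball_Un using pt pl by auto
    then have "affine_smooth (\<Union>(blocks G))
        {z \<in> (\<Union>P\<in>picture_space G. homogeneous_coords G P). \<forall>B\<in>blocks G. z (\<sigma> B) = 1}"
      using smooth unfolding smooth_def multiprojective_smooth_def by blast
    then have "affine_smooth K X"
      unfolding chart_eq_inc_space[OF assms(1) pt pl] Union_blocks .
    with not_affine_smooth[OF e uv \<open>u \<noteq> v\<close> path ind(2,3)] show False by simp
  qed
qed

end
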